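(* For every prime power $q\le 16$, the values of $\bar\alpha(\Gamma_{2,q})$ and $i_V(\Gamma_{2,q})$ are as follows: $$\begin{array}{c|cccccccccc} q & 2&3&4&5&7&8&9&11&13&16\\ \hline \bar\alpha(\Gamma_{2,q}) & 2&3&6&7&13&16&19&28&36&52\\ i_V(\Gamma_{2,q}) & \frac57&\frac{10}{13}&\frac57&\frac{24}{31}&\frac{44}{57}&\frac{57}{73}&\frac{72}{91}&\frac{15}{19}&\frac{49}{61}&\frac{17}{21}\end{array}$$ Moreover, for each such $q$, $$i_V(\Gamma_{2,q}) = 1-\frac{\bar\alpha(\Gamma_{2,q})}{q^2+q+1}.$$
   Context: $\Gamma_{2,q}$ is the point-line incidence graph of the projective plane $\mathrm{PG}(2,q)$: the bipartite graph with bipartition $\{V_1,V_2\}$, where $V_1$ and $V_2$ are the sets of $1$-dimensional and $2$-dimensional linear subspaces of $\mathbb{F}_q^{3}$ respectively, with adjacency given by containment. For a finite graph $\Gamma=(V,E)$ and $X\subseteq V$, the vertex-boundary $N(X)$ is the set of vertices in $V\setminus X$ adjacent to at least one vertex of $X$. The vertex-isoperimetric number of $\Gamma$ is $$i_V(\Gamma)=\min\left\{\frac{|N(X)|}{|X|} : \emptyset\ne X\subseteq V,\ |X|\le \frac{|V|}{2}\right\}.$$ For a bipartite graph $\Gamma$ with bipartition $\{V_1,V_2\}$, $|V_1|=|V_2|$, an incidence-free pair is a pair $(S,T)$ with $S\subseteq V_1$, $T\subseteq V_2$, $|S|=|T|$ and no edge of $\Gamma$ between $S$ and $T$. The incidence-free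 number $\bar\alpha(\Gamma)$ is the maximum of $|S|$ over all incidence-free pairs $(S,T)$; equivalently $\bar\alpha(\Gamma)=\max_{S\subseteq V_1}\min\{|S|,|V_2\setminus N(S)|\}$. *)

theory Defs
  imports "HOL-Analysis.Cartesian_Space" "HOL-Number_Theory.Prime_Powers"
begin

text \<open>
  A finite simple graph is given by its vertex set \<open>V\<close> and its set \<open>E\<close> of edges, an edge being
  the set of its two end-vertices. The minimum and maximum below are meant for finite \<open>V\<close>.
\<close>

definition vertex_boundary :: "'v set \<Rightarrow> 'v set set \<Rightarrow> 'v set \<Rightarrow> 'v set" where
  "vertex_boundary V E X = {v \<in> V - X. \<exists>x\<in>X. {x, v} \<in> E}"

definition vertex_isoperimetric_number :: "'v set \<Rightarrow> 'v set set \<Rightarrow> real" where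
  "vertex_isoperimetric_number V E =
     Min {real (card (vertex_boundary V E X)) / real (card X) | X.
            X \<noteq> {} \<and> X \<subseteq> V \<and> real (card X) \<le> real (card V) / 2}"

definition incidence_free_pair :: "'v set \<Rightarrow> 'v set \<Rightarrow> 'v set set \<Rightarrow> 'v set \<Rightarrow> 'v set \<Rightarrow> bool" where
  "incidence_free_pair V1 V2 E S T \<longleftrightarrow>
     S \<subseteq> V1 \<and> T \<subseteq> V2 \<and> card S = card T \<and> (\<forall>s\<in>S. \<forall>t\<in>T. {s, t} \<notin> E)"

definition incidence_free_number :: "'v set \<Rightarrow> 'v set \<Rightarrow> 'v set set \<Rightarrow> nat" where
  "incidence_free_number V1 V2 E = Max {card S | S T. incidence_free_pair V1 V2 E S T}"

definition PG_points :: "('a::field ^ 3) set set" where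
  "PG_points = {U. vec.subspace U \<and> vec.dim U = 1}"

definition PG_lines :: "('a::field ^ 3) set set" where
  "PG_lines = {U. vec.subspace U \<and> vec.dim U = 2}"

definition PG_edges :: "('a::field ^ 3) set set set" where
  "PG_edges = {{P, L} | P L. P \<in> PG_points \<and> L \<in> PG_lines \<and> P \<subseteq> L}"

text \<open>
  The two invariants of the point-line incidence graph of the projective plane over the
  field \<open>'a\<close>, which is passed as a type argument.
\<close>

definition PG_incidence_free_number :: "'a::field itself \<Rightarrow> nat" where
  "PG_incidence_free_number _ =
     incidence_free_number (PG_points :: ('a ^ 3) set set) PG_lines PG_edges"

definition PG_isoperimetric_number :: "'a::field itself \<Rightarrow> real" where
  "PG_isoperimetric_number _ =
     vertex_isoperimetric_number ((PG_points :: ('a ^ 3) set set) \<union> PG_lines) PG_edges"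

end

theory Submission
  imports Defs "HOL-Analysis.Convex" "HOL-Computational_Algebra.Polynomial"
begin

text \<open>
  Let \<open>N = q\<^sup>2 + q + 1\<close>. If \<open>s\<close> points and \<open>s\<close> lines are pairwise nonincident, then summing \<open>(n - k)(n - k - 1) \<ge> 0\<close>
  over the other \<open>N - s\<close> lines, where \<open>n\<close> is the number of the \<open>s\<close> points on the line, bounds \<open>s\<close> by the
  tabulated value \<open>\<alpha>\<close>, except for \<open>q = 5\<close> and \<open>q = 9\<close>. A configuration with \<open>q = 5\<close>, \<open>s = 8\<close> would contain a 5-arc with two
  completions to a 6-arc. A configuration with \<open>q = 9\<close>, \<open>s = 20\<close> would either extend to a maximal arc of degree 3, excluded
  by a Ceva-type product argument, or yield a triangle of 4-secants and sixteen 2-secants, excluded by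
  evaluating products of linear forms on the resulting ternary codeword. Explicit pairs show that \<open>\<alpha>\<close> is attained.

  If \<open>(S, T)\<close> is an extremal pair, then \<open>S\<close> together with the lines outside \<open>T\<close> has isoperimetric ratio at most
  \<open>1 - \<alpha> / N\<close>. Conversely, a set \<open>A \<union> B\<close> of points and lines with a small boundary gives two disjoint pairs \<open>(A, D)\<close>
  and \<open>(C, B)\<close>, and the bounds for such pairs, together with the lines joining \<open>A\<close> and \<open>C\<close>, show that its ratio is at
  least \<open>1 - \<alpha> / N\<close>.
\<close>

section \<open>Counting in finite projective planes\<close>

text \<open>Cauchy-Schwarz alone gives (s + q)^2 \<le> q (q + 1)^2. For q = 2, 3, 4, 11, 16 this is
  already the tabulated \<alpha>; for q = 4 and q = 16 it holds with equality, which forces a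
  maximal arc. For q = 7, 8, 13 it is one too large, and the integrality in (n - k)(n - k - 1) \<ge>
  0 repairs it. For q = 5 and q = 9 the values s = 8 and s = 20 survive, but the nonnegative terms
  (n - 2)(n - 3) add up to only 2 and 6. So nearly all lines outside the pair meet the points in 2
  or 3 points, and the few exceptions determine the structure. For q = 5 counting in an arbitrary
  plane of that order is enough; for q = 9 the field enters. The obstacle in the isoperimetric part
  is that the extremal set is lopsided: \<alpha> points, N - \<alpha> lines, and \<open>C\<close>
  empty. One inequality for each of the pairs \<open>(A, D)\<close> and \<open>(C, B)\<close> is
  enough only while \<open>A\<close> and \<open>B\<close> have at most about N / 2 elements. Beyond
  that, \<open>C\<close> empty is settled by the definition of \<alpha>, and the delicate case is
  \<open>C\<close> small but nonempty. There the rounded bounds on the pairs must be combined with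
  the lines joining \<open>A\<close> and \<open>C\<close>.\<close>

definition pts_on :: "('p \<Rightarrow> 'l \<Rightarrow> bool) \<Rightarrow> 'p set \<Rightarrow> 'l \<Rightarrow> nat" where
  "pts_on inc A l = card {p \<in> A. inc p l}"

text \<open>The axioms come in dual pairs and are stated as cardinalities, so exchanging points and
  lines gives another instance and every count can be used on either side.\<close>

locale proj_plane =
  fixes Pts :: "'p set" and Lns :: "'l set" and inc :: "'p \<Rightarrow> 'l \<Rightarrow> bool" and q :: nat
  assumes finite_Pts: "finite Pts" and finite_Lns: "finite Lns"
    and card_Pts: "card Pts = q^2 + q + 1" and card_Lns: "card Lns = q^2 + q + 1"
    and card_line: "l \<in> Lns \<Longrightarrow> card {p \<in> Pts. inc p l} = q + 1"
    and card_pencil: "p \<in> Pts \<Longrightarrow> card {l \<in> Lns. inc p l} = q + 1"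
    and join: "p \<in> Pts \<Longrightarrow> p' \<in> Pts \<Longrightarrow> p \<noteq> p' \<Longrightarrow> card {l \<in> Lns. inc p l \<and> inc p' l} = 1"
    and meet: "l \<in> Lns \<Longrightarrow> l' \<in> Lns \<Longrightarrow> l \<noteq> l' \<Longrightarrow> card {p \<in> Pts. inc p l \<and> inc p l'} = 1"
    and q_ge_2: "2 \<le> q"
begin

lemma dual: "proj_plane Lns Pts (\<lambda>l p. inc p l) q"
  using finite_Pts finite_Lns card_Pts card_Lns card_line card_pencil join meet q_ge_2
  by unfold_locales auto

abbreviation N :: nat where "N \<equiv> q^2 + q + 1"

text \<open>The two sides may differ in size: the isoperimetric argument needs the bounds for the
  unequal pairs \<open>(A, D)\<close> and \<open>(C, B)\<close>.\<close>

definition disjoint_pair :: "'p set \<Rightarrow> 'l set \<Rightarrow> bool" where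
  "disjoint_pair A D \<longleftrightarrow> A \<subseteq> Pts \<and> D \<subseteq> Lns \<and> (\<forall>p\<in>A. \<forall>l\<in>D. \<not> inc p l)"

lemma sum_pts_on_subset:
  assumes "A \<subseteq> Pts" "K \<subseteq> Lns"
  shows "(\<Sum>l\<in>K. pts_on inc A l) = (\<Sum>p\<in>A. card {l \<in> K. inc p l})"
proof -
  have fin: "finite A" "finite K" using assms finite_Pts finite_Lns finite_subset by blast+
  have "(\<Sum>l\<in>K. pts_on inc A l) = (\<Sum>l\<in>K. \<Sum>p\<in>A. if inc p l then 1 else 0)"
    using fin by (intro sum.cong) (auto simp: pts_on_def sum.If_cases Collect_conj_eq Int_commute)
  also have "\<dots> = (\<Sum>p\<in>A. \<Sum>l\<in>K. if inc p l then 1 else 0)" by (rule sum.swap)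
  also have "\<dots> = (\<Sum>p\<in>A. card {l \<in> K. inc p l})"
    using fin by (intro sum.cong) (auto simp: sum.If_cases Collect_conj_eq Int_commute)
  finally show ?thesis .
qed

lemma sum_pts_on: "A \<subseteq> Pts \<Longrightarrow> (\<Sum>l\<in>Lns. pts_on inc A l) = card A * (q + 1)"
  using sum_pts_on_subset[of A Lns] card_pencil by (simp add: subset_iff)

lemma sum_pts_on_pencil:
  assumes A: "A \<subseteq> Pts" and p: "p \<in> Pts"
  shows "(\<Sum>l | l \<in> Lns \<and> inc p l. pts_on inc A l) = card A + (if p \<in> A then q else 0)"
proof -
  have fA: "finite A" using A finite_Pts finite_subset by blast
  have "(\<Sum>l | l \<in> Lns \<and> inc p l. pts_on inc A l)
      = (\<Sum>p'\<in>A. card {l \<in> {l \<in> Lns. inc p l}. inc p' l})"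
    using A by (intro sum_pts_on_subset) auto
  also have "\<dots> = (\<Sum>p'\<in>A. if p' = p then q + 1 else 1)"
  proof (rule sum.cong)
    fix p' assume "p' \<in> A"
    then have p': "p' \<in> Pts" using A by blast
    show "card {l \<in> {l \<in> Lns. inc p l}. inc p' l} = (if p' = p then q + 1 else 1)"
      using card_pencil[OF p] join[OF p p'] by (auto simp: conj_ac)
  qed simp
  also have "\<dots> = (\<Sum>p'\<in>A. 1 + (if p' = p then q else 0))" by (rule sum.cong) auto
  also have "\<dots> = card A + (if p \<in> A then q else 0)"
    using fA by (simp only: sum.distrib) (simp add: sum.delta)
  finally show ?thesis .
qed

text \<open>One factor of the square counts the points of \<open>A\<close> on the line; exchanging
  the sums leaves a pencil sum \<open>card A + q\<close> at each point of \<open>A\<close>.\<close>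

lemma sum_pts_on_sq:
  assumes A: "A \<subseteq> Pts"
  shows "(\<Sum>l\<in>Lns. (pts_on inc A l)^2) = card A * (card A + q)"
proof -
  have fA: "finite A" using A finite_Pts finite_subset by blast
  have "(\<Sum>l\<in>Lns. (pts_on inc A l)^2) = (\<Sum>l\<in>Lns. \<Sum>p | p \<in> A \<and> inc p l. pts_on inc A l)"
    by (simp add: pts_on_def power2_eq_square)
  also have "\<dots> = (\<Sum>p\<in>A. \<Sum>l | l \<in> Lns \<and> inc p l. pts_on inc A l)"
    using fA finite_Lns by (rule sum.swap_restrict[symmetric])
  also have "\<dots> = (\<Sum>p\<in>A. card A + q)"
    using A by (intro sum.cong) (auto simp: sum_pts_on_pencil[OF A] subset_iff)
  finally show ?thesis by simp
qed

lemma disjoint_pair_mono: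
  "disjoint_pair A D \<Longrightarrow> A' \<subseteq> A \<Longrightarrow> D' \<subseteq> D \<Longrightarrow> disjoint_pair A' D'"
  unfolding disjoint_pair_def by blast

lemma disjoint_pair_finite: "disjoint_pair A D \<Longrightarrow> finite A \<and> finite D"
  unfolding disjoint_pair_def using finite_Pts finite_Lns finite_subset by metis

lemma pts_on_zero: "disjoint_pair A D \<Longrightarrow> l \<in> D \<Longrightarrow> pts_on inc A l = 0"
  by (auto simp: disjoint_pair_def pts_on_def card_eq_0_iff)

text \<open>Lines of \<open>D\<close> carry no point of \<open>A\<close>, so both moments are
  concentrated on the other lines. This is the source of all bounds on pairs.\<close>

lemma sums_outside:
  assumes "disjoint_pair A D"
  shows "(\<Sum>l\<in>Lns - D. pts_on inc A l) = card A * (q + 1)"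
    and "(\<Sum>l\<in>Lns - D. (pts_on inc A l)^2) = card A * (card A + q)"
    and "card (Lns - D) + card D = N"
proof -
  have D: "D \<subseteq> Lns" and A: "A \<subseteq> Pts" using assms by (auto simp: disjoint_pair_def)
  show "(\<Sum>l\<in>Lns - D. pts_on inc A l) = card A * (q + 1)"
    using sum_pts_on[OF A] D pts_on_zero[OF assms]
    by (subst sum.mono_neutral_left[of Lns]) (auto simp: finite_Lns)
  show "(\<Sum>l\<in>Lns - D. (pts_on inc A l)^2) = card A * (card A + q)"
    using sum_pts_on_sq[OF A] D pts_on_zero[OF assms]
    by (subst sum.mono_neutral_left[of Lns]) (auto simp: finite_Lns)
  show "card (Lns - D) + card D = N"
    using D finite_Lns card_Lns card_mono by (metis card_Diff_subset finite_subset le_add_diff_inverse2)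
qed

text \<open>Summing \<open>(n - k)(n - k - 1) \<ge> 0\<close> over the lines outside \<open>D\<close>.\<close>
lemma disjoint_pair_quadratic:
  assumes "disjoint_pair A D"
  shows "(2*k+1) * int (card A) * (int q + 1)
           \<le> int (card A) * (int (card A) + int q) + k * (k+1) * (int N - int (card D))"
proof -
  let ?n = "\<lambda>l. int (pts_on inc A l)"
  have "0 \<le> (\<Sum>l\<in>Lns - D. (?n l - k) * (?n l - (k+1)))"
  proof (rule sum_nonneg)
    fix l
    have "?n l \<le> k \<or> k + 1 \<le> ?n l" by linarith
    then show "0 \<le> (?n l - k) * (?n l - (k+1))"
      by (auto intro: mult_nonneg_nonneg mult_nonpos_nonpos)
  qed
  also have "\<dots> = (\<Sum>l\<in>Lns - D. (?n l)^2 - (2*k+1) * ?n l + k*(k+1))"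
    by (intro sum.cong) (auto simp: algebra_simps power2_eq_square)
  also have "\<dots> = int (\<Sum>l\<in>Lns - D. (pts_on inc A l)^2) - (2*k+1) * int (\<Sum>l\<in>Lns - D. pts_on inc A l)
      + k*(k+1) * int (card (Lns - D))"
    by (simp add: sum.distrib sum_subtractf sum_distrib_left)
  also have "int (card (Lns - D)) = int N - int (card D)"
    using sums_outside(3)[OF assms] by linarith
  finally show ?thesis by (simp only: sums_outside(1,2)[OF assms]) (simp add: algebra_simps)
qed

lemma disjoint_pair_cauchy:
  assumes "disjoint_pair A D"
  shows "card A * (q + 1)^2 \<le> (N - card D) * (card A + q)"
proof (cases "card A = 0")
  case False
  have c: "card (Lns - D) = N - card D" using sums_outside(3)[OF assms] by linarith
  have "(\<Sum>l\<in>Lns - D. pts_on inc A l * 1)^2 \<le> (\<Sum>l\<in>Lns - D. (pts_on inc A l)^2) * (\<Sum>l\<in>Lns - D. 1^2)"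
  proof -
    have "(\<Sum>l\<in>Lns - D. real (pts_on inc A l) * 1)^2
        \<le> (\<Sum>l\<in>Lns - D. (real (pts_on inc A l))^2) * (\<Sum>l\<in>Lns - D. 1^2)"
      by (rule Cauchy_Schwarz_ineq_sum)
    then have "real ((\<Sum>l\<in>Lns - D. pts_on inc A l * 1)^2)
        \<le> real ((\<Sum>l\<in>Lns - D. (pts_on inc A l)^2) * (\<Sum>l\<in>Lns - D. 1^2))"
      by simp
    then show ?thesis by linarith
  qed
  then have "(card A * (q + 1))^2 \<le> card A * (card A + q) * (N - card D)"
    using sums_outside(1,2)[OF assms] c by (simp del: power_Suc)
  then have "card A * (card A * (q+1)^2) \<le> card A * ((N - card D) * (card A + q))"
    by (simp only: power_mult_distrib power2_eq_square mult_ac)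
  then show ?thesis using False by simp
qed simp

end

section \<open>The isoperimetric inequality\<close>

text \<open>Here \<open>k\<close> is the rounded-down average number of points of \<open>A\<close> on the lines outside \<open>D\<close>, the choice
  for which \<open>disjoint_pair_quadratic\<close> is sharpest.\<close>
definition violates_quadratic :: "int \<Rightarrow> int \<Rightarrow> int \<Rightarrow> bool" where
  "violates_quadratic q a d \<longleftrightarrow>
     (let N = q*q+q+1; k = a*(q+1) div (N - d)
      in a*(a+q) + k*(k+1)*(N - d) < (2*k+1)*a*(q+1))"

text \<open>The quadratic test is applied to both sides because it is not symmetric: for q = 3,
  three points and five lines are excluded by counting points on lines, but not by the dual
  count.\<close>

definition excluded :: "int \<Rightarrow> int \<Rightarrow> int \<Rightarrow> int \<Rightarrow> bool" where
  "excluded q \<alpha> a d \<longleftrightarrow>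
     \<alpha> < a \<and> \<alpha> < d \<or> violates_quadratic q a d \<or> violates_quadratic q d a"

text \<open>Only \<open>m\<close> itself is tested: sizes are integers, so an upper bound that
  cannot be attained drops by one.\<close>

definition refine_bound :: "int \<Rightarrow> int \<Rightarrow> int \<Rightarrow> int \<Rightarrow> int" where
  "refine_bound q \<alpha> d m = (if 0 \<le> m \<and> excluded q \<alpha> m d then m - 1 else m)"

text \<open>An upper bound for \<open>card A\<close> over the disjoint pairs \<open>(A, D)\<close> with \<open>card D = d\<close>. The initial value is
  the Cauchy-Schwarz bound \<open>(card A + q) (d + q) \<le> q (q + 1)\<^sup>2\<close>; two refinements turn out to be enough.\<close>
definition partner_bound :: "int \<Rightarrow> int \<Rightarrow> int \<Rightarrow> int" where
  "partner_bound q \<alpha> d =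
     refine_bound q \<alpha> d (refine_bound q \<alpha> d (q*(q+1)*(q+1) div (d+q) - q))"

text \<open>Let \<open>X = A \<union> B\<close> violate the isoperimetric inequality, let \<open>C\<close> and \<open>D\<close> be the points and lines neither in
  \<open>X\<close> nor adjacent to it, and let \<open>r\<close> be the number of lines outside \<open>B \<union> D\<close>. Then \<open>card A \<ge> \<alpha> + 1 - card C + r\<close>.
  Each point of \<open>C\<close> is on at least \<open>g\<close> of those \<open>r\<close> lines, and two points of \<open>C\<close> share at most one line, so
  a lower bound \<open>a\<close> for \<open>card A\<close> improves to \<open>low_step q \<alpha> (card C) a\<close>.\<close>
definition low_step :: "int \<Rightarrow> int \<Rightarrow> int \<Rightarrow> int \<Rightarrow> int" where
  "low_step q \<alpha> c a =
     (let g = - ((- a) div (if q < \<alpha> + 1 - c then q - 1 else q))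
      in \<alpha> + 1 - c + (if c = 1 then g else 2*g - 1))"

text \<open>The starting value comes from \<open>r \<ge> 0\<close>. A larger \<open>A\<close> needs
  more lines joining it to \<open>C\<close>, hence a larger \<open>r\<close>, hence a larger
  \<open>A\<close> again; three rounds of this feedback are enough for all ten orders.\<close>

definition low_bound :: "int \<Rightarrow> int \<Rightarrow> int \<Rightarrow> int" where
  "low_bound q \<alpha> c =
     low_step q \<alpha> c (low_step q \<alpha> c (low_step q \<alpha> c (\<alpha> + 1 - c)))"

text \<open>The threshold \<open>t0\<close> is the size of \<open>A\<close> and \<open>B\<close> up to which the Cauchy-Schwarz bound alone suffices.
  For larger \<open>B\<close> the set \<open>C\<close> is small, and finitely many values of \<open>c = card C\<close> and \<open>d = card D\<close> remain.\<close>
definition isoperimetric_check :: "int \<Rightarrow> int \<Rightarrow> int \<Rightarrow> bool" where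
  "isoperimetric_check q \<alpha> t0 \<longleftrightarrow>
     (let N = q*q+q+1 in
      0 < \<alpha> \<and> \<alpha> \<le> t0 \<and> t0 \<le> N \<and> (N - \<alpha>) * (q + t0) \<le> (N - t0) * N \<and>
      (\<forall>c\<in>set [1..partner_bound q \<alpha> (t0 + 1)].
       let mc = partner_bound q \<alpha> c in
       \<forall>d\<in>set [\<alpha> + 1 - c..partner_bound q \<alpha> (low_bound q \<alpha> c)].
         (mc + partner_bound q \<alpha> d) * (2*N - \<alpha>) \<le> N * (2*N - c - d)))"

section \<open>Pencils at points outside a disjoint pair\<close>

context proj_plane begin

text \<open>Project \<open>A\<close> from \<open>p\<close>: every point of \<open>A\<close> lies on
  a line joining it to \<open>p\<close>, and such a line has \<open>q\<close> points besides
  \<open>p\<close>. If \<open>D\<close> has more than \<open>q\<close> lines, one of them misses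
  \<open>p\<close> and cuts the joining line in a further point, which is not in
  \<open>A\<close>.\<close>

lemma card_le_pencil:
  assumes AD: "disjoint_pair A D" and p: "p \<in> Pts" "p \<notin> A"
    and w: "w = q \<or> w = q - 1 \<and> q < card D"
  shows "card A \<le> card {l \<in> Lns. inc p l \<and> (\<exists>a\<in>A. inc a l)} * w"
proof -
  define J where "J = {l \<in> Lns. inc p l \<and> (\<exists>a\<in>A. inc a l)}"
  have A: "A \<subseteq> Pts" and D: "D \<subseteq> Lns" using AD by (auto simp: disjoint_pair_def)
  have fJ: "finite J" and fP: "finite {l \<in> Lns. inc p l}" unfolding J_def using finite_Lns by auto
  have cov: "A \<subseteq> (\<Union>l\<in>J. {x \<in> A. inc x l})"
  proof
    fix x assume x: "x \<in> A"
    then have "x \<in> Pts" "x \<noteq> p" using A p by auto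
    then have "{l \<in> Lns. inc p l \<and> inc x l} \<noteq> {}" using join[of p x] p by force
    then show "x \<in> (\<Union>l\<in>J. {x \<in> A. inc x l})" using x by (auto simp: J_def)
  qed
  have "card {x \<in> A. inc x l} \<le> w" if l: "l \<in> J" for l
  proof -
    have lL: "l \<in> Lns" "inc p l" using l by (auto simp: J_def)
    have c: "card {x \<in> Pts. inc x l} = q + 1" using card_line lL by blast
    have fin: "finite {x \<in> Pts. inc x l}" using finite_Pts by auto
    have "card ({x \<in> Pts. inc x l} - {p}) = q" using c p lL fin by (simp add: card_Diff_singleton)
    moreover have "{x \<in> A. inc x l} \<subseteq> {x \<in> Pts. inc x l} - {p}" using A p by auto
    ultimately have le_q: "card {x \<in> A. inc x l} \<le> q"
      using card_mono[OF finite_Diff[OF fin]] by metis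
    show ?thesis
    proof (cases "q < card D")
      case True
      \<comment> \<open>At most \<open>q\<close> lines of \<open>D\<close> pass through
        \<open>p\<close>, since the pencil has \<open>q + 1\<close> lines and \<open>l\<close> meets
        \<open>A\<close>.\<close>
      have "card (D \<inter> {l \<in> Lns. inc p l}) \<le> card ({l \<in> Lns. inc p l} - {l})"
      proof (rule card_mono)
        show "D \<inter> {l \<in> Lns. inc p l} \<subseteq> {l \<in> Lns. inc p l} - {l}"
          using l AD by (auto simp: J_def disjoint_pair_def)
      qed (use finite_Lns in auto)
      also have "\<dots> = q" using card_pencil[OF p(1)] lL fP by (simp add: card_Diff_singleton)
      finally have "\<not> D \<subseteq> {l \<in> Lns. inc p l}" using True by (auto simp: Int_absorb2)
      then obtain m where m: "m \<in> D" "\<not> inc p m" using D by auto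
      then have "card {x \<in> Pts. inc x l \<and> inc x m} = 1" using meet[of l m] lL D by auto
      then obtain z where z: "{x \<in> Pts. inc x l \<and> inc x m} = {z}" by (rule card_1_singletonE)
      have zl: "z \<in> Pts" "inc z l" "inc z m" using z by auto
      then have "z \<notin> A" using m AD by (auto simp: disjoint_pair_def)
      then have "{x \<in> A. inc x l} \<subseteq> {x \<in> Pts. inc x l} - {p, z}" using A p by auto
      moreover have "card ({x \<in> Pts. inc x l} - {p, z}) = q - 1"
      proof -
        have "{p, z} \<subseteq> {x \<in> Pts. inc x l}" "p \<noteq> z" using p lL m zl by auto
        then show ?thesis using c fin by (simp add: card_Diff_subset)
      qed
      ultimately have "card {x \<in> A. inc x l} \<le> q - 1"
        using card_mono[OF finite_Diff[OF fin]] by metis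
      then show ?thesis using w by auto
    qed (use w le_q in auto)
  qed
  then have "(\<Sum>l\<in>J. card {x \<in> A. inc x l}) \<le> card J * w"
    using sum_bounded_above[of J "\<lambda>l. card {x \<in> A. inc x l}" w] by simp
  moreover have "card A \<le> card (\<Union>l\<in>J. {x \<in> A. inc x l})"
    using cov fJ disjoint_pair_finite[OF AD] by (intro card_mono) auto
  moreover have "\<dots> \<le> (\<Sum>l\<in>J. card {x \<in> A. inc x l})" using fJ by (rule card_UN_le)
  ultimately show ?thesis unfolding J_def by linarith
qed

text \<open>A line through a point of \<open>C\<close> that meets \<open>A\<close> belongs to
  neither \<open>B\<close> nor \<open>D\<close>. For two points of \<open>C\<close>, the two sets of
  such lines share at most the line joining the points, which gives
  \<open>2 * g - 1\<close>.\<close>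

lemma separated_pencils:
  assumes AD: "disjoint_pair A D" and CB: "disjoint_pair C B"
    and AC: "A \<inter> C = {}" and w: "w = q \<or> w = q - 1 \<and> q < card D" and C: "card C \<ge> 1"
  shows "\<exists>g. card A \<le> g * w \<and> g \<le> card (Lns - B - D) \<and>
             (card C \<ge> 2 \<longrightarrow> 2 * g \<le> card (Lns - B - D) + 1)"
proof -
  define J where "J = (\<lambda>p. {l \<in> Lns. inc p l \<and> (\<exists>a\<in>A. inc a l)})"
  have J: "J p \<subseteq> Lns - B - D" if "p \<in> C" for p
    using that AD CB by (auto simp: J_def disjoint_pair_def)
  have le: "card A \<le> card (J p) * w" if "p \<in> C" for p
    unfolding J_def using that AC CB w by (intro card_le_pencil[OF AD]) (auto simp: disjoint_pair_def)
  have fin: "finite (Lns - B - D)" "finite (J p)" for p using finite_Lns by (auto simp: J_def)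
  obtain p where p: "p \<in> C" using C by fastforce
  show ?thesis
  proof (cases "card C \<ge> 2")
    case True
    then have "card (C - {p}) \<ge> 1" using p by (simp add: card_Diff_singleton_if)
    then have "C - {p} \<noteq> {}" by (metis card.empty not_one_le_zero)
    then obtain p' where p': "p' \<in> C" "p' \<noteq> p" by blast
    define g where "g = min (card (J p)) (card (J p'))"
    have "card (J p \<inter> J p') \<le> card {l \<in> Lns. inc p l \<and> inc p' l}"
      using finite_Lns by (intro card_mono) (auto simp: J_def)
    also have "\<dots> = 1" using p p' CB by (intro join) (auto simp: disjoint_pair_def)
    finally have "card (J p) + card (J p') \<le> card (J p \<union> J p') + 1"
      using card_Un_Int[OF fin(2) fin(2), of p p'] by linarith
    moreover have "card (J p \<union> J p') \<le> card (Lns - B - D)"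
      using J p p' fin by (intro card_mono) auto
    ultimately have "2 * g \<le> card (Lns - B - D) + 1" unfolding g_def by linarith
    moreover have "card A \<le> g * w" using le[OF p] le[OF p'(1)] by (auto simp: g_def min_def)
    moreover have "g \<le> card (Lns - B - D)"
      unfolding g_def using card_mono[OF fin(1) J[OF p]] by linarith
    ultimately show ?thesis by blast
  next
    case False
    then show ?thesis using le[OF p] card_mono[OF fin(1) J[OF p]] by blast
  qed
qed

lemma violates_quadratic_sound:
  assumes "disjoint_pair A D"
  shows "\<not> violates_quadratic (int q) (int (card A)) (int (card D))"
proof
  assume "violates_quadratic (int q) (int (card A)) (int (card D))"
  then obtain k where "int (card A) * (int (card A) + int q)
      + k * (k+1) * (int q * int q + int q + 1 - int (card D)) < (2*k+1) * int (card A) * (int q + 1)"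
    unfolding violates_quadratic_def Let_def by blast
  with disjoint_pair_quadratic[OF assms, of k] show False
    by (simp add: power2_eq_square add_ac)
qed

end

text \<open>The bound is kept as an assumption because it is proved differently for different
  orders, whereas the isoperimetric inequality is derived from it uniformly.\<close>

locale bounded_plane = proj_plane +
  fixes \<alpha> :: nat
  assumes \<alpha>_bound: "disjoint_pair A D \<Longrightarrow> card A \<le> \<alpha> \<or> card D \<le> \<alpha>"
begin

lemma disjoint_pair_dual:
  "proj_plane.disjoint_pair Lns Pts (\<lambda>l p. inc p l) D A \<longleftrightarrow> disjoint_pair A D"
  unfolding disjoint_pair_def proj_plane.disjoint_pair_def[OF dual] by blast

lemma bounded_dual: "bounded_plane Lns Pts (\<lambda>l p. inc p l) q \<alpha>"
proof -
  interpret d: proj_plane Lns Pts "\<lambda>l p. inc p l" q by (rule dual)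
  show ?thesis using \<alpha>_bound by unfold_locales (auto simp: disjoint_pair_dual)
qed

lemma excluded_sound:
  assumes "disjoint_pair A D"
  shows "\<not> excluded (int q) (int \<alpha>) (int (card A)) (int (card D))"
  using \<alpha>_bound[OF assms] violates_quadratic_sound[OF assms]
    proj_plane.violates_quadratic_sound[OF dual, of D A] disjoint_pair_dual[of D A] assms
  by (auto simp: excluded_def)

lemma refine_bound_sound:
  assumes AD: "disjoint_pair A D" and d: "0 \<le> d" "d \<le> int (card D)" and m: "int (card A) \<le> m"
  shows "int (card A) \<le> refine_bound (int q) (int \<alpha>) d m"
proof (cases "int (card A) = m")
  case True
  \<comment> \<open>The exclusion is tested for exactly \<open>d\<close> lines, while
    \<open>D\<close> may have more; a subset of the right size is again part of a disjoint
    pair.\<close>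
  obtain D' where D': "D' \<subseteq> D" "card D' = nat d"
    using d by (meson nat_le_iff obtain_subset_with_card_n)
  then have "disjoint_pair A D'" using disjoint_pair_mono[OF AD] by blast
  from excluded_sound[OF this] show ?thesis using D' d True by (auto simp: refine_bound_def)
qed (use m in \<open>auto simp: refine_bound_def\<close>)

text \<open>Any lower bound \<open>d\<close> for \<open>card D\<close> is allowed, since in the
  applications the size of the partner is often known only from below.\<close>

lemma partner_bound_sound:
  assumes AD: "disjoint_pair A D" and d: "0 \<le> d" "d \<le> int (card D)"
  shows "int (card A) \<le> partner_bound (int q) (int \<alpha>) d"
  unfolding partner_bound_def
proof (intro refine_bound_sound[OF AD d])
  let ?a = "int (card A)" and ?d = "int (card D)" and ?q = "int q"
  have "int (card A * (q + 1)^2) \<le> int ((N - card D) * (card A + q))"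
    using disjoint_pair_cauchy[OF AD] by (simp only: of_nat_le_iff)
  also have "\<dots> = (?q^2 + ?q + 1 - ?d) * (?a + ?q)"
    using sums_outside(3)[OF AD] by (simp add: of_nat_diff)
  finally have "?a * (?q+1)^2 \<le> (?q^2 + ?q + 1 - ?d) * (?a + ?q)" by (simp add: algebra_simps)
  then have "(?a + ?q) * (?d + ?q) \<le> ?q * (?q+1) * (?q+1)"
    by (simp add: algebra_simps power2_eq_square)
  moreover have "(?a + ?q) * (d + ?q) \<le> (?a + ?q) * (?d + ?q)" using d by (intro mult_left_mono) auto
  ultimately have "(?a + ?q) * (d + ?q) \<le> ?q * (?q+1) * (?q+1)" by linarith
  moreover have "0 < d + ?q" using d q_ge_2 by linarith
  ultimately have "?a + ?q \<le> ?q*(?q+1)*(?q+1) div (d + ?q)"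
    using zdiv_mono1[of "(?a + ?q) * (d + ?q)" "?q*(?q+1)*(?q+1)" "d + ?q"] by simp
  then show "?a \<le> ?q*(?q+1)*(?q+1) div (d + ?q) - ?q" by linarith
qed

lemma low_bound_sound:
  assumes AD: "disjoint_pair A D" and CB: "disjoint_pair C B" and AC: "A \<inter> C = {}"
    and r: "int \<alpha> + 1 - int (card C) + int (card (Lns - B - D)) \<le> int (card A)"
    and d: "int \<alpha> + 1 - int (card C) \<le> int (card D)" and c: "1 \<le> card C"
  shows "low_bound (int q) (int \<alpha>) (int (card C)) \<le> int (card A)"
proof -
  have step: "low_step (int q) (int \<alpha>) (int (card C)) a \<le> int (card A)" if a: "a \<le> int (card A)" for a
  proof -
    define w where "w = (if int q < int \<alpha> + 1 - int (card C) then q - 1 else q)"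
    \<comment> \<open>The definition of \<open>low_step\<close> can only test
      \<open>\<alpha> + 1 - c\<close>; by the assumption \<open>d\<close> this number is a lower
      bound for \<open>card D\<close>.\<close>
    have "w = q \<or> w = q - 1 \<and> q < card D" using d by (auto simp: w_def)
    from separated_pencils[OF AD CB AC this c]
    obtain g where g: "card A \<le> g * w" "g \<le> card (Lns - B - D)"
      "card C \<ge> 2 \<Longrightarrow> 2 * g \<le> card (Lns - B - D) + 1" by blast
    have w: "int w > 0" "int w = (if int q < int \<alpha> + 1 - int (card C) then int q - 1 else int q)"
      using q_ge_2 by (auto simp: w_def)
    have "a \<le> int g * int w" using a g(1) by (metis of_nat_le_iff of_nat_mult order_trans)
    \<comment> \<open>The sign changes turn the rounding of \<open>div\<close> upwards:
      \<open>- ((- a) div w)\<close> is the ceiling of \<open>a / w\<close>.\<close>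
    then have "- int g * int w \<le> - a" by simp
    then have "- int g \<le> (- a) div int w"
      using zdiv_mono1[of "- int g * int w" "- a" "int w"] w(1)
        nonzero_mult_div_cancel_right[of "int w" "- int g"] by linarith
    then have "- ((- a) div int w) \<le> int g" by simp
    then show ?thesis
      unfolding low_step_def Let_def w(2)[symmetric] using g(2,3) r c by (cases "card C = 1") auto
  qed
  show ?thesis unfolding low_bound_def using r by (intro step) linarith
qed

text \<open>Needed because \<open>partner_bound_sound\<close> is applied with this bound in place of
  \<open>d\<close>.\<close>

lemma low_bound_nonneg:
  assumes "c \<le> int \<alpha>"
  shows "0 \<le> low_bound (int q) (int \<alpha>) c"
proof -
  have step: "0 \<le> low_step (int q) (int \<alpha>) c a" if "0 \<le> a" for a
  proof -
    have "(- a) div (if int q < int \<alpha> + 1 - c then int q - 1 else int q) \<le> 0"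
      using that q_ge_2 by (intro div_nonpos_pos_le0) auto
    then show ?thesis using assms unfolding low_step_def Let_def by (cases "c = 1") auto
  qed
  show ?thesis unfolding low_bound_def using assms by (intro step) linarith
qed

lemma card_outside:
  assumes "A \<subseteq> Pts" "C \<subseteq> Pts" "A \<inter> C = {}"
  shows "int (card (Pts - A - C)) = int N - int (card A) - int (card C)"
proof -
  have "finite A" "finite C" using assms finite_Pts finite_subset by blast+
  then have "card (A \<union> C) = card A + card C" using assms by (intro card_Un_disjoint)
  moreover have "card (Pts - (A \<union> C)) = card Pts - card (A \<union> C)" "card (A \<union> C) \<le> card Pts"
    using assms \<open>finite A\<close> \<open>finite C\<close> finite_Pts by (auto intro!: card_Diff_subset card_mono)
  moreover have "Pts - A - C = Pts - (A \<union> C)" by blast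
  ultimately show ?thesis using card_Pts by simp
qed

text \<open>A violation forces \<open>c + d > \<alpha>\<close> and a lower bound on
  \<open>a\<close>. If \<open>c = 0\<close>, then both \<open>a\<close> and \<open>d\<close> exceed
  \<alpha>, which is impossible for the pair \<open>(A, D)\<close>. Otherwise \<open>b > t0\<close>
  bounds \<open>c\<close> from above and \<open>low_bound\<close> bounds \<open>a\<close> from
  below, so \<open>c\<close> and \<open>d\<close> lie in the range searched by the check, which
  contradicts the violation.\<close>

lemma isoperimetric_large:
  assumes AD: "disjoint_pair A D" and CB: "disjoint_pair C B"
    and AC: "A \<inter> C = {}" and BD: "B \<inter> D = {}" and ab: "card A + card B \<le> N"
    and check: "isoperimetric_check (int q) (int \<alpha>) (int t0)" and t0: "t0 < card B"
  shows "(int (card A) + int (card B)) * (int N - int \<alpha>)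
     \<le> int N * (2 * int N - int (card A) - int (card B) - int (card C) - int (card D))"
proof (rule ccontr)
  define a b c d where "a = int (card A)" and "b = int (card B)" and "c = int (card C)"
    and "d = int (card D)"
  define M where "M = int N"
  define pb where "pb = partner_bound (int q) (int \<alpha>)"
  note defs = a_def b_def c_def d_def M_def pb_def
  assume "\<not> ?thesis"
  then have viol: "M * (2 * M - a - b - c - d) < (a + b) * (M - int \<alpha>)" by (simp add: defs)
  have M: "M = int q * int q + int q + 1" by (simp add: M_def power2_eq_square)
  interpret dl: bounded_plane Lns Pts "\<lambda>l p. inc p l" q \<alpha> by (rule bounded_dual)
  have DA: "dl.disjoint_pair D A" and BC: "dl.disjoint_pair B C"
    using AD CB disjoint_pair_dual by auto
  have pos: "0 < M" "0 \<le> a" "0 \<le> b" "0 \<le> c" "0 \<le> d"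
    unfolding defs of_nat_0_less_iff by auto
  have abM: "a + b \<le> M" unfolding defs using ab by linarith
  have chk: "int \<alpha> \<le> int t0" "int t0 \<le> M"
    "\<And>c d. 1 \<le> c \<Longrightarrow> c \<le> pb (int t0 + 1) \<Longrightarrow> int \<alpha> + 1 - c \<le> d \<Longrightarrow>
       d \<le> pb (low_bound (int q) (int \<alpha>) c) \<Longrightarrow>
       (pb c + pb d) * (2 * M - int \<alpha>) \<le> M * (2 * M - c - d)"
    using check unfolding isoperimetric_check_def Let_def M[symmetric] pb_def by auto
  have r': "int (card (Lns - B - D)) = M - b - d"
    using dl.card_outside[of B D] AD CB BD by (auto simp: disjoint_pair_def defs)
  have 1: "M * (2 * M - c - d) < (a + b) * (2 * M - int \<alpha>)" using viol by (simp add: algebra_simps)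
  also have "\<dots> \<le> M * (2 * M - int \<alpha>)" using abM chk pos by (intro mult_right_mono) auto
  finally have cd: "int \<alpha> + 1 \<le> c + d" using pos by simp
  \<comment> \<open>Since \<open>a + b \<le> M\<close>, the violation gives
    \<open>2 * M - a - b - c - d < M - \<alpha>\<close>; the number of lines outside
    \<open>B\<close> and \<open>D\<close> is \<open>M - b - d\<close>.\<close>
  note viol
  also have "(a + b) * (M - int \<alpha>) \<le> M * (M - int \<alpha>)" using abM chk by (intro mult_right_mono) auto
  finally have ac: "int \<alpha> + 1 - c + int (card (Lns - B - D)) \<le> a" using pos r' by simp
  have c_le: "c \<le> int \<alpha>" using \<alpha>_bound[OF CB] t0 chk(1) by (auto simp: defs)
  have c_pos: "1 \<le> c"
  proof (rule ccontr)
    assume "\<not> 1 \<le> c"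
    then have "int \<alpha> < a" "int \<alpha> < d" using ac cd pos by linarith+
    then show False using \<alpha>_bound[OF AD] by (auto simp: defs)
  qed
  have low: "low_bound (int q) (int \<alpha>) c \<le> a"
    using low_bound_sound[OF AD CB AC] ac cd c_pos unfolding defs by auto
  have "c \<le> pb (int t0 + 1)"
    using partner_bound_sound[OF CB, of "int t0 + 1"] t0 by (simp add: defs)
  moreover have "d \<le> pb (low_bound (int q) (int \<alpha>) c)"
    using dl.partner_bound_sound[OF DA low_bound_nonneg[OF c_le]] low by (simp add: defs)
  ultimately have "(pb c + pb d) * (2 * M - int \<alpha>) \<le> M * (2 * M - c - d)"
    using chk(3) c_pos cd by simp
  \<comment> \<open>The violation is used in the form obtained by adding \<open>M * (a + b)\<close>
    on both sides, in which \<open>a\<close> and \<open>b\<close> occur only through their sum and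
    can be replaced by upper bounds.\<close>
  also note 1
  also have "(a + b) * (2 * M - int \<alpha>) \<le> (pb c + pb d) * (2 * M - int \<alpha>)"
  proof (rule mult_right_mono)
    have "a \<le> pb d" using partner_bound_sound[OF AD, of d] by (simp add: defs)
    moreover have "b \<le> pb c" using dl.partner_bound_sound[OF BC, of c] by (simp add: defs)
    ultimately show "a + b \<le> pb c + pb d" by linarith
  qed (use chk pos in linarith)
  finally show False by simp
qed

text \<open>As \<open>(q + 1)^2 = N + q\<close>, Cauchy-Schwarz rearranges to
  \<open>b * (M - b) \<le> (M - c - b) * (q + b)\<close>. The threshold condition
  \<open>(M - \<alpha>) * (q + b) \<le> (M - b) * M\<close> holds at \<open>t0\<close> and hence
  below it; combining the two and cancelling \<open>q + b\<close> gives the claim.\<close>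

lemma isoperimetric_half:
  assumes CB: "disjoint_pair C B"
    and check: "isoperimetric_check (int q) (int \<alpha>) (int t0)" and t0: "card B \<le> t0"
  shows "int (card B) * (int N - int \<alpha>) \<le> int N * (int N - int (card C) - int (card B))"
proof -
  define b c M where "b = int (card B)" and "c = int (card C)" and "M = int N"
  have M: "M = int q * int q + int q + 1" by (simp add: M_def power2_eq_square)
  have chk: "int \<alpha> \<le> int t0" "int t0 \<le> M" "(M - int \<alpha>) * (int q + int t0) \<le> (M - int t0) * M"
    using check unfolding isoperimetric_check_def Let_def M[symmetric] by auto
  have b: "0 \<le> b" "b \<le> int t0" using t0 by (auto simp: b_def)
  have "int (card C * (q + 1)^2) \<le> int ((N - card B) * (card C + q))"
    using disjoint_pair_cauchy[OF CB] by (simp only: of_nat_le_iff)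
  also have "int ((N - card B) * (card C + q)) = (int N - int (card B)) * (c + int q)"
    using sums_outside(3)[OF CB] by (simp add: of_nat_diff c_def)
  finally have "c * (int q + 1) * (int q + 1) \<le> (M - b) * (c + int q)"
    by (simp add: c_def M_def b_def power2_eq_square algebra_simps)
  then have "b * (M - b) \<le> (M - c - b) * (int q + b)" by (simp add: M algebra_simps)
  then have "M * (b * (M - b)) \<le> M * ((M - c - b) * (int q + b))"
    by (intro mult_left_mono) (auto simp: M_def)
  moreover have "b * ((M - int \<alpha>) * (int q + b)) \<le> b * ((M - b) * M)"
  proof (rule mult_left_mono)
    have "(M - int \<alpha>) * (int q + b) \<le> (M - int \<alpha>) * (int q + int t0)"
      using b chk by (intro mult_left_mono) auto
    also note chk(3)
    also have "(M - int t0) * M \<le> (M - b) * M" using b by (intro mult_right_mono) (auto simp: M_def)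
    finally show "(M - int \<alpha>) * (int q + b) \<le> (M - b) * M" .
  qed (rule b)
  ultimately have "(b * (M - int \<alpha>)) * (int q + b) \<le> (M * (M - c - b)) * (int q + b)"
    by (simp add: mult_ac)
  moreover have "0 < int q + b" using b q_ge_2 by linarith
  ultimately have "b * (M - int \<alpha>) \<le> M * (M - c - b)" by simp
  then show ?thesis by (simp add: b_def c_def M_def)
qed

text \<open>If both sizes are at most \<open>t0\<close>, the inequality is the sum of one for
  \<open>(C, B)\<close> and one for the dual of \<open>(A, D)\<close>. Otherwise duality makes
  \<open>B\<close> the large side.\<close>

lemma isoperimetric:
  assumes AD: "disjoint_pair A D" and CB: "disjoint_pair C B"
    and AC: "A \<inter> C = {}" and BD: "B \<inter> D = {}" and ab: "card A + card B \<le> N"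
    and check: "isoperimetric_check (int q) (int \<alpha>) (int t0)"
  shows "(int (card A) + int (card B)) * (int N - int \<alpha>)
     \<le> int N * (2 * int N - int (card A) - int (card B) - int (card C) - int (card D))"
proof -
  interpret dl: bounded_plane Lns Pts "\<lambda>l p. inc p l" q \<alpha> by (rule bounded_dual)
  have DA: "dl.disjoint_pair D A" and BC: "dl.disjoint_pair B C"
    using AD CB disjoint_pair_dual by auto
  consider "t0 < card B" | "t0 < card A" | "card A \<le> t0" "card B \<le> t0" by linarith
  then show ?thesis
  proof cases
    case 1
    then show ?thesis by (rule isoperimetric_large[OF AD CB AC BD ab check])
  next
    case 2
    have "card B + card A \<le> N" using ab by simp
    from dl.isoperimetric_large[OF BC DA BD AC this check 2] show ?thesis
      by (simp add: algebra_simps)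
  next
    case 3
    from isoperimetric_half[OF CB check 3(2)] dl.isoperimetric_half[OF DA check 3(1)]
    show ?thesis by (simp add: algebra_simps)
  qed
qed

end

context proj_plane begin

lemma bounded_planeI:
  assumes "\<And>A D. disjoint_pair A D \<Longrightarrow> card A = Suc \<alpha> \<Longrightarrow> card D = Suc \<alpha> \<Longrightarrow> False"
  shows "bounded_plane Pts Lns inc q \<alpha>"
proof unfold_locales
  fix A D assume AD: "disjoint_pair A D"
  show "card A \<le> \<alpha> \<or> card D \<le> \<alpha>"
  proof (rule ccontr)
    assume "\<not> ?thesis"
    then have "Suc \<alpha> \<le> card A" "Suc \<alpha> \<le> card D" by auto
    then obtain A' D' where "A' \<subseteq> A" "card A' = Suc \<alpha>" "D' \<subseteq> D" "card D' = Suc \<alpha>"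
      by (meson obtain_subset_with_card_n)
    then show False using assms disjoint_pair_mono[OF AD] by blast
  qed
qed

lemma bounded_plane_quadratic:
  assumes "violates_quadratic (int q) (int \<alpha> + 1) (int \<alpha> + 1)"
  shows "bounded_plane Pts Lns inc q \<alpha>"
proof (rule bounded_planeI)
  fix A D assume "disjoint_pair A D" "card A = Suc \<alpha>" "card D = Suc \<alpha>"
  with violates_quadratic_sound[of A D] assms show False by (simp add: add.commute)
qed

end

text \<open>In each case \<open>t0\<close> is the largest integer with
  \<open>(N - \<alpha>) * (q + t0) \<le> (N - t0) * N\<close>.\<close>

lemma isoperimetric_checks:
  "isoperimetric_check 2 2 3" "isoperimetric_check 3 3 6" "isoperimetric_check 4 6 10"
  "isoperimetric_check 5 7 15" "isoperimetric_check 7 13 29" "isoperimetric_check 8 16 37"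
  "isoperimetric_check 9 19 46" "isoperimetric_check 11 28 69" "isoperimetric_check 13 36 95"
  "isoperimetric_check 16 52 143"
  by code_simp+

text \<open>The sizes are \<open>\<alpha> + 1\<close>. Orders 5 and 9 are absent because the test
  does not refute them: it compares 242 with 240 and 1006 with 1000.\<close>

lemma violates_quadratic_instances:
  "violates_quadratic 2 3 3" "violates_quadratic 3 4 4" "violates_quadratic 4 7 7"
  "violates_quadratic 7 14 14" "violates_quadratic 8 17 17" "violates_quadratic 11 29 29"
  "violates_quadratic 13 37 37" "violates_quadratic 16 53 53"
  by (simp_all add: violates_quadratic_def)

section \<open>Planes of order 5 and 9\<close>

context proj_plane begin

lemma pts_on_dual: "pts_on (\<lambda>l p. inc p l) K p = card {l \<in> K. inc p l}"
  by (simp add: pts_on_def)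

lemma sum_pts_on_line:
  assumes "K \<subseteq> Lns" "m \<in> Lns"
  shows "(\<Sum>p | p \<in> Pts \<and> inc p m. card {l \<in> K. inc p l}) = card K + (if m \<in> K then q else 0)"
proof -
  interpret d: proj_plane Lns Pts "\<lambda>l p. inc p l" q by (rule dual)
  show ?thesis using d.sum_pts_on_pencil[OF assms] by (simp add: pts_on_dual)
qed

lemma sum_lines_through:
  assumes "K \<subseteq> Lns"
  shows "(\<Sum>p\<in>Pts. card {l \<in> K. inc p l}) = card K * (q + 1)"
    and "(\<Sum>p\<in>Pts. (card {l \<in> K. inc p l})^2) = card K * (card K + q)"
proof -
  interpret d: proj_plane Lns Pts "\<lambda>l p. inc p l" q by (rule dual)
  show "(\<Sum>p\<in>Pts. card {l \<in> K. inc p l}) = card K * (q + 1)"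
    using d.sum_pts_on[OF assms] by (simp add: pts_on_dual)
  show "(\<Sum>p\<in>Pts. (card {l \<in> K. inc p l})^2) = card K * (card K + q)"
    using d.sum_pts_on_sq[OF assms] by (simp add: pts_on_dual)
qed

end

lemma sum_quadratic:
  fixes f :: "'b \<Rightarrow> nat"
  assumes "finite I"
  shows "(\<Sum>x\<in>I. (int (f x) - a) * (int (f x) - b))
    = int (\<Sum>x\<in>I. (f x)^2) - (a + b) * int (\<Sum>x\<in>I. f x) + a * b * int (card I)"
proof -
  have "(\<Sum>x\<in>I. (int (f x) - a) * (int (f x) - b))
      = (\<Sum>x\<in>I. int (f x)^2 - (a + b) * int (f x) + a * b)"
    by (intro sum.cong) (auto simp: algebra_simps power2_eq_square)
  then show ?thesis by (simp add: sum.distrib sum_subtractf sum_distrib_left)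
qed

lemma sum_split_values:
  fixes f :: "'b \<Rightarrow> nat" and g :: "nat \<Rightarrow> nat"
  assumes "finite I" "\<And>x. x \<in> I \<Longrightarrow> f x \<le> n"
  shows "(\<Sum>x\<in>I. g (f x)) = (\<Sum>i\<le>n. g i * card {x \<in> I. f x = i})"
proof -
  have "(\<Sum>x\<in>I. g (f x)) = (\<Sum>i\<le>n. \<Sum>x | x \<in> I \<and> f x = i. g (f x))"
    using assms by (intro sum.group[symmetric]) auto
  also have "\<dots> = (\<Sum>i\<le>n. g i * card {x \<in> I. f x = i})"
    by (intro sum.cong) (auto simp: mult.commute)
  finally show ?thesis .
qed

section \<open>Intersection numbers of a point set with all lines\<close>

context proj_plane begin

text \<open>The standard equations for the numbers of \<open>i\<close>-secants of a point
  set.\<close>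

lemma line_type_sums:
  assumes A: "A \<subseteq> Pts" and le: "\<And>l. l \<in> Lns \<Longrightarrow> pts_on inc A l \<le> n"
  shows "(\<Sum>i\<le>n. card {l \<in> Lns. pts_on inc A l = i}) = N"
    and "(\<Sum>i\<le>n. i * card {l \<in> Lns. pts_on inc A l = i}) = card A * (q + 1)"
    and "(\<Sum>i\<le>n. i^2 * card {l \<in> Lns. pts_on inc A l = i}) = card A * (card A + q)"
  using sum_split_values[OF finite_Lns le, where g = "\<lambda>_. 1"] card_Lns
    sum_split_values[OF finite_Lns le, where g = "\<lambda>i. i"] sum_pts_on[OF A]
    sum_split_values[OF finite_Lns le, where g = "\<lambda>i. i^2"] sum_pts_on_sq[OF A] by simp_all

lemma pencil_type_sums:
  assumes A: "A \<subseteq> Pts" and le: "\<And>l. l \<in> Lns \<Longrightarrow> pts_on inc A l \<le> n" and p: "p \<in> Pts"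
  shows "(\<Sum>i\<le>n. card {l \<in> {l \<in> Lns. pts_on inc A l = i}. inc p l}) = q + 1"
    and "(\<Sum>i\<le>n. i * card {l \<in> {l \<in> Lns. pts_on inc A l = i}. inc p l})
      = card A + (if p \<in> A then q else 0)"
proof -
  have fin: "finite {l \<in> Lns. inc p l}" and le': "\<And>l. l \<in> {l \<in> Lns. inc p l} \<Longrightarrow> pts_on inc A l \<le> n"
    using finite_Lns le by auto
  have eq: "{l \<in> {l \<in> Lns. inc p l}. pts_on inc A l = i} = {l \<in> {l \<in> Lns. pts_on inc A l = i}. inc p l}" for i
    by auto
  show "(\<Sum>i\<le>n. card {l \<in> {l \<in> Lns. pts_on inc A l = i}. inc p l}) = q + 1"
    unfolding eq[symmetric]
    using sum_split_values[where f = "pts_on inc A" and g = "\<lambda>_. 1", OF fin le'] card_pencil[OF p] by simp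
  show "(\<Sum>i\<le>n. i * card {l \<in> {l \<in> Lns. pts_on inc A l = i}. inc p l})
      = card A + (if p \<in> A then q else 0)"
    unfolding eq[symmetric]
    using sum_split_values[where f = "pts_on inc A" and g = "\<lambda>i. i", OF fin le'] sum_pts_on_pencil[OF A p]
    by simp
qed

text \<open>All terms are nonnegative and their total over the lines outside \<open>D\<close> is
  known, so each single term is at most the total. The total is 2 for eight points and lines in
  order 5, and 6 for twenty in order 9, which bounds the intersection numbers.\<close>

lemma quadratic_slack:
  assumes AD: "disjoint_pair A D" and l: "l \<in> Lns - D"
  shows "(int (pts_on inc A l) - 2) * (int (pts_on inc A l) - 3)
    \<le> int (card A) * (int (card A) + int q) - 5 * (int (card A) * (int q + 1)) + 6 * (int N - int (card D))"
proof -
  have fin: "finite (Lns - D)" using finite_Lns by simp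
  have nonneg: "0 \<le> (int m - 2) * (int m - 3)" for m
    by (cases "m \<le> 2") (auto intro: mult_nonneg_nonneg mult_nonpos_nonpos)
  have c: "int (card (Lns - D)) = int N - int (card D)" using sums_outside(3)[OF AD] by linarith
  have "(int (pts_on inc A l) - 2) * (int (pts_on inc A l) - 3)
      \<le> (\<Sum>l\<in>Lns - D. (int (pts_on inc A l) - 2) * (int (pts_on inc A l) - 3))"
    using member_le_sum[OF l, of "\<lambda>l. (int (pts_on inc A l) - 2) * (int (pts_on inc A l) - 3)"] nonneg fin
    by simp
  also have "\<dots> = int (card A * (card A + q)) - (2 + 3) * int (card A * (q + 1)) + 2 * 3 * (int N - int (card D))"
    unfolding c[symmetric] by (subst sum_quadratic[OF fin]) (simp only: sums_outside(1,2)[OF AD])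
  finally show ?thesis by (simp add: algebra_simps)
qed

text \<open>At every point the intersection numbers of the lines through it add up to \<open>2\<close> modulo \<open>3\<close>, so the lines
  whose intersection number is not divisible by \<open>3\<close> cover all points. Counting incidences with
  them leaves only a maximal arc of degree \<open>3\<close> or three lines of intersection number \<open>4\<close> forming a triangle.\<close>
lemma order9_cases:
  assumes AD: "disjoint_pair A D" and cA: "card A = 20" and cD: "card D = 20" and q: "q = 9"
  shows "(\<exists>S. S \<subseteq> Pts \<and> card S = 21 \<and> (\<forall>l\<in>Lns. pts_on inc S l \<in> {0, 3})) \<or>
    (\<exists>U W. U \<subseteq> Lns \<and> W \<subseteq> Lns \<and> card U = 3 \<and> U \<inter> W = {} \<and>
      (\<forall>l\<in>Lns. pts_on inc A l mod 3 = (if l \<in> U then 1 else if l \<in> W then 2 else 0)) \<and>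
      (\<forall>m\<in>U. \<forall>p\<in>Pts. inc p m \<longrightarrow>
         card {l \<in> U. inc p l} = 2 \<and> card {l \<in> W. inc p l} = 0 \<or>
         card {l \<in> U. inc p l} = 1 \<and> card {l \<in> W. inc p l} = 2))"
proof -
  have AP: "A \<subseteq> Pts" and DL: "D \<subseteq> Lns" using AD by (auto simp: disjoint_pair_def)
  define n where "n = pts_on inc A"
  define L where "L i = {l \<in> Lns. n l = i}" for i
  note L_fold = n_def[symmetric] L_def[symmetric]
  have n_le: "n l \<le> 5" if l: "l \<in> Lns" for l
  proof (rule ccontr)
    assume neg: "\<not> n l \<le> 5"
    then have "l \<notin> D" using pts_on_zero[OF AD] by (auto simp: n_def)
    then have "(int (n l) - 2) * (int (n l) - 3) \<le> 6"
      using quadratic_slack[OF AD, of l] l cA cD q by (simp add: n_def)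
    moreover have "4 * 3 \<le> (int (n l) - 2) * (int (n l) - 3)" using neg by (intro mult_mono) auto
    ultimately show False by simp
  qed
  have five: "(\<Sum>i\<le>5. g i) = g 0 + g 1 + g 2 + g 3 + g 4 + g 5" for g :: "nat \<Rightarrow> nat"
    by (simp add: eval_nat_numeral)
  note line_sums = line_type_sums[OF AP n_le[unfolded n_def], unfolded L_fold five]
  define t where "t i = card (L i)" for i
  have e: "t 0 + t 1 + t 2 + t 3 + t 4 + t 5 = 91" "t 1 + 2 * t 2 + 3 * t 3 + 4 * t 4 + 5 * t 5 = 200"
    "t 1 + 4 * t 2 + 9 * t 3 + 16 * t 4 + 25 * t 5 = 580"
    using line_sums cA q by (simp_all add: t_def)
  have finL: "finite (L i)" for i using finite_Lns by (simp add: L_def)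
  have "D \<subseteq> L 0" using pts_on_zero[OF AD] DL by (auto simp: L_def n_def)
  then have t0: "20 \<le> t 0" using card_mono[OF finL] cD by (metis t_def)
  have mod_20_3: "(20::nat) mod 3 = 2" and mod_29_3: "(29::nat) mod 3 = 2" by simp_all
  have pencil': "(card {l \<in> L 1. inc p l} + 2 * card {l \<in> L 2. inc p l} + card {l \<in> L 4. inc p l}
      + 2 * card {l \<in> L 5. inc p l}) mod 3 = 2" if "p \<in> Pts" for p
  proof -
    have "(if p \<in> A then 29 else 20) = card {l \<in> L 1. inc p l} + 2 * card {l \<in> L 2. inc p l}
      + 3 * card {l \<in> L 3. inc p l} + 4 * card {l \<in> L 4. inc p l} + 5 * card {l \<in> L 5. inc p l}"
      using pencil_type_sums(2)[OF AP n_le[unfolded n_def] that, unfolded L_fold five] cA q by simp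
    also have "\<dots> = (card {l \<in> L 1. inc p l} + 2 * card {l \<in> L 2. inc p l}
      + card {l \<in> L 4. inc p l} + 2 * card {l \<in> L 5. inc p l})
      + 3 * (card {l \<in> L 3. inc p l} + card {l \<in> L 4. inc p l} + card {l \<in> L 5. inc p l})"
      by simp
    finally show ?thesis by (metis (mono_tags) mod_mult_self2 mod_20_3 mod_29_3)
  qed
  consider (max_arc) "t 1 = 0" "t 2 = 10" "t 4 = 0" "t 5 = 0"
    | (five) "t 1 = 0" "t 2 = 15" "t 4 = 0" "t 5 = 1"
    | (triangle) "t 1 + t 4 = 3" "t 2 = 7 + 3 * t 4" "t 5 = 0"
  proof -
    \<comment> \<open>This is half of the sum of \<open>(n - 2) * (n - 3)\<close> over all lines, in
      which \<open>t 2\<close> and \<open>t 3\<close> cancel.\<close>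
    have e3: "3 * t 0 + t 1 + t 4 + 3 * t 5 = 63" using e by linarith
    then have "t 0 = 20 \<or> t 0 = 21" using t0 by linarith
    then consider "t 0 = 21" "t 1 = 0" "t 4 = 0" "t 5 = 0" | "t 0 = 20" "t 1 = 0" "t 4 = 0" "t 5 = 1"
      | "t 0 = 20" "t 1 + t 4 = 3" "t 5 = 0"
      using e3 by (cases "t 5 = 0") force+
    then show thesis using that e by cases auto
  qed
  then show ?thesis
  proof cases
    case max_arc
    define s where "s p = card {l \<in> L 2. inc p l}" for p
    have e: "L 1 = {}" "L 4 = {}" "L 5 = {}" using max_arc t_def finL by auto
    have c: "card (L 2) = 10" using max_arc t_def by simp
    have s3: "s p mod 3 = 1" if "p \<in> Pts" for p
      using pencil'[OF that, unfolded e] unfolding s_def by simp presburger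
    \<comment> \<open>By the congruence a point on fewer than eight of the ten 2-secants is on 1, 4
      or 7 of them and contributes at most 0. As the sum is positive, some point lies on at least 8,
      hence on all 10; adding this concurrency point to \<open>A\<close> makes every 2-secant a
      3-secant.\<close>
    have tot: "(\<Sum>p\<in>Pts. (int (s p) - 1) * (int (s p) - 7)) = 27"
      unfolding s_def using sum_lines_through[of "L 2"] c q card_Pts
      by (subst sum_quadratic[OF finite_Pts]) (simp add: L_def)
    have "\<exists>Q\<in>Pts. 7 < s Q"
    proof (rule ccontr)
      assume neg: "\<not> ?thesis"
      have "(\<Sum>p\<in>Pts. (int (s p) - 1) * (int (s p) - 7)) \<le> 0"
      proof (rule sum_nonpos)
        fix p assume "p \<in> Pts"
        then have "1 \<le> s p" "s p \<le> 7" using s3[of p] neg by (auto simp: not_less)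
        then show "(int (s p) - 1) * (int (s p) - 7) \<le> 0" by (intro mult_nonneg_nonpos) auto
      qed
      then show False using tot by simp
    qed
    then obtain Q where Q: "Q \<in> Pts" "7 < s Q" by blast
    have fp: "finite {l \<in> Lns. inc Q l}" using finite_Lns by simp
    have sub: "{l \<in> L 2. inc Q l} \<subseteq> {l \<in> Lns. inc Q l}" by (auto simp: L_def)
    then have "s Q \<le> 10" using card_mono[OF fp sub] card_pencil[OF Q(1)] q by (simp add: s_def)
    then have sQ: "s Q = 10" using Q s3[of Q] by presburger
    then have all: "{l \<in> L 2. inc Q l} = {l \<in> Lns. inc Q l}"
      using card_subset_eq[OF fp sub] card_pencil[OF Q(1)] q by (simp add: s_def)
    have all': "{l \<in> L 2. inc Q l} = L 2"
      using card_subset_eq[OF finL, of "{l \<in> L 2. inc Q l}" 2] sQ c by (auto simp: s_def)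
    have "(\<Sum>l | l \<in> Lns \<and> inc Q l. n l) = 20"
    proof -
      have "(\<Sum>l | l \<in> Lns \<and> inc Q l. n l) = (\<Sum>l\<in>L 2. 2)"
        unfolding all[symmetric] all' by (intro sum.cong) (auto simp: L_def)
      then show ?thesis using c by simp
    qed
    then have QA: "Q \<notin> A" using sum_pts_on_pencil[OF AP Q(1), folded n_def] cA q by (auto split: if_splits)
    have fA: "finite A" using disjoint_pair_finite[OF AD] by simp
    have "pts_on inc (insert Q A) l \<in> {0, 3}" if l: "l \<in> Lns" for l
    proof (cases "inc Q l")
      case True
      then have "n l = 2" using all l by (auto simp: L_def)
      moreover have "{p \<in> insert Q A. inc p l} = insert Q {p \<in> A. inc p l}" using True by auto
      ultimately show ?thesis using QA fA by (simp add: pts_on_def n_def)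
    next
      case False
      then have "l \<notin> L 2" using all' by auto
      moreover have "l \<notin> L 1" "l \<notin> L 4" "l \<notin> L 5" using e by auto
      ultimately have "n l \<noteq> 1" "n l \<noteq> 2" "n l \<noteq> 4" "n l \<noteq> 5" using l by (auto simp: L_def)
      then have "n l = 0 \<or> n l = 3" using n_le[OF l] by presburger
      moreover have "{p \<in> insert Q A. inc p l} = {p \<in> A. inc p l}" using False by auto
      ultimately show ?thesis by (simp add: pts_on_def n_def)
    qed
    moreover have "card (insert Q A) = 21" using QA fA cA by simp
    ultimately show ?thesis using Q(1) AP by (intro disjI1 exI[of _ "insert Q A"]) auto
  next
    case five
    define W where "W = L 2 \<union> L 5"
    define s where "s p = card {l \<in> W. inc p l}" for p
    have e: "L 1 = {}" "L 4 = {}" using five t_def finL by auto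
    have dis: "L 2 \<inter> L 5 = {}" by (auto simp: L_def)
    have c: "card W = 16"
      unfolding W_def using five t_def card_Un_disjoint[OF finL finL dis] by simp
    have s3: "s p mod 3 = 1" if "p \<in> Pts" for p
    proof -
      have "{l \<in> W. inc p l} = {l \<in> L 2. inc p l} \<union> {l \<in> L 5. inc p l}" by (auto simp: W_def)
      then have "s p = card {l \<in> L 2. inc p l} + card {l \<in> L 5. inc p l}"
        unfolding s_def using dis finL[of 2] finL[of 5] by (simp add: card_Un_disjoint disjoint_iff)
      then show ?thesis using pencil'[OF that, unfolded e] by simp presburger
    qed
    \<comment> \<open>Each value is 1 modulo 3, so no term is negative, while the moments of sixteen
      lines give a negative total: this case cannot occur.\<close>
    have "(\<Sum>p\<in>Pts. (int (s p) - 1) * (int (s p) - 4)) = - 36"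
      unfolding s_def using sum_lines_through[of W] c q card_Pts
      by (subst sum_quadratic[OF finite_Pts]) (simp add: L_def W_def subset_iff)
    moreover have "0 \<le> (\<Sum>p\<in>Pts. (int (s p) - 1) * (int (s p) - 4))"
    proof (rule sum_nonneg)
      fix p assume "p \<in> Pts"
      then have "s p = 1 \<or> 4 \<le> s p" using s3[of p] by presburger
      then show "0 \<le> (int (s p) - 1) * (int (s p) - 4)" by auto
    qed
    ultimately show ?thesis by simp
  next
    case triangle
    define U W where "U = L 1 \<union> L 4" and "W = L 2"
    define u w where "u p = card {l \<in> U. inc p l}" and "w p = card {l \<in> W. inc p l}" for p
    have e: "L 5 = {}" using triangle t_def finL by auto
    have dis: "L 1 \<inter> L 4 = {}" by (auto simp: L_def)
    have sub: "U \<subseteq> Lns" "W \<subseteq> Lns" and fin: "finite U" "finite W"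
      using finL by (auto simp: U_def W_def L_def)
    have cU: "card U = 3" and cW: "card W = 7 + 3 * t 4"
      unfolding U_def W_def
      using triangle t_def card_Un_disjoint[OF finL finL dis] by simp_all
    have uw: "(u p + 2 * w p) mod 3 = 2" if "p \<in> Pts" for p
    proof -
      have "{l \<in> U. inc p l} = {l \<in> L 1. inc p l} \<union> {l \<in> L 4. inc p l}" by (auto simp: U_def)
      then have "u p = card {l \<in> L 1. inc p l} + card {l \<in> L 4. inc p l}"
        unfolding u_def using dis finL[of 1] finL[of 4] by (simp add: card_Un_disjoint disjoint_iff)
      then show ?thesis using pencil'[OF that] by (simp add: e w_def W_def add_ac)
    qed
    have tight: "t 4 = 3 \<and> (\<forall>p\<in>Pts. inc p m \<longrightarrow> u p = 2 \<and> w p = 0 \<or> u p = 1 \<and> w p = 2)"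
      if m: "m \<in> U" for m
    proof -
      let ?P = "{p \<in> Pts. inc p m}"
      have mL: "m \<in> Lns" "m \<notin> W" using m sub by (auto simp: U_def W_def L_def)
      have fP: "finite ?P" and cP: "card ?P = 10" using finite_Pts card_line[OF mL(1)] q by auto
      have u1: "1 \<le> u p" if "p \<in> ?P" for p
      proof -
        have "{l \<in> U. inc p l} \<noteq> {}" using m that by blast
        then have "0 < card {l \<in> U. inc p l}" using fin(1) by (simp only: card_gt_0_iff) simp
        then show ?thesis unfolding u_def by simp
      qed
      \<comment> \<open>The congruence says that \<open>2 * (u p - 1) + w p\<close> is 2 modulo 3.
        Summed over the ten points of \<open>m\<close> this gives at least 20, whereas the total is
        \<open>11 + 3 * t 4\<close> with \<open>t 4 \<le> 3\<close>; so equality holds at every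
        point.\<close>
      have ge2: "2 \<le> 2 * (u p - 1) + w p" if "p \<in> ?P" for p
        using uw[of p] u1[OF that] that by simp presburger
      have "(\<Sum>p\<in>?P. u p) = 12" "(\<Sum>p\<in>?P. w p) = 7 + 3 * t 4"
        unfolding u_def w_def using sub m mL cU cW q by (simp_all add: sum_pts_on_line)
      moreover have "(\<Sum>p\<in>?P. u p) = (\<Sum>p\<in>?P. u p - 1) + 10"
      proof -
        have "(\<Sum>p\<in>?P. u p) = (\<Sum>p\<in>?P. (u p - 1) + 1)" using u1 by (intro sum.cong) fastforce+
        then show ?thesis by (simp only: sum.distrib) (simp add: cP)
      qed
      ultimately have tot: "(\<Sum>p\<in>?P. 2 * (u p - 1) + w p) = 11 + 3 * t 4"
        by (simp add: sum.distrib sum_distrib_left[symmetric])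
      have "(\<Sum>p\<in>?P. 2::nat) \<le> (\<Sum>p\<in>?P. 2 * (u p - 1) + w p)" using ge2 by (intro sum_mono) auto
      then have t4: "t 4 = 3" using tot cP triangle by simp
      have eq2: "2 * (u p - 1) + w p = 2" if p: "p \<in> ?P" for p
      proof (rule ccontr)
        assume "2 * (u p - 1) + w p \<noteq> 2"
        then have "(\<Sum>p\<in>?P. 2) < (\<Sum>p\<in>?P. 2 * (u p - 1) + w p)"
          using ge2 p fP by (intro sum_strict_mono_ex1) (auto intro!: bexI[of _ p] simp: le_neq_implies_less)
        then show False using tot cP t4 by simp
      qed
      have "u p = 2 \<and> w p = 0 \<or> u p = 1 \<and> w p = 2" if "p \<in> ?P" for p
        using eq2[OF that] u1[OF that] by presburger
      then show ?thesis using t4 by blast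
    qed
    obtain m where "m \<in> U" using cU by fastforce
    then have "t 4 = 3" "t 1 = 0" using tight triangle by auto
    then have "L 1 = {}" using t_def finL by auto
    then have "n l mod 3 = (if l \<in> U then 1 else if l \<in> W then 2 else 0)" if "l \<in> Lns" for l
    proof -
      have "l \<notin> L 1" "l \<notin> L 5" using \<open>L 1 = {}\<close> e by auto
      then have "n l \<noteq> 1" "n l \<noteq> 5" using that by (auto simp: L_def)
      then have "n l = 0 \<or> n l = 2 \<or> n l = 3 \<or> n l = 4" using n_le[OF that] by presburger
      then show ?thesis using that by (auto simp: U_def W_def L_def)
    qed
    moreover have "U \<inter> W = {}" by (auto simp: U_def W_def L_def)
    ultimately show ?thesis
      using sub cU tight unfolding n_def u_def w_def by (intro disjI2 exI[of _ U] exI[of _ W]) auto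
  qed
qed

text \<open>Over the 26 points off the arc, the terms \<open>(s - 1) * (s - 2)\<close> add up to 2,
  where \<open>s\<close> counts the secants through the point. A point completing the arc has
  \<open>s = 0\<close> and uses up this total alone.\<close>

lemma five_arc_completion_unique:
  assumes Q: "Q \<subseteq> Pts" "card Q = 5" and q: "q = 5"
    and arc: "\<And>l. l \<in> Lns \<Longrightarrow> pts_on inc Q l \<le> 2"
    and fg: "f \<in> Pts - Q" "g \<in> Pts - Q"
    and off: "\<And>l. l \<in> Lns \<Longrightarrow> pts_on inc Q l = 2 \<Longrightarrow> \<not> inc f l \<and> \<not> inc g l"
  shows "f = g"
proof (rule ccontr)
  assume ne: "f \<noteq> g"
  define n where "n = pts_on inc Q"
  define L where "L i = {l \<in> Lns. n l = i}" for i
  define s where "s p = card {l \<in> L 2. inc p l}" for p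
  have fQ: "finite Q" using Q finite_Pts finite_subset by blast
  have n2: "n l \<le> 2" if "l \<in> Lns" for l using arc that by (simp add: n_def)
  have split: "(\<Sum>i\<le>2. h i) = h 0 + h 1 + h 2" for h :: "nat \<Rightarrow> nat" by (simp add: eval_nat_numeral)
  note L_fold = n_def[symmetric] L_def[symmetric]
  have "card (L 1) + 2 * card (L 2) = 30" "card (L 1) + 4 * card (L 2) = 50"
    using line_type_sums[OF Q(1) n2[unfolded n_def], unfolded L_fold split] Q q by simp_all
  then have c: "card (L 2) = 10" by linarith
  have pencil: "card {l \<in> L 1. inc p l} + 2 * s p = (if p \<in> Q then 10 else 5)"
    and count: "card {l \<in> L 0. inc p l} + card {l \<in> L 1. inc p l} + s p = 6" if p: "p \<in> Pts" for p
    using pencil_type_sums[OF Q(1) n2[unfolded n_def] p, unfolded L_fold split] Q q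
    by (cases "p \<in> Q"; simp add: s_def)+
  have s4: "s p = 4" if "p \<in> Q" for p
  proof -
    have "{l \<in> L 0. inc p l} = {}" using that fQ by (auto simp: L_def n_def pts_on_def card_eq_0_iff)
    then have "card {l \<in> L 0. inc p l} = 0" by (simp only: card.empty)
    moreover have "p \<in> Pts" using that Q by auto
    ultimately show ?thesis using pencil[of p] count[of p] that by simp
  qed
  have tot: "(\<Sum>p\<in>Pts. s p) = 60" "(\<Sum>p\<in>Pts. (s p)^2) = 150"
    unfolding s_def using sum_lines_through[of "L 2"] c q by (auto simp: L_def)
  have Qsum: "(\<Sum>p\<in>Q. s p) = 20" "(\<Sum>p\<in>Q. (s p)^2) = 80" using s4 Q by simp_all
  have out: "(\<Sum>p\<in>Pts - Q. s p) = 40" "(\<Sum>p\<in>Pts - Q. (s p)^2) = 70"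
    using sum.subset_diff[OF Q(1) finite_Pts, of s] sum.subset_diff[OF Q(1) finite_Pts, of "\<lambda>p. (s p)^2"]
      tot Qsum by simp_all
  have fin: "finite (Pts - Q)" using finite_Pts by simp
  have card_out: "card (Pts - Q) = 26" using card_Diff_subset[OF fQ Q(1)] card_Pts Q q by simp
  have sum2: "(\<Sum>p\<in>Pts - Q. (int (s p) - 1) * (int (s p) - 2)) = 2"
    by (subst sum_quadratic[OF fin]) (simp add: out card_out)
  have nonneg: "0 \<le> (int (s p) - 1) * (int (s p) - 2)" for p
    by (cases "s p \<le> 1") (auto intro: mult_nonneg_nonneg mult_nonpos_nonpos)
  have "{l \<in> L 2. inc f l} = {}" "{l \<in> L 2. inc g l} = {}" using off by (auto simp: L_def n_def)
  then have "s f = 0" "s g = 0" by (simp_all only: s_def card.empty)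
  then have "(\<Sum>p\<in>{f, g}. (int (s p) - 1) * (int (s p) - 2)) = 4" using ne by simp
  moreover have "(\<Sum>p\<in>{f, g}. (int (s p) - 1) * (int (s p) - 2))
      \<le> (\<Sum>p\<in>Pts - Q. (int (s p) - 1) * (int (s p) - 2))"
    using fg nonneg fin by (intro sum_mono2) auto
  ultimately show False using sum2 by simp
qed

text \<open>Eight points missing eight lines would contain three collinear triples \<open>{P, a, b}\<close>, \<open>{P, c, d}\<close>,
  \<open>{e, f, g}\<close>, so that \<open>f\<close> and \<open>g\<close> both complete the 5-arc \<open>{a, b, c, d, e}\<close> to a 6-arc.\<close>
lemma order5_no_8:
  assumes AD: "disjoint_pair A D" and cA: "card A = 8" and cD: "card D = 8" and q: "q = 5"
  shows False
proof -
  have AP: "A \<subseteq> Pts" and DL: "D \<subseteq> Lns" using AD by (auto simp: disjoint_pair_def)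
  have fA: "finite A" using disjoint_pair_finite[OF AD] by simp
  define n where "n = pts_on inc A"
  define L where "L i = {l \<in> Lns. n l = i}" for i
  define t where "t i = card (L i)" for i
  note L_fold = n_def[symmetric] L_def[symmetric]
  have slack: "(int (n l) - 2) * (int (n l) - 3) \<le> 2" if "l \<in> Lns - D" for l
    using quadratic_slack[OF AD that] cA cD q by (simp add: n_def)
  have nD: "n l = 0" if "l \<in> D" for l using pts_on_zero[OF AD that] by (simp add: n_def)
  have n_le: "n l \<le> 4" if l: "l \<in> Lns" for l
  proof (rule ccontr)
    assume neg: "\<not> n l \<le> 4"
    then have "3 * 2 \<le> (int (n l) - 2) * (int (n l) - 3)" by (intro mult_mono) auto
    then show False using slack[of l] nD[of l] neg l by fastforce
  qed
  have split: "(\<Sum>i\<le>4. h i) = h 0 + h 1 + h 2 + h 3 + h 4" for h :: "nat \<Rightarrow> nat"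
    by (simp add: eval_nat_numeral)
  \<comment> \<open>A line outside \<open>D\<close> that misses \<open>A\<close> would contribute 6
    to a sum bounded by 2.\<close>
  have "L 0 = D"
  proof (intro equalityI subsetI)
    fix l assume l: "l \<in> L 0"
    then show "l \<in> D" using slack[of l] by (cases "l \<in> D") (auto simp: L_def)
  qed (use nD DL in \<open>auto simp: L_def\<close>)
  then have e: "t 1 + t 2 + t 3 + t 4 = 23" "t 1 + 2 * t 2 + 3 * t 3 + 4 * t 4 = 48"
    "t 1 + 4 * t 2 + 9 * t 3 + 16 * t 4 = 104"
    using line_type_sums[OF AP n_le[unfolded n_def], unfolded L_fold split] cA cD q by (simp_all add: t_def)
  have finL: "finite (L i)" for i using finite_Lns by (simp add: L_def)
  have pencil: "card {l \<in> L 1. inc p l} + 2 * card {l \<in> L 2. inc p l} + 3 * card {l \<in> L 3. inc p l}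
      + 4 * card {l \<in> L 4. inc p l} = 13"
    and count: "card {l \<in> L 1. inc p l} + card {l \<in> L 2. inc p l} + card {l \<in> L 3. inc p l}
      + card {l \<in> L 4. inc p l} = 6" if p: "p \<in> A" for p
  proof -
    have pP: "p \<in> Pts" using p AP by auto
    have "{l \<in> L 0. inc p l} = {}" using p fA by (auto simp: L_def n_def pts_on_def card_eq_0_iff)
    then have z: "card {l \<in> L 0. inc p l} = 0" by (simp only: card.empty)
    note types = pencil_type_sums[OF AP n_le[unfolded n_def] pP, unfolded L_fold split]
    show "card {l \<in> L 1. inc p l} + 2 * card {l \<in> L 2. inc p l} + 3 * card {l \<in> L 3. inc p l}
        + 4 * card {l \<in> L 4. inc p l} = 13" using types(2) p cA q by simp
    show "card {l \<in> L 1. inc p l} + card {l \<in> L 2. inc p l} + card {l \<in> L 3. inc p l}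
        + card {l \<in> L 4. inc p l} = 6" using types(1) z q by simp
  qed
  consider "t 1 = 0" "t 3 = 0" "t 4 = 1" | "t 1 = 1" "t 3 = 3" "t 4 = 0"
  proof -
    \<comment> \<open>Half of the sum of \<open>(n - 2) * (n - 3)\<close> over the lines outside
      \<open>D\<close>.\<close>
    have "t 1 + t 4 = 1" using e by linarith
    then consider "t 1 = 0" "t 4 = 1" | "t 1 = 1" "t 4 = 0" by linarith
    then show thesis using that e by cases auto
  qed
  then show False
  proof cases
    case 1
    then have e: "L 1 = {}" "L 3 = {}" using t_def finL by auto
    have "card (L 4) = 1" using 1 t_def by simp
    then obtain m where m: "L 4 = {m}" by (rule card_1_singletonE)
    then have "m \<in> L 4" by simp
    then have "card {p \<in> A. inc p m} = 4" by (simp add: L_def n_def pts_on_def)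
    then have "{p \<in> A. inc p m} \<noteq> A" using cA by auto
    then obtain p where p: "p \<in> A" "\<not> inc p m" by blast
    then have "{l \<in> L 4. inc p l} = {}" using m by auto
    then have "card {l \<in> L 4. inc p l} = 0" by (simp only: card.empty)
    \<comment> \<open>A point of \<open>A\<close> off the only 4-secant has only 2-secants through
      it, but the pencil sum 13 is odd.\<close>
    then have "2 * card {l \<in> L 2. inc p l} = 13" using pencil[OF p(1), unfolded e] by simp
    then show False by presburger
  next
    case 2
    have e: "L 4 = {}" using 2 t_def finL by auto
    have "card (L 1) = 1" using 2 t_def by simp
    then obtain m where m: "L 1 = {m}" by (rule card_1_singletonE)
    then have "m \<in> L 1" by simp
    then have "card {p \<in> A. inc p m} = 1" by (simp add: L_def n_def pts_on_def)
    then obtain P where P: "{p \<in> A. inc p m} = {P}" by (rule card_1_singletonE)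
    then have PA: "P \<in> A" "inc P m" by auto
    have "{l \<in> L 1. inc P l} = {m}" using m PA by auto
    then have P3: "card {l \<in> L 3. inc P l} = 2"
      using pencil[OF PA(1)] count[OF PA(1)] unfolding e by simp
    have p3: "card {l \<in> L 3. inc p l} = 1" if "p \<in> A" "p \<noteq> P" for p
    proof -
      have "{l \<in> L 1. inc p l} = {}" using m P that by auto
      then have "card {l \<in> L 1. inc p l} = 0" by (simp only: card.empty)
      then show ?thesis using pencil[OF that(1)] count[OF that(1)] unfolding e by simp
    qed
    have cL3: "card (L 3) = 3" using 2 t_def by simp
    have "card (L 3 - {l \<in> L 3. inc P l}) = 1"
      using card_Diff_subset[of "{l \<in> L 3. inc P l}" "L 3"] finL cL3 P3 by auto
    then obtain m3 where m3: "L 3 - {l \<in> L 3. inc P l} = {m3}" by (rule card_1_singletonE)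
    then have m3L: "m3 \<in> L 3" "\<not> inc P m3" by auto
    define M3 where "M3 = {p \<in> A. inc p m3}"
    have M3: "card M3 = 3" "M3 \<subseteq> A" "P \<notin> M3" using m3L by (auto simp: L_def n_def pts_on_def M3_def)
    then obtain e f g where efg: "M3 = {e, f, g}" "e \<noteq> f" "e \<noteq> g" "f \<noteq> g" by (auto simp: card_3_iff)
    \<comment> \<open>Every 3-secant loses a point: the two through \<open>P\<close> lose
      \<open>P\<close>, and \<open>m3\<close> keeps only \<open>e\<close>. So no three points of
      \<open>Q\<close> are collinear.\<close>
    define Q where "Q = A - {P, f, g}"
    have QA: "Q \<subseteq> A" by (auto simp: Q_def)
    have "{P, f, g} \<subseteq> A" "card {P, f, g} = 3" using PA M3 efg by auto
    then have cQ: "card Q = 5" unfolding Q_def using cA by (simp add: card_Diff_subset)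
    have m3Q: "{p \<in> Q. inc p m3} = {e}" using efg M3 by (auto simp: Q_def M3_def)
    have le_n: "pts_on inc Q l \<le> n l" for l
      unfolding pts_on_def n_def using QA fA by (intro card_mono) auto
    have n3: "n l \<le> 3" if "l \<in> Lns" for l
    proof -
      have "l \<notin> L 4" using e by simp
      then show ?thesis using n_le[OF that] that by (auto simp: L_def)
    qed
    have "f = g"
    proof (rule five_arc_completion_unique[OF _ cQ q])
      show "Q \<subseteq> Pts" using QA AP by auto
      show "f \<in> Pts - Q" "g \<in> Pts - Q" using M3 efg AP by (auto simp: Q_def)
      show "pts_on inc Q l \<le> 2" if l: "l \<in> Lns" for l
      proof (cases "n l = 3")
        case True
        then have l3: "l \<in> L 3" using l by (simp add: L_def)
        show ?thesis
        proof (cases "inc P l")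
          case True
          then have "{p \<in> Q. inc p l} \<subset> {p \<in> A. inc p l}" using PA QA by (auto simp: Q_def)
          then have "pts_on inc Q l < n l" unfolding pts_on_def n_def using fA by (intro psubset_card_mono) auto
          then show ?thesis using \<open>n l = 3\<close> by simp
        next
          case False
          then have "l = m3" using l3 m3 by auto
          then show ?thesis using m3Q by (simp add: pts_on_def)
        qed
      qed (use le_n[of l] n3[OF l] in linarith)
      show "\<not> inc f l \<and> \<not> inc g l" if l: "l \<in> Lns" "pts_on inc Q l = 2" for l
      proof -
        have "\<not> inc x l" if x: "x \<in> {f, g}" for x
        proof
          assume xl: "inc x l"
          have xA: "x \<in> A" "x \<noteq> P" "inc x m3" using x M3 efg by (auto simp: M3_def)
          have "x \<notin> Q" using x by (auto simp: Q_def)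
          then have "{p \<in> Q. inc p l} \<subset> {p \<in> A. inc p l}" using xA xl QA by auto
          then have "pts_on inc Q l < n l" unfolding pts_on_def n_def using fA by (intro psubset_card_mono) auto
          \<comment> \<open>A secant of \<open>Q\<close> through \<open>x\<close> has three points
            of \<open>A\<close>. The only 3-secant through \<open>x\<close> is \<open>m3\<close>,
            which has just one point of \<open>Q\<close>.\<close>
          then have "l \<in> L 3" using l n3[OF l(1)] by (auto simp: L_def)
          then have "{l, m3} \<subseteq> {l \<in> L 3. inc x l}" using xl xA m3L by auto
          moreover obtain y where "{l \<in> L 3. inc x l} = {y}" using p3[OF xA(1,2)] by (rule card_1_singletonE)
          ultimately have "{l, m3} \<subseteq> {y}" by simp
          then have "l = m3" by simp
          then show False using l m3Q by (simp add: pts_on_def)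
        qed
        then show ?thesis by auto
      qed
    qed
    then show False using efg by simp
  qed
qed

lemma bounded_plane_order5: "q = 5 \<Longrightarrow> bounded_plane Pts Lns inc q 7"
  using order5_no_8 by (intro bounded_planeI) auto

end

section \<open>Coordinates\<close>

lemma card_field_ge_2: "2 \<le> CARD('a::{field,finite})"
proof -
  have "card {0, 1 :: 'a} \<le> CARD('a)" by (intro card_mono) auto
  then show ?thesis by simp
qed

definition dot :: "'a::field^'n \<Rightarrow> 'a^'n \<Rightarrow> 'a" where
  "dot u x = (\<Sum>i\<in>UNIV. u$i * x$i)"

lemma dot_commute: "dot u x = dot x u"
  by (simp add: dot_def mult.commute)

lemma dot_add: "dot u (x + y) = dot u x + dot u y"
  and dot_diff: "dot u (x - y) = dot u x - dot u y"
  and dot_scale: "dot u (c *s x) = c * dot u x"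
  and dot_zero: "dot u 0 = 0"
  by (simp_all add: dot_def algebra_simps sum.distrib sum_subtractf sum_distrib_left)

lemma dot_add_left: "dot (u + w) x = dot u x + dot w x"
  and dot_diff_left: "dot (u - w) x = dot u x - dot w x"
  and dot_scale_left: "dot (c *s u) x = c * dot u x"
  and dot_zero_left: "dot 0 x = 0"
  by (simp_all add: dot_def algebra_simps sum.distrib sum_subtractf sum_distrib_left)

lemmas dot_simps = dot_add dot_diff dot_scale dot_zero dot_add_left dot_diff_left dot_scale_left dot_zero_left

lemma dot_axis: "dot u (axis i 1) = u$i"
proof -
  have "(\<Sum>j\<in>UNIV. u$j * axis i 1 $ j) = (\<Sum>j\<in>UNIV. if j = i then u$j else 0)"
    by (intro sum.cong) (auto simp: axis_def)
  then show ?thesis by (simp add: dot_def)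
qed

lemma dot_nonzero_ex:
  assumes "u \<noteq> 0"
  obtains e where "dot u e = 1"
proof -
  obtain i where "u$i \<noteq> 0" using assms by (auto simp: vec_eq_iff)
  then have "dot u ((1 / u$i) *s axis i 1) = 1" by (simp add: dot_simps dot_axis)
  then show thesis by (rule that)
qed

text \<open>The vectors \<open>u$i *s axis j 1 - u$j *s axis i 1\<close> lie in the kernel of
  \<open>u\<close>, and vanishing on them makes the coordinates of \<open>w\<close> proportional to
  those of \<open>u\<close>.\<close>

lemma dot_kernel_subset:
  assumes "u \<noteq> 0" and "\<And>x. dot u x = 0 \<Longrightarrow> dot w x = 0"
  shows "\<exists>c. w = c *s u"
proof -
  obtain i where i: "u$i \<noteq> 0" using assms(1) by (auto simp: vec_eq_iff)
  have "w$j = u$j * (w$i / u$i)" for j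
  proof -
    have "dot u (u$i *s axis j 1 - u$j *s axis i 1) = 0" by (simp add: dot_simps dot_axis)
    then have "dot w (u$i *s axis j 1 - u$j *s axis i 1) = 0" by (rule assms(2))
    then have "u$i * w$j = u$j * w$i" unfolding dot_simps dot_axis by (simp only: right_minus_eq)
    then have "w$j = u$j * w$i / u$i" using i by (metis nonzero_mult_div_cancel_left)
    then show ?thesis by simp
  qed
  then have "w = (w$i / u$i) *s u"
    unfolding vec_eq_iff vector_smult_component by (metis mult.commute)
  then show ?thesis by blast
qed

text \<open>Splitting off one coordinate serves two purposes: it gives the sizes of kernels, and it
  parametrises the cosets over which products of linear forms are summed. For the latter
  \<open>g\<close> is an arbitrary functional.\<close>

lemma bij_kernel:
  fixes g :: "'a::{field,finite}^'n \<Rightarrow> 'a"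
  assumes K: "vec.subspace K" and e: "e \<in> K" "g e = 1"
    and g: "\<And>x y. g (x + y) = g x + g y" "\<And>c x. g (c *s x) = c * g x"
  shows "bij_betw (\<lambda>(k, c). k + c *s e) ({x \<in> K. g x = 0} \<times> UNIV) K"
proof -
  have g_diff: "g (x - y) = g x - g y" for x y using g(1)[of "x - y" y] by simp
  show ?thesis
    unfolding bij_betw_def
  proof
    show "inj_on (\<lambda>(k, c). k + c *s e) ({x \<in> K. g x = 0} \<times> UNIV)"
    proof (rule inj_onI, clarify)
      fix k c k' c' assume h: "g k = 0" "g k' = 0" "k + c *s e = k' + c' *s e"
      from arg_cong[OF h(3), of g] have "c = c'" using h(1,2) e by (simp only: g) simp
      then show "k = k' \<and> c = c'" using h by simp
    qed
    show "(\<lambda>(k, c). k + c *s e) ` ({x \<in> K. g x = 0} \<times> UNIV) = K"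
    proof
      show "(\<lambda>(k, c). k + c *s e) ` ({x \<in> K. g x = 0} \<times> UNIV) \<subseteq> K"
        using K e by (auto intro: vec.subspace_add vec.subspace_scale)
      show "K \<subseteq> (\<lambda>(k, c). k + c *s e) ` ({x \<in> K. g x = 0} \<times> UNIV)"
      proof
        fix x assume x: "x \<in> K"
        have "x - g x *s e \<in> {x \<in> K. g x = 0}"
          using K e x by (auto simp: g_diff g intro: vec.subspace_diff vec.subspace_scale)
        then show "x \<in> (\<lambda>(k, c). k + c *s e) ` ({x \<in> K. g x = 0} \<times> UNIV)"
          by (intro image_eqI[of _ _ "(x - g x *s e, g x)"]) auto
      qed
    qed
  qed
qed

lemma card_kernel:
  fixes g :: "'a::{field,finite}^'n \<Rightarrow> 'a"
  assumes K: "vec.subspace K" and e: "e \<in> K" "g e = 1"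
    and g: "\<And>x y. g (x + y) = g x + g y" "\<And>c x. g (c *s x) = c * g x"
  shows "card K = card {x \<in> K. g x = 0} * CARD('a)"
  using bij_betw_same_card[OF bij_kernel[OF K e g]] by (simp add: card_cartesian_product)

lemma subspace_dot: "vec.subspace {x. dot u x = 0}"
  by (auto simp: vec.subspace_def dot_simps)

lemma card_dot_zero:
  fixes u :: "'a::{field,finite}^3"
  assumes "u \<noteq> 0"
  shows "card {x. dot u x = 0} = CARD('a)^2"
proof -
  obtain e where "dot u e = 1" using dot_nonzero_ex[OF assms] .
  then have "CARD('a^3) = card {x \<in> UNIV. dot u x = 0} * CARD('a)"
    by (intro card_kernel) (auto simp: dot_simps)
  then have "card {x. dot u x = 0} * CARD('a) = CARD('a)^2 * CARD('a)"
    by (simp add: power3_eq_cube power2_eq_square)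
  then show ?thesis by (simp only: mult_cancel2) (simp add: card_eq_0_iff)
qed

lemma card_dot_zero2:
  fixes u w :: "'a::{field,finite}^3"
  assumes u: "u \<noteq> 0" and w: "\<And>c. w \<noteq> c *s u"
  shows "card {x. dot u x = 0 \<and> dot w x = 0} = CARD('a)"
proof -
  obtain x where x: "dot u x = 0" "dot w x \<noteq> 0" using dot_kernel_subset[OF u, of w] w by blast
  let ?e = "(1 / dot w x) *s x"
  have "card {x. dot u x = 0} = card {x \<in> {x. dot u x = 0}. dot w x = 0} * CARD('a)"
    using x by (intro card_kernel[where e = ?e] subspace_dot) (auto simp: dot_simps)
  then have "card {x. dot u x = 0 \<and> dot w x = 0} * CARD('a) = CARD('a) * CARD('a)"
    using card_dot_zero[OF u] by (simp add: power2_eq_square)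
  then show ?thesis by (simp only: mult_cancel2) (simp add: card_eq_0_iff)
qed

definition point :: "'a::field^3 \<Rightarrow> ('a^3) set" where "point x = vec.span {x}"
definition line :: "'a::field^3 \<Rightarrow> ('a^3) set" where "line u = {x. dot u x = 0}"

lemma point_subset_line: "point x \<subseteq> line u \<longleftrightarrow> dot u x = 0"
proof
  assume "point x \<subseteq> line u"
  then show "dot u x = 0" using vec.span_base[of x "{x}"] by (auto simp: point_def line_def)
next
  assume "dot u x = 0"
  then show "point x \<subseteq> line u"
    unfolding point_def line_def using subspace_dot by (intro vec.span_minimal) auto
qed

lemma PG_points_eq: "(PG_points :: ('a::field^3) set set) = point ` {x. x \<noteq> 0}"
proof (intro set_eqI iffI)
  fix U :: "('a^3) set" assume "U \<in> PG_points"
  then have U: "vec.subspace U" "vec.dim U = 1" by (auto simp: PG_points_def)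
  obtain B where B: "B \<subseteq> U" "vec.independent B" "U \<subseteq> vec.span B" "card B = vec.dim U"
    using vec.basis_exists .
  then obtain x where "B = {x}" using U card_1_singletonE by metis
  then have "U = point x" "x \<noteq> 0"
    using B U vec.span_minimal[of B U] vec.dependent_zero[of B] by (auto simp: point_def)
  then show "U \<in> point ` {x. x \<noteq> 0}" by blast
next
  fix U :: "('a^3) set" assume "U \<in> point ` {x. x \<noteq> 0}"
  then show "U \<in> PG_points" by (auto simp: PG_points_def point_def vec.dim_span)
qed

lemma PG_lines_eq: "(PG_lines :: ('a::{field,finite}^3) set set) = line ` {u. u \<noteq> 0}"
proof (intro set_eqI iffI)
  have dim: "vec.subspace (line u) \<and> vec.dim (line u) = 2" if u: "u \<noteq> 0" for u :: "'a^3"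
  proof
    show sub: "vec.subspace (line u)" unfolding line_def by (rule subspace_dot)
    obtain e where e: "dot u e = 1" using dot_nonzero_ex[OF u] .
    have "vec.span (insert e (line u)) = UNIV"
    proof -
      have "x \<in> vec.span (insert e (line u))" for x
      proof -
        have "x - dot u x *s e \<in> vec.span (insert e (line u))"
          using e by (intro vec.span_base) (simp add: line_def dot_simps)
        moreover have "dot u x *s e \<in> vec.span (insert e (line u))"
          by (intro vec.span_scale vec.span_base) simp
        ultimately have "(x - dot u x *s e) + dot u x *s e \<in> vec.span (insert e (line u))"
          by (rule vec.span_add)
        then show ?thesis by simp
      qed
      then show ?thesis by blast
    qed
    then have "vec.dim (insert e (line u)) = CARD(3)" by (metis vec.dim_span vec_dim_card)
    moreover have "e \<notin> vec.span (line u)"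
      unfolding vec.span_eq_iff[THEN iffD2, OF sub] using e by (simp add: line_def)
    ultimately show "vec.dim (line u) = 2" by (simp add: vec.dim_insert)
  qed
  fix U :: "('a^3) set"
  show "U \<in> PG_lines" if "U \<in> line ` {u. u \<noteq> 0}" using that dim by (auto simp: PG_lines_def)
  assume "U \<in> PG_lines"
  then have U: "vec.subspace U" "vec.dim U = 2" by (auto simp: PG_lines_def)
  obtain B where B: "B \<subseteq> U" "vec.independent B" "U \<subseteq> vec.span B" "card B = vec.dim U"
    using vec.basis_exists .
  then obtain x y where xy: "B = {x, y}" using U by (metis card_2_iff)
  \<comment> \<open>A linear form vanishing at both basis vectors exists by the pigeonhole
    principle: there are \<open>q^3\<close> forms but only \<open>q^2\<close> pairs of
    values.\<close>
  have "\<not> inj (\<lambda>u::'a^3. (dot u x, dot u y))"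
  proof
    assume "inj (\<lambda>u::'a^3. (dot u x, dot u y))"
    then have "CARD('a^3) \<le> card (UNIV :: ('a \<times> 'a) set)" by (intro card_inj_on_le) auto
    then have "CARD('a)^3 \<le> CARD('a)^2" by (simp add: power2_eq_square)
    then show False using card_field_ge_2[where 'a='a] by (simp add: power_increasing_iff)
  qed
  then obtain u w where uw: "u \<noteq> w" "dot u x = dot w x" "dot u y = dot w y" by (auto simp: inj_def)
  then have ne: "u - w \<noteq> 0" by simp
  have "vec.span B \<subseteq> line (u - w)"
    using uw dim[OF ne] xy by (intro vec.span_minimal) (auto simp: line_def dot_simps)
  then have "U \<subseteq> line (u - w)" using B by simp
  then have "U = line (u - w)" using vec.subspace_dim_equal[of U "line (u - w)"] U dim[OF ne] by simp
  then show "U \<in> line ` {u. u \<noteq> 0}" using ne by blast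
qed

lemma point_eq_iff:
  assumes "x \<noteq> 0"
  shows "point x = point y \<longleftrightarrow> (\<exists>c. c \<noteq> 0 \<and> y = c *s x)"
proof
  assume h: "point x = point y"
  have "y \<in> point y" by (simp add: point_def vec.span_base)
  then obtain c where c: "y = c *s x" using h by (auto simp: point_def vec.span_singleton)
  moreover have "x \<in> point x" by (simp add: point_def vec.span_base)
  then obtain d where "x = d *s y" using h by (auto simp: point_def vec.span_singleton)
  ultimately have "c \<noteq> 0" using assms by auto
  then show "\<exists>c. c \<noteq> 0 \<and> y = c *s x" using c by blast
next
  assume "\<exists>c. c \<noteq> 0 \<and> y = c *s x"
  then obtain c where c: "c \<noteq> 0" "y = c *s x" by blast
  then have "x \<in> vec.span {y}" "y \<in> vec.span {x}"
    using vec.span_scale[OF vec.span_base, of y "{y}" "1/c"] vec.span_scale[OF vec.span_base, of x "{x}" c]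
    by simp_all
  then show "point x = point y"
    unfolding point_def by (intro equalityI vec.span_minimal vec.subspace_span) simp_all
qed

lemma line_eq_iff:
  assumes "u \<noteq> 0" "w \<noteq> 0"
  shows "line u = line w \<longleftrightarrow> (\<exists>c. c \<noteq> 0 \<and> w = c *s u)"
proof
  assume "line u = line w"
  then obtain c where "w = c *s u" using dot_kernel_subset[OF assms(1), of w] by (auto simp: line_def)
  then show "\<exists>c. c \<noteq> 0 \<and> w = c *s u" using assms by auto
next
  assume "\<exists>c. c \<noteq> 0 \<and> w = c *s u"
  then show "line u = line w" by (auto simp: line_def dot_simps)
qed

text \<open>The fibres of \<open>f\<close> are the orbits of the nonzero scalars, each of size
  \<open>q - 1\<close>.\<close>

lemma card_projective:
  fixes V :: "('a::{field,finite}^3) set"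
  assumes V: "0 \<notin> V" "\<And>c x. c \<noteq> 0 \<Longrightarrow> x \<in> V \<Longrightarrow> c *s x \<in> V"
    and f: "\<And>x y. x \<in> V \<Longrightarrow> y \<in> V \<Longrightarrow> f x = f y \<longleftrightarrow> (\<exists>c. c \<noteq> 0 \<and> y = c *s x)"
  shows "card (f ` V) * (CARD('a) - 1) = card V"
proof -
  have "card V = (\<Sum>z\<in>f ` V. card {x \<in> V. f x = z})"
    using sum.image_gen[of V "\<lambda>_. 1::nat" f] by simp
  also have "\<dots> = (\<Sum>z\<in>f ` V. CARD('a) - 1)"
  proof (rule sum.cong)
    fix z assume "z \<in> f ` V"
    then obtain x where x: "x \<in> V" "z = f x" by blast
    have "{y \<in> V. f y = z} = (\<lambda>c. c *s x) ` (UNIV - {0})"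
    proof (intro set_eqI iffI)
      fix y assume "y \<in> {y \<in> V. f y = z}"
      then obtain c where "c \<noteq> 0" "y = c *s x" using x f[OF x(1), of y] by auto
      then show "y \<in> (\<lambda>c. c *s x) ` (UNIV - {0})" by blast
    next
      fix y assume "y \<in> (\<lambda>c. c *s x) ` (UNIV - {0})"
      then obtain c where c: "c \<noteq> 0" "y = c *s x" by auto
      then have yV: "y \<in> V" using V(2) x by simp
      then have "f x = f y" using f[OF x(1)] c by blast
      then show "y \<in> {y \<in> V. f y = z}" using x yV by simp
    qed
    moreover have "inj_on (\<lambda>c. c *s x) (UNIV - {0})" using V(1) x by (intro inj_onI) auto
    ultimately show "card {y \<in> V. f y = z} = CARD('a) - 1"
      by (simp only: card_image) (simp add: card_Diff_singleton)
  qed simp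
  finally show ?thesis by simp
qed

lemma card_points_of:
  fixes V :: "('a::{field,finite}^3) set"
  assumes V: "vec.subspace V"
  shows "card (point ` (V - {0})) * (CARD('a) - 1) = card V - 1"
proof -
  have "card (point ` (V - {0})) * (CARD('a) - 1) = card (V - {0})"
    using V by (intro card_projective) (auto simp: point_eq_iff intro: vec.subspace_scale)
  then show ?thesis using vec.subspace_0[OF V] by (simp add: card_Diff_singleton)
qed

lemma card_lines_of:
  fixes V :: "('a::{field,finite}^3) set"
  assumes V: "vec.subspace V"
  shows "card (line ` (V - {0})) * (CARD('a) - 1) = card V - 1"
proof -
  have "card (line ` (V - {0})) * (CARD('a) - 1) = card (V - {0})"
    using V by (intro card_projective) (auto simp: line_eq_iff intro: vec.subspace_scale)
  then show ?thesis using vec.subspace_0[OF V] by (simp add: card_Diff_singleton)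
qed

lemma geometric_cancel:
  fixes q m :: nat
  assumes "2 \<le> q"
  shows "m * (q - 1) = q^3 - 1 \<Longrightarrow> m = q^2 + q + 1" "m * (q - 1) = q^2 - 1 \<Longrightarrow> m = q + 1"
    "m * (q - 1) = q - 1 \<Longrightarrow> m = 1"
proof -
  have "q^3 - 1 = (q^2 + q + 1) * (q - 1)" "q^2 - 1 = (q + 1) * (q - 1)"
    using assms by (cases q; simp add: power3_eq_cube power2_eq_square algebra_simps)+
  moreover have "q - 1 \<noteq> 0" using assms by simp
  ultimately show "m * (q - 1) = q^3 - 1 \<Longrightarrow> m = q^2 + q + 1"
    "m * (q - 1) = q^2 - 1 \<Longrightarrow> m = q + 1" "m * (q - 1) = q - 1 \<Longrightarrow> m = 1"
    by (simp_all only: mult_cancel2) simp_all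
qed

lemma points_on_line:
  fixes u :: "'a::{field,finite}^3"
  shows "{P \<in> PG_points. P \<subseteq> line u} = point ` ({x. dot u x = 0} - {0})"
proof -
  have "{P \<in> PG_points. P \<subseteq> line u} = point ` {x \<in> {x. x \<noteq> 0}. point x \<subseteq> line u}"
    unfolding PG_points_eq by blast
  also have "{x \<in> {x. x \<noteq> 0}. point x \<subseteq> line u} = {x. dot u x = 0} - {0}"
    unfolding point_subset_line by blast
  finally show ?thesis .
qed

lemma lines_through_point:
  fixes x :: "'a::{field,finite}^3"
  shows "{L \<in> PG_lines. point x \<subseteq> L} = line ` ({u. dot x u = 0} - {0})"
proof -
  have "{L \<in> PG_lines. point x \<subseteq> L} = line ` {u \<in> {u. u \<noteq> 0}. point x \<subseteq> line u}"
    unfolding PG_lines_eq by blast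
  also have "{u \<in> {u. u \<noteq> 0}. point x \<subseteq> line u} = {u. dot x u = 0} - {0}"
    unfolding point_subset_line dot_commute[of _ x] by blast
  finally show ?thesis .
qed

lemma PG_proj_plane:
  "proj_plane (PG_points :: ('a::{field,finite}^3) set set) PG_lines (\<subseteq>) CARD('a)"
proof
  note q = card_field_ge_2[where 'a='a]
  note cancel = geometric_cancel[OF q]
  show "2 \<le> CARD('a)" by (rule q)
  show "finite (PG_points :: ('a^3) set set)" "finite (PG_lines :: ('a^3) set set)" by simp_all
  have "(PG_points :: ('a^3) set set) = point ` (UNIV - {0})"
    "(PG_lines :: ('a^3) set set) = line ` (UNIV - {0})" by (auto simp: PG_points_eq PG_lines_eq)
  then show "card (PG_points :: ('a^3) set set) = CARD('a)^2 + CARD('a) + 1"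
    "card (PG_lines :: ('a^3) set set) = CARD('a)^2 + CARD('a) + 1"
    using card_points_of[of "UNIV :: ('a^3) set"] card_lines_of[of "UNIV :: ('a^3) set"]
    by (auto intro!: cancel(1) simp del: One_nat_def)
next
  note cancel = geometric_cancel[OF card_field_ge_2[where 'a='a]]
  fix L :: "('a^3) set" assume "L \<in> PG_lines"
  then obtain u where u: "u \<noteq> 0" "L = line u" by (auto simp: PG_lines_eq)
  show "card {P \<in> PG_points. P \<subseteq> L} = CARD('a) + 1"
    unfolding u points_on_line using card_points_of[OF subspace_dot[of u]] card_dot_zero[OF u(1)]
    by (intro cancel(2)) simp
  fix L' :: "('a^3) set" assume "L' \<in> PG_lines" "L \<noteq> L'"
  then obtain w where w: "w \<noteq> 0" "L' = line w" by (auto simp: PG_lines_eq)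
  have nw: "w \<noteq> c *s u" for c using line_eq_iff[OF u(1) w(1)] u w \<open>L \<noteq> L'\<close> by auto
  have "{P \<in> PG_points. P \<subseteq> L \<and> P \<subseteq> L'} = point ` ({x. dot u x = 0 \<and> dot w x = 0} - {0})"
  proof -
    have "{P \<in> PG_points. P \<subseteq> L \<and> P \<subseteq> L'}
        = point ` {x \<in> {x. x \<noteq> 0}. point x \<subseteq> line u \<and> point x \<subseteq> line w}"
      unfolding PG_points_eq u w by blast
    also have "{x \<in> {x. x \<noteq> 0}. point x \<subseteq> line u \<and> point x \<subseteq> line w}
        = {x. dot u x = 0 \<and> dot w x = 0} - {0}"
      unfolding point_subset_line by blast
    finally show ?thesis .
  qed
  moreover have "vec.subspace {x. dot u x = 0 \<and> dot w x = 0}" by (auto simp: vec.subspace_def dot_simps)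
  from card_points_of[OF this] have "card (point ` ({x. dot u x = 0 \<and> dot w x = 0} - {0})) = 1"
    using card_dot_zero2[OF u(1) nw] by (intro cancel(3)) simp
  ultimately show "card {P \<in> PG_points. P \<subseteq> L \<and> P \<subseteq> L'} = 1" by (simp only:)
next
  note cancel = geometric_cancel[OF card_field_ge_2[where 'a='a]]
  fix P :: "('a^3) set" assume "P \<in> PG_points"
  then obtain x where x: "x \<noteq> 0" "P = point x" by (auto simp: PG_points_eq)
  show "card {L \<in> PG_lines. P \<subseteq> L} = CARD('a) + 1"
    unfolding x lines_through_point using card_lines_of[OF subspace_dot[of x]] card_dot_zero[OF x(1)]
    by (intro cancel(2)) simp
  fix P' :: "('a^3) set" assume "P' \<in> PG_points" "P \<noteq> P'"
  then obtain y where y: "y \<noteq> 0" "P' = point y" by (auto simp: PG_points_eq)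
  have ny: "y \<noteq> c *s x" for c using point_eq_iff[OF x(1), of y] x y \<open>P \<noteq> P'\<close> by auto
  have "{L \<in> PG_lines. P \<subseteq> L \<and> P' \<subseteq> L} = line ` ({u. dot x u = 0 \<and> dot y u = 0} - {0})"
  proof -
    have "{L \<in> PG_lines. P \<subseteq> L \<and> P' \<subseteq> L}
        = line ` {u \<in> {u. u \<noteq> 0}. point x \<subseteq> line u \<and> point y \<subseteq> line u}"
      unfolding PG_lines_eq x y by blast
    also have "{u \<in> {u. u \<noteq> 0}. point x \<subseteq> line u \<and> point y \<subseteq> line u}
        = {u. dot x u = 0 \<and> dot y u = 0} - {0}"
      unfolding point_subset_line dot_commute[of _ x] dot_commute[of _ y] by blast
    finally show ?thesis .
  qed
  moreover have "vec.subspace {u. dot x u = 0 \<and> dot y u = 0}" by (auto simp: vec.subspace_def dot_simps)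
  from card_lines_of[OF this] have "card (line ` ({u. dot x u = 0 \<and> dot y u = 0} - {0})) = 1"
    using card_dot_zero2[OF x(1) ny] by (intro cancel(3)) simp
  ultimately show "card {L \<in> PG_lines. P \<subseteq> L \<and> P' \<subseteq> L} = 1" by (simp only:)
qed

section \<open>The two invariants of the incidence graph\<close>

lemma PG_edges_iff:
  "{x, v} \<in> PG_edges \<longleftrightarrow>
     x \<in> PG_points \<and> v \<in> PG_lines \<and> x \<subseteq> v \<or> v \<in> PG_points \<and> x \<in> PG_lines \<and> v \<subseteq> x"
  unfolding PG_edges_def by (auto simp: doubleton_eq_iff)

lemma PG_points_lines_disjoint: "PG_points \<inter> PG_lines = {}"
  by (auto simp: PG_points_def PG_lines_def)

lemma PG_edge_iff: "P \<in> PG_points \<Longrightarrow> L \<in> PG_lines \<Longrightarrow> {P, L} \<in> PG_edges \<longleftrightarrow> P \<subseteq> L"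
  using PG_points_lines_disjoint unfolding PG_edges_iff by blast

lemma vertex_boundary_PG:
  assumes "X \<subseteq> PG_points \<union> PG_lines"
  shows "vertex_boundary (PG_points \<union> PG_lines) PG_edges X =
    {P \<in> PG_points - X. \<exists>L\<in>X \<inter> PG_lines. P \<subseteq> L} \<union> {L \<in> PG_lines - X. \<exists>P\<in>X \<inter> PG_points. P \<subseteq> L}"
  unfolding vertex_boundary_def PG_edges_iff using assms PG_points_lines_disjoint by blast

lemma PG_invariants:
  fixes S T :: "('a::{field,finite}^3) set set"
  assumes bnd: "bounded_plane (PG_points :: ('a^3) set set) PG_lines (\<subseteq>) CARD('a) \<alpha>"
    and check: "isoperimetric_check (int CARD('a)) (int \<alpha>) (int t0)"
    and ST: "S \<subseteq> PG_points" "T \<subseteq> PG_lines" "card S = \<alpha>" "card T = \<alpha>"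
      "\<And>P L. P \<in> S \<Longrightarrow> L \<in> T \<Longrightarrow> \<not> P \<subseteq> L"
  shows "PG_incidence_free_number TYPE('a) = \<alpha> \<and>
    PG_isoperimetric_number TYPE('a) = 1 - real \<alpha> / real (CARD('a)^2 + CARD('a) + 1)"
proof
  interpret bounded_plane "PG_points :: ('a^3) set set" PG_lines "(\<subseteq>)" "CARD('a)" \<alpha> by (rule bnd)
  let ?P = "PG_points :: ('a^3) set set" and ?L = "PG_lines :: ('a^3) set set"
  note disj = PG_points_lines_disjoint[where 'a='a]
  have pair: "incidence_free_pair ?P ?L PG_edges A D \<longleftrightarrow> disjoint_pair A D \<and> card A = card D" for A D
  proof -
    have "(\<forall>P\<in>A. \<forall>L\<in>D. {P, L} \<notin> PG_edges) \<longleftrightarrow> (\<forall>P\<in>A. \<forall>L\<in>D. \<not> P \<subseteq> L)"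
      if "A \<subseteq> ?P" "D \<subseteq> ?L"
      using that by (intro ball_cong refl) (simp only: PG_edge_iff subsetD)
    then show ?thesis unfolding incidence_free_pair_def disjoint_pair_def by argo
  qed
  have dST: "disjoint_pair S T" using ST by (simp add: disjoint_pair_def)
  show "PG_incidence_free_number TYPE('a) = \<alpha>"
    unfolding PG_incidence_free_number_def incidence_free_number_def pair
  proof (rule Max_eqI)
    show "finite {card A | A D. disjoint_pair A D \<and> card A = card D}" by (simp add: finite_image_set2)
    show "y \<le> \<alpha>" if "y \<in> {card A | A D. disjoint_pair A D \<and> card A = card D}" for y
      using that \<alpha>_bound by fastforce
    show "\<alpha> \<in> {card A | A D. disjoint_pair A D \<and> card A = card D}"
      using dST ST by (intro CollectI exI[of _ S] exI[of _ T]) simp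
  qed
  have N: "0 < real N" by (simp add: add_pos_nonneg)
  have \<alpha>_le: "\<alpha> \<le> N" using card_mono[OF finite_Pts ST(1)] ST card_Pts by simp
  have cV: "card (?P \<union> ?L) = 2 * N"
    using card_Un_disjoint[OF finite_Pts finite_Lns disj] card_Pts card_Lns by simp
  define \<delta> where "\<delta> X = card (vertex_boundary (?P \<union> ?L) PG_edges X)" for X
  have lower: "real (card X) * (real N - real \<alpha>) \<le> real N * real (\<delta> X)"
    if X: "X \<subseteq> ?P \<union> ?L" "real (card X) \<le> real (card (?P \<union> ?L)) / 2" for X
  proof -
    define A B where "A = X \<inter> ?P" and "B = X \<inter> ?L"
    \<comment> \<open>With these sets the boundary is everything outside \<open>A\<close>,
      \<open>B\<close>, \<open>C\<close> and \<open>D\<close>, so a lower bound on it is an upper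
      bound on the sizes of the two disjoint pairs.\<close>
    define C D where "C = {P \<in> ?P - A. \<forall>L\<in>B. \<not> P \<subseteq> L}" and "D = {L \<in> ?L - B. \<forall>P\<in>A. \<not> P \<subseteq> L}"
    have "disjoint_pair A D" "disjoint_pair C B" "A \<inter> C = {}" "B \<inter> D = {}"
      by (auto simp: disjoint_pair_def A_def B_def C_def D_def)
    note iso = isoperimetric[OF this _ check]
    have XAB: "X = A \<union> B" "A \<inter> B = {}" using X disj by (auto simp: A_def B_def)
    from XAB have cX: "card X = card A + card B" by (simp add: card_Un_disjoint)
    have "2 * card X \<le> card (?P \<union> ?L)" using X(2) by linarith
    then have "card A + card B \<le> N" unfolding cX cV by (simp only: mult_le_cancel1)
    note iso = iso[OF this]
    have "vertex_boundary (?P \<union> ?L) PG_edges X = (?P - A - C) \<union> (?L - B - D)"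
      unfolding vertex_boundary_PG[OF X(1)] A_def B_def C_def D_def by blast
    moreover have "(?P - A - C) \<inter> (?L - B - D) = {}" using disj by blast
    ultimately have "\<delta> X = card (?P - A - C) + card (?L - B - D)"
      by (simp add: \<delta>_def card_Un_disjoint)
    moreover have "int (card (?P - A - C)) = int N - int (card A) - int (card C)"
      by (intro card_outside) (auto simp: A_def C_def)
    moreover have "int (card (?L - B - D)) = int N - int (card B) - int (card D)"
    proof -
      interpret d: bounded_plane ?L ?P "\<lambda>l p. p \<subseteq> l" "CARD('a)" \<alpha> by (rule bounded_dual)
      show ?thesis by (intro d.card_outside) (auto simp: B_def D_def)
    qed
    ultimately have e: "2 * int N - int (card A) - int (card B) - int (card C) - int (card D) = int (\<delta> X)"
      by (simp del: of_nat_Suc)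
    have "int (card X) * (int N - int \<alpha>) \<le> int N * int (\<delta> X)"
      using iso unfolding e cX by simp
    then have "real_of_int (int (card X) * (int N - int \<alpha>)) \<le> real_of_int (int N * int (\<delta> X))"
      by (simp only: of_int_le_iff)
    then show ?thesis by simp
  qed
  show "PG_isoperimetric_number TYPE('a) = 1 - real \<alpha> / real N"
    unfolding PG_isoperimetric_number_def vertex_isoperimetric_number_def \<delta>_def[symmetric]
  proof (rule Min_eqI)
    let ?M = "{real (\<delta> X) / real (card X) | X.
      X \<noteq> {} \<and> X \<subseteq> ?P \<union> ?L \<and> real (card X) \<le> real (card (?P \<union> ?L)) / 2}"
    show "finite ?M" by (simp add: finite_image_set)
    show "1 - real \<alpha> / real N \<le> y" if y: "y \<in> ?M" for y
    proof -
      obtain X where X: "X \<noteq> {}" "X \<subseteq> ?P \<union> ?L" "real (card X) \<le> real (card (?P \<union> ?L)) / 2"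
        "y = real (\<delta> X) / real (card X)" using y by blast
      have "0 < real (card X)" using X(1) by (simp add: card_gt_0_iff)
      moreover have "1 - real \<alpha> / real N = (real N - real \<alpha>) / real N" using N by (simp add: field_simps)
      ultimately show ?thesis unfolding X(4) using lower[OF X(2,3)] N
        by (simp add: divide_le_eq le_divide_eq mult.commute)
    qed
    define X where "X = S \<union> (?L - T)"
    have X: "X \<subseteq> ?P \<union> ?L" using ST by (auto simp: X_def)
    have "S \<inter> (?L - T) = {}" using ST disj by blast
    then have "card X = card S + card (?L - T)" unfolding X_def by (simp add: card_Un_disjoint)
    \<comment> \<open>This is exactly half of all vertices, the largest size allowed.\<close>
    then have cX: "card X = N" using ST card_Lns \<alpha>_le by (simp add: card_Diff_subset)
    have "X \<inter> ?P = S" "?L - X = T" using ST(1,2) disj by (auto simp: X_def)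
    then have "{L \<in> ?L - X. \<exists>P\<in>X \<inter> ?P. P \<subseteq> L} = {}" using ST(5) by simp
    moreover have "{P \<in> ?P - X. \<exists>L\<in>X \<inter> ?L. P \<subseteq> L} \<subseteq> ?P - S" by (auto simp: X_def)
    ultimately have "vertex_boundary (?P \<union> ?L) PG_edges X \<subseteq> ?P - S"
      unfolding vertex_boundary_PG[OF X] by (simp only: Un_empty_right)
    then have "\<delta> X \<le> card (?P - S)" unfolding \<delta>_def by (intro card_mono) auto
    also have "\<dots> = N - \<alpha>" using ST card_Pts by (simp add: card_Diff_subset)
    finally have "\<delta> X + \<alpha> \<le> N" using \<alpha>_le by linarith
    then have "real (\<delta> X + \<alpha>) \<le> real N" by (simp only: of_nat_le_iff)
    then have "real (\<delta> X) \<le> real N - real \<alpha>" by (simp only: of_nat_add)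
    moreover have small: "real (card X) \<le> real (card (?P \<union> ?L)) / 2" using cX cV by simp
    \<comment> \<open>The reverse estimate is the isoperimetric inequality for this very set, so its
      boundary need not be determined directly.\<close>
    moreover have "real N - real \<alpha> \<le> real (\<delta> X)" using lower[OF X small] cX N by simp
    ultimately have "real (\<delta> X) = real N - real \<alpha>" by linarith
    then have "1 - real \<alpha> / real N = real (\<delta> X) / real (card X)" using cX N by (simp add: field_simps)
    moreover have "X \<noteq> {}" using cX by auto
    ultimately show "1 - real \<alpha> / real N \<in> ?M" using X small by blast
  qed
qed

section \<open>Incidence-free pairs in logarithmic coordinates\<close>

text \<open>A code \<open>c\<close> stands for the field element \<open>0\<close> if \<open>c = 0\<close> and for \<open>g ^ (c - 1)\<close> otherwise, where \<open>g\<close>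
  generates the multiplicative group, of order \<open>m\<close>. The list \<open>Z\<close> of Zech logarithms contains the codes of \<open>1 + g ^ k\<close>
  for \<open>k < m\<close>.\<close>
definition code_mult :: "int \<Rightarrow> int \<Rightarrow> int \<Rightarrow> int" where
  "code_mult m a b = (if a = 0 \<or> b = 0 then 0 else if m < a + b - 1 then a + b - 1 - m else a + b - 1)"

text \<open>Uses \<open>g^i + g^j = g^i * (1 + g^(j - i))\<close>, with the exponent difference
  taken modulo \<open>m\<close>.\<close>

definition code_add :: "int \<Rightarrow> int list \<Rightarrow> int \<Rightarrow> int \<Rightarrow> int" where
  "code_add m Z a b =
     (if a = 0 then b else if b = 0 then a
      else code_mult m a (Z ! nat (if b < a then b - a + m else b - a)))"

definition code_dot :: "int \<Rightarrow> int list \<Rightarrow> int \<times> int \<times> int \<Rightarrow> int \<times> int \<times> int \<Rightarrow> int" where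
  "code_dot m Z = (\<lambda>(a, b, c) (a', b', c').
     code_add m Z (code_add m Z (code_mult m a a') (code_mult m b b')) (code_mult m c c'))"

text \<open>Homogeneous coordinates are normalised so that the first nonzero one is 1, whose code is
  1. Distinct triples then stand for distinct points or lines.\<close>

definition code_valid :: "int \<Rightarrow> int \<times> int \<times> int \<Rightarrow> bool" where
  "code_valid m = (\<lambda>(a, b, c). 0 \<le> a \<and> a \<le> m \<and> 0 \<le> b \<and> b \<le> m \<and> 0 \<le> c \<and> c \<le> m \<and>
     (a = 1 \<or> a = 0 \<and> (b = 1 \<or> b = 0 \<and> c = 1)))"

definition pair_check ::
  "int \<Rightarrow> int list \<Rightarrow> (int \<times> int \<times> int) list \<Rightarrow> (int \<times> int \<times> int) list \<Rightarrow> bool" where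
  "pair_check m Z S T \<longleftrightarrow> list_all (code_valid m) S \<and> list_all (code_valid m) T \<and>
     distinct S \<and> distinct T \<and> list_all (\<lambda>s. list_all (\<lambda>t. code_dot m Z s t \<noteq> 0) T) S"

definition code_val :: "'a::field \<Rightarrow> int \<Rightarrow> 'a" where
  "code_val g c = (if c = 0 then 0 else g ^ nat (c - 1))"

definition code_vec :: "'a::field \<Rightarrow> int \<times> int \<times> int \<Rightarrow> 'a^3" where
  "code_vec g = (\<lambda>(a, b, c). vector [code_val g a, code_val g b, code_val g c])"

text \<open>Zech logarithms are verified in the basis \<open>1, g, g\<^sup>2, \<dots>\<close> over the prime field, with integers modulo
  \<open>p\<close> as coefficients; \<open>rs\<close> holds the coefficients of the first power of \<open>g\<close> that is not a basis element, and \<open>h\<close>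
  is the exponent with \<open>g ^ h = -1\<close>.\<close>
definition horner :: "'a::field \<Rightarrow> int list \<Rightarrow> 'a" where
  "horner g cs = foldr (\<lambda>c x. of_int c + g * x) cs 0"

text \<open>Multiplication by \<open>g\<close> on coefficient lists, lowest degree first: shift up
  and replace the overflowing power by its expansion \<open>rs\<close>, as the companion matrix
  does.\<close>

definition shift_mod :: "int \<Rightarrow> int list \<Rightarrow> int list \<Rightarrow> int list" where
  "shift_mod p rs cs = map2 (\<lambda>x r. (x + last cs * r) mod p) (0 # butlast cs) rs"

primrec power_list :: "int \<Rightarrow> int list \<Rightarrow> int list \<Rightarrow> nat \<Rightarrow> int list list" where
  "power_list p rs cs 0 = []"
| "power_list p rs cs (Suc n) = cs # power_list p rs (shift_mod p rs cs) n"

text \<open>A code \<open>z\<close> has exponent \<open>z - 1\<close>, so the coefficients of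
  \<open>1 + g^k\<close> are compared with entry \<open>Z ! nat k - 1\<close> of the list of powers.
  Requiring the code 0 to occur only at \<open>h\<close> certifies the order of
  \<open>g\<close>.\<close>

definition zech_check :: "int \<Rightarrow> int list \<Rightarrow> int list \<Rightarrow> int \<Rightarrow> bool" where
  "zech_check p rs Z h \<longleftrightarrow>
     (let n = length Z; m = int n; u = 1 # map (\<lambda>_. 0) (tl rs); P = power_list p rs u n
      in rs \<noteq> [] \<and> 0 \<le> h \<and> h < m \<and> Z ! nat h = 0 \<and>
         list_all (\<lambda>z. 0 \<le> z \<and> z \<le> m) Z \<and>
         list_all (\<lambda>k. k = h \<or> Z ! nat k \<noteq> 0) [0..m-1] \<and>
         list_all (\<lambda>k. map2 (\<lambda>x y. (x + y) mod p) u (P ! nat k)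
            = (if Z ! nat k = 0 then map (\<lambda>_. 0) rs else P ! nat (Z ! nat k - 1))) [0..m-1])"

locale zech_field =
  fixes g :: "'a::{field,finite}" and Z :: "int list" and m h :: int
  assumes gm: "g ^ nat m = 1" and h: "0 \<le> h" "h < m" "Z ! nat h = 0"
    and h_unique: "\<And>k. 0 \<le> k \<Longrightarrow> k < m \<Longrightarrow> Z ! nat k = 0 \<Longrightarrow> k = h"
    and Z_range: "\<And>k. 0 \<le> k \<Longrightarrow> k < m \<Longrightarrow> 0 \<le> Z ! nat k \<and> Z ! nat k \<le> m"
    and zech: "\<And>k. 0 \<le> k \<Longrightarrow> k < m \<Longrightarrow> 1 + g ^ nat k = code_val g (Z ! nat k)"
begin

lemma g_nonzero: "g \<noteq> 0"
  using gm h by (cases "g = 0") (auto simp: power_0_left split: if_splits)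

lemma code_val_0: "code_val g 0 = 0" and code_val_1: "code_val g 1 = 1"
  by (simp_all add: code_val_def)

lemma code_val_zero_iff: "code_val g c = 0 \<longleftrightarrow> c = 0"
  using g_nonzero by (simp add: code_val_def)

lemma code_mult:
  assumes "0 \<le> a" "a \<le> m" "0 \<le> b" "b \<le> m"
  shows "code_val g (code_mult m a b) = code_val g a * code_val g b"
    and "0 \<le> code_mult m a b \<and> code_mult m a b \<le> m"
proof -
  show "0 \<le> code_mult m a b \<and> code_mult m a b \<le> m" using assms by (auto simp: code_mult_def)
  show "code_val g (code_mult m a b) = code_val g a * code_val g b"
  proof (cases "a = 0 \<or> b = 0")
    case False
    then have ab: "1 \<le> a" "1 \<le> b" using assms by auto
    then have "code_val g a * code_val g b = g ^ (nat (a - 1) + nat (b - 1))"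
      by (simp add: code_val_def power_add)
    also have "nat (a - 1) + nat (b - 1) = nat (a + b - 2)" using ab by simp
    finally have v: "code_val g a * code_val g b = g ^ nat (a + b - 2)" .
    show ?thesis
    proof (cases "m < a + b - 1")
      case True
      then have "nat (a + b - 2) = nat (a + b - 2 - m) + nat m" using ab h by simp
      then have "g ^ nat (a + b - 2) = g ^ nat (a + b - 2 - m)" by (simp add: power_add gm)
      moreover have e: "code_mult m a b = a + b - 1 - m" using True ab by (simp add: code_mult_def)
      moreover have "code_val g (a + b - 1 - m) = g ^ nat (a + b - 1 - m - 1)"
        using True by (simp add: code_val_def)
      moreover have "a + b - 1 - m - 1 = a + b - 2 - m" by simp
      ultimately show ?thesis using v by (simp only:)
    next
      case False
      then have e: "code_mult m a b = a + b - 1" using ab by (simp add: code_mult_def)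
      have "code_val g (a + b - 1) = g ^ nat (a + b - 1 - 1)" using ab by (simp add: code_val_def)
      moreover have "a + b - 1 - 1 = a + b - 2" by simp
      ultimately show ?thesis using v e by (simp only:)
    qed
  qed (auto simp: code_mult_def code_val_0)
qed

lemma code_add:
  assumes "0 \<le> a" "a \<le> m" "0 \<le> b" "b \<le> m"
  shows "code_val g (code_add m Z a b) = code_val g a + code_val g b"
    and "0 \<le> code_add m Z a b \<and> code_add m Z a b \<le> m"
proof -
  define k where "k = (if b < a then b - a + m else b - a)"
  have sum: "code_val g (code_add m Z a b) = code_val g a + code_val g b \<and>
      0 \<le> code_add m Z a b \<and> code_add m Z a b \<le> m" if ab: "a \<noteq> 0" "b \<noteq> 0"
  proof -
    have k: "0 \<le> k" "k < m" using assms ab by (auto simp: k_def)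
    have ca: "code_add m Z a b = code_mult m a (Z ! nat k)" using ab by (simp add: code_add_def k_def)
    have "g ^ nat (a - 1) * g ^ nat k = g ^ nat (b - 1)"
    proof (cases "b < a")
      case True
      have "g ^ nat (a - 1) * g ^ nat k = g ^ (nat (a - 1) + nat k)" by (simp add: power_add)
      also have "nat (a - 1) + nat k = nat (b - 1) + nat m"
        using True assms ab k by (simp add: k_def)
      finally show ?thesis by (simp add: power_add gm)
    next
      case False
      have "g ^ nat (a - 1) * g ^ nat k = g ^ (nat (a - 1) + nat k)" by (simp add: power_add)
      also have "nat (a - 1) + nat k = nat (b - 1)" using False assms ab k by (simp add: k_def)
      finally show ?thesis .
    qed
    then have "code_val g a + code_val g b = code_val g a * code_val g (Z ! nat k)"
      using ab zech[OF k, symmetric] by (simp add: code_val_def algebra_simps)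
    then show ?thesis unfolding ca using code_mult[of a "Z ! nat k"] assms Z_range[OF k] by simp
  qed
  show "code_val g (code_add m Z a b) = code_val g a + code_val g b"
    using sum by (cases "a = 0 \<or> b = 0") (auto simp: code_add_def code_val_0)
  show "0 \<le> code_add m Z a b \<and> code_add m Z a b \<le> m"
    using sum assms by (cases "a = 0 \<or> b = 0") (auto simp: code_add_def)
qed

text \<open>If two of the powers coincided, a second exponent \<open>k \<noteq> h\<close> would
  satisfy \<open>g^k = g^h = -1\<close>, so \<open>Z\<close> would contain 0 twice. No separate
  proof that \<open>g\<close> is primitive is required.\<close>

lemma code_val_less:
  assumes "1 \<le> a" "a < b" "b \<le> m"
  shows "code_val g a \<noteq> code_val g b"
proof
  assume "code_val g a = code_val g b"
  then have "g ^ nat (a - 1) = g ^ nat (b - 1)" using assms by (simp add: code_val_def)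
  also have "nat (b - 1) = nat (a - 1) + nat (b - a)" using assms by simp
  finally have "g ^ nat (b - a) = 1" using g_nonzero by (simp add: power_add)
  then have g: "g ^ nat (h + (b - a)) = g ^ nat h"
    using assms h by (simp add: nat_add_distrib power_add)
  define k where "k = (if h + (b - a) < m then h + (b - a) else h + (b - a) - m)"
  have k: "0 \<le> k" "k < m" "k \<noteq> h" using assms h by (auto simp: k_def)
  have "g ^ nat k = g ^ nat (h + (b - a))"
  proof (cases "h + (b - a) < m")
    case False
    then have "nat (h + (b - a)) = nat k + nat m" using h by (simp add: k_def)
    then show ?thesis by (simp add: power_add gm)
  qed (simp add: k_def)
  then have "code_val g (Z ! nat k) = code_val g (Z ! nat h)" using g zech k h by metis
  then have "Z ! nat k = 0" using h code_val_zero_iff code_val_0 by simp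
  then show False using h_unique k by blast
qed

lemma code_val_inj:
  assumes "0 \<le> a" "a \<le> m" "0 \<le> b" "b \<le> m" "code_val g a = code_val g b"
  shows "a = b"
proof (cases "a = 0 \<or> b = 0")
  case True
  then show ?thesis using assms(5) code_val_zero_iff by (metis code_val_0)
next
  case False
  then have "1 \<le> a" "1 \<le> b" using assms by auto
  then show ?thesis
    using code_val_less[of a b] code_val_less[of b a] assms by (cases a b rule: linorder_cases) auto
qed

lemma code_vec_nth:
  "code_vec g (a, b, c) $ 1 = code_val g a" "code_vec g (a, b, c) $ 2 = code_val g b"
  "code_vec g (a, b, c) $ 3 = code_val g c"
  by (simp_all add: code_vec_def)

lemma code_vec_nonzero: "code_valid m t \<Longrightarrow> code_vec g t \<noteq> 0"
  by (cases t) (auto simp: code_valid_def vec_eq_iff forall_3 code_vec_nth code_val_zero_iff)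

text \<open>Comparing the leading coordinates, both equal to 1, shows that the scalar is 1.\<close>

lemma code_vec_scale:
  assumes "code_valid m t" "code_valid m t'" "code_vec g t' = c *s code_vec g t" "c \<noteq> 0"
  shows "t = t'"
proof -
  obtain x y z x' y' z' where t: "t = (x, y, z)" "t' = (x', y', z')" by (cases t, cases t')
  have e: "code_val g x' = c * code_val g x" "code_val g y' = c * code_val g y"
    "code_val g z' = c * code_val g z"
    using assms(3) unfolding t by (auto simp: vec_eq_iff forall_3 code_vec_nth)
  have "c = 1"
    using assms(1,2,4) e unfolding t
    by (auto simp: code_valid_def code_val_0 code_val_1 code_val_zero_iff)
  then show ?thesis using assms(1,2) e unfolding t by (auto simp: code_valid_def intro: code_val_inj)
qed

lemma code_dot:
  assumes "code_valid m t" "code_valid m t'"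
  shows "dot (code_vec g t) (code_vec g t') = code_val g (code_dot m Z t t')"
proof -
  obtain x y z x' y' z' where t: "t = (x, y, z)" "t' = (x', y', z')" by (cases t, cases t')
  have r: "0 \<le> x" "x \<le> m" "0 \<le> y" "y \<le> m" "0 \<le> z" "z \<le> m"
    "0 \<le> x'" "x' \<le> m" "0 \<le> y'" "y' \<le> m" "0 \<le> z'" "z' \<le> m"
    using assms by (auto simp: t code_valid_def)
  show ?thesis
    unfolding t dot_def sum_3 code_vec_nth code_dot_def prod.case using r
    by (simp add: code_add code_mult)
qed

lemma pair_check_sound:
  assumes "pair_check m Z S T"
  shows "\<exists>A D. A \<subseteq> (PG_points :: ('a^3) set set) \<and> D \<subseteq> PG_lines \<and>
    card A = length S \<and> card D = length T \<and> (\<forall>P\<in>A. \<forall>L\<in>D. \<not> P \<subseteq> L)"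
proof -
  have S: "\<And>s. s \<in> set S \<Longrightarrow> code_valid m s" "distinct S"
    and T: "\<And>t. t \<in> set T \<Longrightarrow> code_valid m t" "distinct T"
    and ST: "\<And>s t. s \<in> set S \<Longrightarrow> t \<in> set T \<Longrightarrow> code_dot m Z s t \<noteq> 0"
    using assms by (auto simp: pair_check_def list_all_iff)
  have "inj_on (\<lambda>t. point (code_vec g t)) (set S)"
  proof (rule inj_onI)
    fix s s' assume h: "s \<in> set S" "s' \<in> set S" "point (code_vec g s) = point (code_vec g s')"
    then obtain c where "c \<noteq> 0" "code_vec g s' = c *s code_vec g s"
      using point_eq_iff[OF code_vec_nonzero] S(1) by blast
    then show "s = s'" using code_vec_scale S(1) h by blast
  qed
  then have cA: "card ((\<lambda>t. point (code_vec g t)) ` set S) = length S"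
    using S(2) by (simp add: card_image distinct_card)
  have "inj_on (\<lambda>t. line (code_vec g t)) (set T)"
  proof (rule inj_onI)
    fix t t' assume h: "t \<in> set T" "t' \<in> set T" "line (code_vec g t) = line (code_vec g t')"
    then obtain c where "c \<noteq> 0" "code_vec g t' = c *s code_vec g t"
      using line_eq_iff[OF code_vec_nonzero code_vec_nonzero] T(1) by blast
    then show "t = t'" using code_vec_scale T(1) h by blast
  qed
  then have cD: "card ((\<lambda>t. line (code_vec g t)) ` set T) = length T"
    using T(2) by (simp add: card_image distinct_card)
  have "\<not> point (code_vec g s) \<subseteq> line (code_vec g t)" if "s \<in> set S" "t \<in> set T" for s t
    using code_dot[OF S(1) T(1), OF that] ST[OF that] code_val_zero_iff
    by (simp add: point_subset_line dot_commute)
  then show ?thesis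
    using cA cD S(1) T(1) code_vec_nonzero
    by (intro exI[of _ "(\<lambda>t. point (code_vec g t)) ` set S"] exI[of _ "(\<lambda>t. line (code_vec g t)) ` set T"])
      (auto simp: PG_points_eq PG_lines_eq)
qed

end

section \<open>Correctness of the Zech logarithms\<close>

lemma horner_Nil: "horner g [] = 0" and horner_Cons: "horner g (c # cs) = of_int c + g * horner g cs"
  by (simp_all add: horner_def)

lemma horner_append: "horner g (xs @ [y]) = horner g xs + of_int y * g ^ length xs"
  by (induction xs) (simp_all add: horner_Nil horner_Cons algebra_simps)

lemma horner_zeros: "horner g (map (\<lambda>_. 0) xs) = 0"
  by (induction xs) (simp_all add: horner_Nil horner_Cons)

lemma of_int_mod_char:
  assumes "(of_int p :: 'a::ring_1) = 0"
  shows "(of_int (x mod p) :: 'a) = of_int x"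
proof -
  have "(of_int x :: 'a) = of_int (x div p * p + x mod p)" by simp
  also have "\<dots> = of_int (x mod p)" using assms by (simp only: of_int_add of_int_mult) simp
  finally show ?thesis by simp
qed

text \<open>The factor \<open>c\<close> covers both uses: the reduction step of
  \<open>shift_mod\<close>, and with \<open>c = 1\<close> the addition in
  \<open>zech_check\<close>.\<close>

lemma horner_map2:
  assumes p: "of_int p = (0::'a::field)" and "length xs = length ys"
  shows "horner (g::'a) (map2 (\<lambda>x y. (x + c * y) mod p) xs ys) = horner g xs + of_int c * horner g ys"
  using assms(2)
  by (induction xs ys rule: list_induct2)
    (simp_all add: horner_Nil horner_Cons of_int_mod_char[OF p] algebra_simps)

lemma horner_shift_mod:
  fixes g :: "'a::field"
  assumes p: "of_int p = (0::'a)" and g: "g ^ length rs = horner g rs"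
    and cs: "length cs = length rs" "rs \<noteq> []"
  shows "horner g (shift_mod p rs cs) = g * horner g cs" "length (shift_mod p rs cs) = length rs"
proof -
  have ne: "cs \<noteq> []" using cs by auto
  then have split: "cs = butlast cs @ [last cs]" by simp
  have len: "length (0 # butlast cs) = length rs" using ne cs by (cases cs) auto
  show "length (shift_mod p rs cs) = length rs" using len by (simp add: shift_mod_def)
  have "horner g cs = horner g (butlast cs) + of_int (last cs) * g ^ length (butlast cs)"
    using horner_append[of g "butlast cs" "last cs"] split by simp
  then have "g * horner g cs = g * horner g (butlast cs) + of_int (last cs) * g ^ Suc (length (butlast cs))"
    by (simp add: algebra_simps)
  also have "Suc (length (butlast cs)) = length rs" using len by simp
  also have "g * horner g (butlast cs) + of_int (last cs) * g ^ length rs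
      = horner g (0 # butlast cs) + of_int (last cs) * horner g rs"
    using g by (simp add: horner_Cons)
  also have "\<dots> = horner g (shift_mod p rs cs)"
    unfolding shift_mod_def by (rule horner_map2[OF p len, symmetric])
  finally show "horner g (shift_mod p rs cs) = g * horner g cs" by simp
qed

lemma horner_power_list:
  fixes g :: "'a::field"
  assumes p: "of_int p = (0::'a)" and g: "g ^ length rs = horner g rs" and rs: "rs \<noteq> []"
  shows "length cs = length rs \<Longrightarrow> i < n \<Longrightarrow>
    horner g (power_list p rs cs n ! i) = g ^ i * horner g cs \<and> length (power_list p rs cs n ! i) = length rs"
proof (induction n arbitrary: cs i)
  case (Suc n)
  note sh = horner_shift_mod[OF p g Suc.prems(1) rs]
  show ?case
  proof (cases i)
    case (Suc j)
    then show ?thesis using Suc.IH[OF sh(2), of j] Suc.prems sh(1) by (simp add: mult_ac)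
  qed (use Suc.prems in simp)
qed simp

lemma power_card_minus_one:
  fixes x :: "'a::{field,finite}"
  assumes "x \<noteq> 0"
  shows "x ^ (CARD('a) - 1) = 1"
proof -
  have "bij_betw ((*) x) (UNIV - {0}) (UNIV - {0})"
    using assms by (intro bij_betwI[where g = "\<lambda>y. y / x"]) auto
  then have "(\<Prod>y\<in>UNIV - {0::'a}. x * y) = (\<Prod>y\<in>UNIV - {0}. y)" by (rule prod.reindex_bij_betw)
  then have "x ^ card (UNIV - {0::'a}) * (\<Prod>y\<in>UNIV - {0}. y) = (\<Prod>y\<in>UNIV - {0::'a}. y)"
    by (simp only: prod.distrib prod_constant)
  moreover have "(\<Prod>y\<in>UNIV - {0::'a}. y) \<noteq> 0" by simp
  ultimately show ?thesis by (simp add: card_Diff_singleton)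
qed

lemma zech_check_sound:
  fixes g :: "'a::{field,finite}"
  assumes check: "zech_check p rs Z h" and p: "of_int p = (0::'a)"
    and g: "g ^ length rs = horner g rs" "g \<noteq> 0" and card: "CARD('a) = Suc (length Z)"
  shows "zech_field g Z (int (length Z)) h"
proof
  let ?u = "1 # map (\<lambda>_. 0::int) (tl rs)" and ?m = "int (length Z)"
  have rs: "rs \<noteq> []" and hh: "0 \<le> h" "h < ?m" "Z ! nat h = 0"
    and Zr: "\<And>z. z \<in> set Z \<Longrightarrow> 0 \<le> z \<and> z \<le> ?m"
    and hu: "\<And>k. 0 \<le> k \<Longrightarrow> k < ?m \<Longrightarrow> k = h \<or> Z ! nat k \<noteq> 0"
    and ze: "\<And>k. 0 \<le> k \<Longrightarrow> k < ?m \<Longrightarrow>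
       map2 (\<lambda>x y. (x + y) mod p) ?u (power_list p rs ?u (length Z) ! nat k)
       = (if Z ! nat k = 0 then map (\<lambda>_. 0) rs
          else power_list p rs ?u (length Z) ! nat (Z ! nat k - 1))"
    using check by (auto simp: zech_check_def Let_def list_all_iff)
  show "g ^ nat ?m = 1" using power_card_minus_one[OF g(2)] card by simp
  show "0 \<le> h" "h < ?m" "Z ! nat h = 0" by fact+
  fix k assume k: "0 \<le> k" "k < ?m"
  show "Z ! nat k = 0 \<Longrightarrow> k = h" using hu[OF k] by auto
  have Zk: "0 \<le> Z ! nat k \<and> Z ! nat k \<le> ?m" using k by (intro Zr nth_mem) auto
  then show "0 \<le> Z ! nat k \<and> Z ! nat k \<le> ?m" .
  have u: "length ?u = length rs" "horner g ?u = 1" using rs by (simp_all add: horner_Cons horner_zeros)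
  note pl = horner_power_list[OF p g(1) rs u(1), of _ "length Z", unfolded u(2) mult_1_right]
  have "horner g (map2 (\<lambda>x y. (x + 1 * y) mod p) ?u (power_list p rs ?u (length Z) ! nat k)) = 1 + g ^ nat k"
    using pl[of "nat k"] k u by (subst horner_map2[OF p]) auto
  then have "1 + g ^ nat k = horner g (if Z ! nat k = 0 then map (\<lambda>_. 0) rs
          else power_list p rs ?u (length Z) ! nat (Z ! nat k - 1))"
    using ze[OF k] by simp
  also have "\<dots> = code_val g (Z ! nat k)"
    using pl[of "nat (Z ! nat k - 1)"] Zk k by (auto simp: code_val_def horner_zeros)
  finally show "1 + g ^ nat k = code_val g (Z ! nat k)" .
qed

text \<open>Translation by 1 permutes the field, so it does not change the sum of all
  elements.\<close>

lemma of_nat_CARD: "of_nat CARD('a::{field,finite}) = (0::'a)"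
proof -
  have "bij ((+) (1::'a))" by (intro bijI' ) (auto intro: exI[of _ "_ - 1"])
  then have "(\<Sum>x\<in>UNIV. 1 + x) = (\<Sum>x\<in>(UNIV::'a set). x)" by (rule sum.reindex_bij_betw)
  then show ?thesis by (simp add: sum.distrib)
qed

lemma of_int_char:
  assumes "CARD('a::{field,finite}) = p ^ k"
  shows "of_int (int p) = (0::'a)"
proof -
  have "(of_nat p :: 'a) ^ k = 0" using of_nat_CARD[where 'a='a] assms by simp
  then show ?thesis by (cases "k = 0") auto
qed

section \<open>Generators of the fields of orders 4, 8, 9 and 16\<close>

lemma exists_nonroot:
  fixes P :: "'a::{field,finite} poly"
  assumes "P \<noteq> 0" "degree P < CARD('a)"
  shows "\<exists>x. poly P x \<noteq> 0"
proof (rule ccontr)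
  assume "\<not> ?thesis"
  then have "{x. poly P x = 0} = UNIV" by auto
  then show False using card_poly_roots_bound[OF assms(1)] assms(2) by simp
qed

lemma generator4:
  assumes "CARD('a::{field,finite}) = 2 ^ 2"
  shows "\<exists>g::'a. g \<noteq> 0 \<and> g ^ 2 = 1 + g"
proof -
  have two: "(2::'a) = 0" using of_int_char[OF assms] by simp
  obtain x :: 'a where "poly [:0, -1, 1:] x \<noteq> 0"
    using exists_nonroot[of "[:0, -1, 1::'a:]"] assms by auto
  then have x: "x \<noteq> 0" "x - 1 \<noteq> 0" by (auto simp: algebra_simps)
  have "(x - 1) * (x^2 + x + 1) = x^3 - 1" by (simp add: algebra_simps power2_eq_square power3_eq_cube)
  also have "\<dots> = 0" using power_card_minus_one[OF x(1)] assms by simp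
  finally have "x^2 + x + 1 = 0" using x by simp
  then have "x^2 = 1 + x - 2 * (1 + x)" by (simp add: algebra_simps eq_neg_iff_add_eq_0)
  then show ?thesis using x two by auto
qed

lemma generator8:
  assumes "CARD('a::{field,finite}) = 2 ^ 3"
  shows "\<exists>g::'a. g \<noteq> 0 \<and> g ^ 3 = 1 + g"
proof -
  have two: "(2::'a) = 0" using of_int_char[OF assms] by simp
  obtain x :: 'a where "poly [:0, -1, 1:] x \<noteq> 0"
    using exists_nonroot[of "[:0, -1, 1::'a:]"] assms by auto
  then have x: "x \<noteq> 0" "x - 1 \<noteq> 0" by (auto simp: algebra_simps)
  \<comment> \<open>Modulo 2 the two cubics are the irreducible factors of
    \<open>(x^7 - 1) / (x - 1)\<close>; the multiple of 2 is the discrepancy over the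
    integers.\<close>
  have "(x - 1) * ((x^3 + x + 1) * (x^3 + x^2 + 1)) = x^7 - 1 + 2 * (x^3 * (x - 1))"
    by (simp add: algebra_simps eval_nat_numeral)
  also have "\<dots> = 0" using power_card_minus_one[OF x(1)] assms two by simp
  finally have "x^3 + x + 1 = 0 \<or> x^3 + x^2 + 1 = 0" using x by simp
  then show ?thesis
  proof
    assume "x^3 + x + 1 = 0"
    then have "x^3 = 1 + x - 2 * (1 + x)" by (simp add: algebra_simps eq_neg_iff_add_eq_0)
    then show ?thesis using x two by auto
  next
    assume h: "x^3 + x^2 + 1 = 0"
    \<comment> \<open>Replacing \<open>x\<close> by \<open>x - 1\<close> carries roots of the second
      cubic to roots of the first.\<close>
    have "(x - 1)^3 = 1 + (x - 1) + (x^3 + x^2 + 1) + 2 * (x - 2 * x^2 - 1)"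
      by (simp add: algebra_simps eval_nat_numeral)
    then show ?thesis using x h two by (intro exI[of _ "x - 1"]) simp
  qed
qed

text \<open>An element outside the roots of \<open>X^5 - X\<close> is nonzero with
  \<open>x^4 \<noteq> 1\<close>. Modulo 3 the remaining part of \<open>X^8 - 1\<close> splits into
  two quadratics exchanged by \<open>x \<mapsto> - x\<close>.\<close>

lemma generator9:
  assumes "CARD('a::{field,finite}) = 3 ^ 2"
  shows "\<exists>g::'a. g \<noteq> 0 \<and> g ^ 2 = 1 + g"
proof -
  have three: "(3::'a) = 0" using of_int_char[OF assms] by simp
  obtain x :: 'a where "poly [:0, -1, 0, 0, 0, 1:] x \<noteq> 0"
    using exists_nonroot[of "[:0, -1, 0, 0, 0, 1::'a:]"] assms by auto
  then have x: "x \<noteq> 0" "x^4 - 1 \<noteq> 0" by (auto simp: algebra_simps eval_nat_numeral)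
  have "(x^4 - 1) * ((x^2 - x - 1) * (x^2 + x - 1)) = x^8 - 1 - 3 * (x^2 * (x^4 - 1))"
    by (simp add: algebra_simps eval_nat_numeral)
  also have "\<dots> = 0" using power_card_minus_one[OF x(1)] assms three by simp
  finally have "x^2 - x - 1 = 0 \<or> x^2 + x - 1 = 0" using x by simp
  then have "x^2 = 1 + x \<or> (- x)^2 = 1 + (- x)" by (auto simp: algebra_simps)
  then show ?thesis using x by (metis neg_equal_0_iff_equal)
qed

text \<open>The excluded polynomial collects 0 and the elements of order 1, 3 and 5, leaving those
  of order 15. They are roots of two quartics that are reciprocal to each other, so passing to
  \<open>1 / x\<close> reaches the desired one.\<close>

lemma generator16:
  assumes "CARD('a::{field,finite}) = 2 ^ 4"
  shows "\<exists>g::'a. g \<noteq> 0 \<and> g ^ 4 = 1 + g"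
proof -
  have two: "(2::'a) = 0" using of_int_char[OF assms] by simp
  obtain x :: 'a where "poly [:0, -1, -1, -1, 0, 0, 1, 1, 1:] x \<noteq> 0"
    using exists_nonroot[of "[:0, -1, -1, -1, 0, 0, 1, 1, 1::'a:]"] assms by auto
  moreover have "poly [:0, -1, -1, -1, 0, 0, 1, 1, 1:] x = x * ((x^3 - 1) * (x^4 + x^3 + x^2 + x + 1))"
    by (simp add: algebra_simps eval_nat_numeral)
  ultimately have x: "x \<noteq> 0" "(x^3 - 1) * (x^4 + x^3 + x^2 + x + 1) \<noteq> 0" by auto
  have "((x^3 - 1) * (x^4 + x^3 + x^2 + x + 1)) * ((x^4 + x + 1) * (x^4 + x^3 + 1))
      = x^15 - 1 + 2 * ((-1)*x^1 + (-1)*x^2 + (-1)*x^3 + (-2)*x^4 + (-2)*x^5 + (-1)*x^6 + (1)*x^9 + (2)*x^10 + (2)*x^11 + (1)*x^12 + (1)*x^13 + (1)*x^14)"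
    by (simp add: algebra_simps eval_nat_numeral)
  also have "\<dots> = 0" using power_card_minus_one[OF x(1)] assms two by simp
  finally have "x^4 + x + 1 = 0 \<or> x^4 + x^3 + 1 = 0" using x by simp
  then show ?thesis
  proof
    assume "x^4 + x + 1 = 0"
    then have "x^4 = 1 + x - 2 * (1 + x)" by (simp add: algebra_simps eq_neg_iff_add_eq_0)
    then show ?thesis using x two by auto
  next
    assume "x^4 + x^3 + 1 = 0"
    then have "1 = x^4 + x^3 - 2 * (x^4 + x^3)" by (simp add: algebra_simps eq_neg_iff_add_eq_0)
    then have "1 / x^4 = (x^4 + x^3) / x^4" using two by simp
    then have "(1 / x)^4 = 1 + 1 / x" using x by (simp add: power_divide add_divide_distrib eval_nat_numeral)
    then show ?thesis using x by (intro exI[of _ "1 / x"]) simp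
  qed
qed

section \<open>The plane over the field with nine elements\<close>

text \<open>The coefficient is taken at given degree bounds rather than at the degrees, because the
  leading coefficients of the linear factors used later may vanish.\<close>

lemma coeff_mult_top:
  fixes p q :: "'a::comm_semiring_0 poly"
  assumes "degree p \<le> n" "degree q \<le> m"
  shows "coeff (p * q) (n + m) = coeff p n * coeff q m"
proof -
  have "coeff p i * coeff q (n + m - i) = 0" if "i \<noteq> n" "i \<le> n + m" for i
  proof (cases "i < n")
    case True
    then have "degree q < n + m - i" using assms by linarith
    then show ?thesis by (simp add: coeff_eq_0)
  next
    case False
    then have "degree p < i" using that assms by linarith
    then show ?thesis by (simp add: coeff_eq_0)
  qed
  then have "(\<Sum>i\<le>n + m. coeff p i * coeff q (n + m - i)) = (\<Sum>i\<in>{n}. coeff p i * coeff q (n + m - i))"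
    by (intro sum.mono_neutral_right) auto
  then show ?thesis by (simp add: coeff_mult)
qed

lemma degree_coeff_power_top:
  fixes p :: "'a::comm_semiring_1 poly"
  assumes "degree p \<le> 1"
  shows "degree (p ^ j) \<le> j \<and> coeff (p ^ j) j = coeff p 1 ^ j"
proof (induction j)
  case (Suc j)
  have "degree (p * p ^ j) \<le> 1 + j" using degree_mult_le[of p "p ^ j"] assms Suc by linarith
  moreover have "coeff (p * p ^ j) (1 + j) = coeff p 1 * coeff (p ^ j) j"
    using assms Suc by (intro coeff_mult_top) auto
  ultimately show ?case using Suc by simp
qed simp

lemma degree_coeff_prod_top:
  fixes p :: "'b \<Rightarrow> 'a::comm_semiring_1 poly"
  assumes "finite X" "\<And>x. x \<in> X \<Longrightarrow> degree (p x) \<le> 1"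
  shows "degree (\<Prod>x\<in>X. p x) \<le> card X \<and> coeff (\<Prod>x\<in>X. p x) (card X) = (\<Prod>x\<in>X. coeff (p x) 1)"
  using assms
proof (induction X rule: finite_induct)
  case (insert x X)
  then have IH: "degree (\<Prod>x\<in>X. p x) \<le> card X" "coeff (\<Prod>x\<in>X. p x) (card X) = (\<Prod>x\<in>X. coeff (p x) 1)"
    by auto
  have px: "degree (p x) \<le> 1" using insert by auto
  have "degree (p x * (\<Prod>x\<in>X. p x)) \<le> 1 + card X"
    using degree_mult_le[of "p x" "\<Prod>x\<in>X. p x"] IH px by linarith
  moreover have "coeff (p x * (\<Prod>x\<in>X. p x)) (1 + card X) = coeff (p x) 1 * coeff (\<Prod>x\<in>X. p x) (card X)"
    using px IH by (intro coeff_mult_top)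
  ultimately show ?case using insert IH by simp
qed simp

text \<open>For \<open>i > 0\<close> the polynomial \<open>X^(i+1) - X\<close> has too small a
  degree to vanish everywhere, so some \<open>a \<noteq> 0\<close> has
  \<open>a^i \<noteq> 1\<close>; the substitution \<open>s \<mapsto> a * s\<close> multiplies the
  sum by \<open>a^i\<close>. For \<open>i = 0\<close> the sum is \<open>q\<close> times 1.\<close>

lemma sum_powers_zero:
  assumes "i < CARD('a::{field,finite}) - 1"
  shows "(\<Sum>s\<in>(UNIV::'a set). s ^ i) = 0"
proof (cases "i = 0")
  case True
  then show ?thesis using of_nat_CARD[where 'a='a] by simp
next
  case False
  let ?P = "monom 1 (Suc i) - monom 1 1 :: 'a poly"
  have "coeff ?P (Suc i) = 1" using False by simp
  then have "?P \<noteq> 0" by (metis coeff_0 zero_neq_one)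
  moreover have "degree ?P \<le> Suc i" by (intro degree_diff_le) (auto simp: degree_monom_eq)
  then have "degree ?P < CARD('a)" using assms by linarith
  ultimately obtain a where "poly ?P a \<noteq> 0" using exists_nonroot by blast
  then have a: "a \<noteq> 0" "a ^ i - 1 \<noteq> 0" by (auto simp: poly_monom)
  have "bij_betw ((*) a) UNIV UNIV" using a by (intro bij_betwI[where g = "\<lambda>y. y / a"]) auto
  then have "(\<Sum>s\<in>UNIV. (a * s) ^ i) = (\<Sum>s\<in>(UNIV::'a set). s ^ i)"
    by (rule sum.reindex_bij_betw[of _ _ _ "\<lambda>s. s ^ i"])
  moreover have "(\<Sum>s\<in>(UNIV::'a set). (a * s) ^ i) = a ^ i * (\<Sum>s\<in>UNIV. s ^ i)"
    by (simp add: power_mult_distrib sum_distrib_left)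
  ultimately have "(a ^ i - 1) * (\<Sum>s\<in>(UNIV::'a set). s ^ i) = 0"
    by (simp add: left_diff_distrib)
  then show ?thesis using a by simp
qed

text \<open>Only the power \<open>q - 1\<close> survives, and its sum is the number of nonzero
  elements, which is -1 in the field.\<close>

lemma sum_poly:
  fixes P :: "'a::{field,finite} poly"
  assumes "degree P \<le> CARD('a) - 1"
  shows "(\<Sum>s\<in>UNIV. poly P s) = - coeff P (CARD('a) - 1)"
proof -
  let ?m = "CARD('a) - 1"
  have m: "?m \<noteq> 0" using card_field_ge_2[where 'a='a] by simp
  have "poly P s = (\<Sum>i\<le>?m. coeff P i * s ^ i)" for s
    unfolding poly_altdef using assms by (intro sum.mono_neutral_left) (auto simp: coeff_eq_0)
  then have "(\<Sum>s\<in>UNIV. poly P s) = (\<Sum>i\<le>?m. coeff P i * (\<Sum>s\<in>UNIV. s ^ i))"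
    by (simp add: sum_distrib_left) (rule sum.swap)
  also have "\<dots> = (\<Sum>i\<in>{?m}. coeff P i * (\<Sum>s\<in>UNIV. s ^ i))"
    by (intro sum.mono_neutral_right) (auto simp: sum_powers_zero)
  also have "\<dots> = coeff P ?m * (\<Sum>s\<in>UNIV. s ^ ?m)" by simp
  also have "(\<Sum>s\<in>(UNIV::'a set). s ^ ?m) = (\<Sum>s\<in>UNIV - {0::'a}. 1)"
    using m by (intro sum.mono_neutral_cong_right) (auto simp: power_card_minus_one[unfolded One_nat_def] power_0_left)
  also have "(\<Sum>s\<in>UNIV - {0::'a}. 1::'a) = of_nat CARD('a) - 1"
    using card_field_ge_2[where 'a='a] by (simp add: card_Diff_singleton of_nat_diff)
  finally show ?thesis using of_nat_CARD[where 'a='a] by simp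
qed

text \<open>On a coset of a one-dimensional subspace, the product of \<open>q - 1\<close> linear forms sums to minus its leading
  coefficient, and this value is the same for all \<open>q\<close> cosets.\<close>
lemma pencil_sum_zero:
  fixes x v :: "'a::{field,finite}^3" and z :: "'b \<Rightarrow> 'a^3"
  assumes x: "x \<noteq> 0" and X: "finite X" "j + card X = CARD('a) - 1"
  shows "(\<Sum>u | dot x u = 0. dot u v ^ j * (\<Prod>i\<in>X. dot u (z i))) = 0"
proof -
  let ?K = "{u. dot x u = 0}"
  let ?M = "\<lambda>u. dot u v ^ j * (\<Prod>i\<in>X. dot u (z i))"
  have "\<not> ?K \<subseteq> {0}"
  proof
    assume "?K \<subseteq> {0}"
    then have "card ?K \<le> 1" using card_mono[of "{0::'a^3}" ?K] by simp
    moreover have "2^2 \<le> CARD('a)^2" using card_field_ge_2[where 'a='a] by (intro power_mono) auto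
    ultimately show False using card_dot_zero[OF x] by simp
  qed
  then obtain e where "dot x e = 0" "e \<noteq> 0" by auto
  then obtain i where e: "dot x e = 0" "e $ i \<noteq> 0" by (auto simp: vec_eq_iff)
  \<comment> \<open>The kernel of this coordinate functional inside the pencil is a set of
    representatives for the cosets of the span of \<open>e\<close>.\<close>
  define g where "g u = u $ i / e $ i" for u :: "'a^3"
  have g: "g (a + b) = g a + g b" "g (c *s a) = c * g a" "g e = 1" for a b c
    using e by (simp_all add: g_def add_divide_distrib)
  have bij: "bij_betw (\<lambda>(k, c). k + c *s e) ({u \<in> ?K. g u = 0} \<times> UNIV) ?K"
    using e g by (intro bij_kernel subspace_dot) auto
  have "card ?K = card {u \<in> ?K. g u = 0} * CARD('a)"
    using e g by (intro card_kernel[of _ e] subspace_dot) auto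
  then have ck: "card {u \<in> ?K. g u = 0} = CARD('a)"
    using card_dot_zero[OF x] by (simp add: power2_eq_square)
  have inner: "(\<Sum>s\<in>UNIV. ?M (k + s *s e)) = - ?M e" for k
  proof -
    let ?p = "\<lambda>y. [:dot k y, dot e y:]"
    let ?P = "?p v ^ j * (\<Prod>i\<in>X. ?p (z i))"
    have p: "degree (?p y) \<le> 1" "coeff (?p y) 1 = dot e y" for y by simp_all
    note A = degree_coeff_power_top[OF p(1), of v j] and B = degree_coeff_prod_top[OF X(1) p(1), of z]
    have "degree ?P \<le> j + card X" using degree_mult_le[of "?p v ^ j" "\<Prod>i\<in>X. ?p (z i)"] A B by linarith
    moreover have "coeff ?P (j + card X) = ?M e"
      using coeff_mult_top[of "?p v ^ j" j "\<Prod>i\<in>X. ?p (z i)" "card X"] A B by (simp add: p(2))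
    moreover have "poly ?P s = ?M (k + s *s e)" for s
      by (simp add: poly_prod dot_simps)
    ultimately show ?thesis using sum_poly[of ?P] X(2) by simp
  qed
  have "(\<Sum>u\<in>?K. ?M u) = (\<Sum>(k, s)\<in>{u \<in> ?K. g u = 0} \<times> UNIV. ?M (k + s *s e))"
    using sum.reindex_bij_betw[OF bij, of ?M] by (simp add: case_prod_unfold)
  also have "\<dots> = (\<Sum>k\<in>{u \<in> ?K. g u = 0}. \<Sum>s\<in>UNIV. ?M (k + s *s e))"
    by (rule sum.cartesian_product[symmetric])
  also have "\<dots> = of_nat CARD('a) * (- ?M e)"
    unfolding inner sum_constant ck ..
  finally show ?thesis by (simp add: of_nat_CARD)
qed

section \<open>Excluding maximal arcs of degree 3\<close>

lemma card_2_cases: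
  assumes "card {s. P s} = 2" "P a" "P b" "a \<noteq> b" "P u"
  shows "u = a \<or> u = b"
proof -
  have "finite {s. P s}" using assms(1) by (simp add: card_ge_0_finite)
  then have "{a, b} = {s. P s}" using assms by (intro card_subset_eq) auto
  then show ?thesis using assms(5) by auto
qed

lemma char3:
  assumes "CARD('a::{field,finite}) = 9"
  shows "(3::'a) = 0"
  using of_int_char[of 3 2, where 'a='a] assms by simp

text \<open>The map \<open>\<phi> x = x\<^sup>3 - x\<close> is additive, its kernel is the prime field, and its nonzero values are the
  two square roots of \<open>-1\<close>. The six given points fill the rows, columns and diagonals with index in the prime field, so
  \<open>\<phi> u\<close>, \<open>\<phi> v\<close> and \<open>\<phi> (u - v)\<close> are nonzero for every other point \<open>(u, v)\<close>, whence \<open>\<phi> (u + v) = 0\<close>: all \<open>18\<close> points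
  are on three lines.\<close>
lemma no_affine_cubic_arc:
  fixes A :: "'a::{field,finite} \<Rightarrow> 'a \<Rightarrow> bool"
  assumes q: "CARD('a) = 9"
    and row: "\<And>t. card {s. A s t} = 2" and col: "\<And>s. card {t. A s t} = 2"
    and diag: "\<And>k. card {t. A (t + k) t} = 2" and anti: "\<And>k. card {t. A (k - t) t} \<le> 3"
    and pts: "A 0 0" "A 1 0" "A 0 1" "A (-1) (-1)" "A 1 (-1)" "A (-1) 1"
  shows False
proof -
  have three: "(3::'a) = 0" by (rule char3[OF q])
  have two: "(2::'a) = -1" using three by (simp add: eq_neg_iff_add_eq_0)
  have ne: "(1::'a) \<noteq> -1" "(0::'a) \<noteq> 1" "(0::'a) \<noteq> -1"
  proof -
    show "(1::'a) \<noteq> -1"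
    proof
      assume "(1::'a) = -1"
      then have "(1::'a) = 2 - 2 * 1 + 1 \<and> (2::'a) = 0" by (simp add: eq_neg_iff_add_eq_0)
      then show False using two by simp
    qed
  qed auto
  define \<phi> where "\<phi> x = x^3 - x" for x :: 'a
  have cube_add: "(x + y)^3 = x^3 + y^3" for x y :: 'a
  proof -
    have "(x + y)^3 = x^3 + y^3 + 3 * (x^2 * y + x * y^2)" by (simp add: eval_nat_numeral algebra_simps)
    then show ?thesis using three by simp
  qed
  have \<phi>_add: "\<phi> (x + y) = \<phi> x + \<phi> y" for x y by (simp add: \<phi>_def cube_add)
  have \<phi>_neg: "\<phi> (- x) = - \<phi> x" for x by (simp add: \<phi>_def)
  have \<phi>_diff: "\<phi> (x - y) = \<phi> x - \<phi> y" for x y using \<phi>_add[of x "- y"] \<phi>_neg[of y] by simp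
  have \<phi>0: "\<phi> x = 0 \<longleftrightarrow> x = 0 \<or> x = 1 \<or> x = -1" for x
  proof -
    have "\<phi> x = x * ((x - 1) * (x + 1))" by (simp add: \<phi>_def eval_nat_numeral algebra_simps)
    then show ?thesis by (auto simp: eq_neg_iff_add_eq_0)
  qed
  have \<phi>_sq: "(\<phi> x)^2 = -1" if "\<phi> x \<noteq> 0" for x
  proof -
    have "x \<noteq> 0" using that by (auto simp: \<phi>0)
    then have "x^9 = x" using power_card_minus_one[of x] q by (simp add: eval_nat_numeral)
    have "(\<phi> x)^3 = (x^3)^3 + (- x)^3" unfolding \<phi>_def using cube_add[of "x^3" "- x"] by simp
    also have "\<dots> = x^9 - x^3" by (simp add: power_mult[symmetric])
    also have "\<dots> = - \<phi> x" using \<open>x^9 = x\<close> by (simp add: \<phi>_def)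
    finally have "\<phi> x * ((\<phi> x)^2 + 1) = 0" by (simp add: eval_nat_numeral algebra_simps)
    then show ?thesis using that by (simp add: eq_neg_iff_add_eq_0)
  qed
  have key: "\<phi> (u + v) = 0" if A: "A u v" for u v
  proof -
    have row_F: "\<phi> u = 0" if h: "\<phi> v = 0"
    proof -
      consider "v = 0" | "v = 1" | "v = -1" using h[unfolded \<phi>0] by blast
      then show ?thesis
      proof cases
        case 1
        then have "u = 0 \<or> u = 1" using card_2_cases[OF row[of 0] pts(1,2)] ne A by auto
        then show ?thesis by (auto simp: \<phi>0)
      next
        case 2
        then have "u = 0 \<or> u = -1" using card_2_cases[OF row[of 1] pts(3,6)] ne A by auto
        then show ?thesis by (auto simp: \<phi>0)
      next
        case 3
        then have "u = -1 \<or> u = 1" using card_2_cases[OF row[of "-1"] pts(4,5)] ne A by auto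
        then show ?thesis by (auto simp: \<phi>0)
      qed
    qed
    have col_F: "\<phi> v = 0" if h: "\<phi> u = 0"
    proof -
      consider "u = 0" | "u = 1" | "u = -1" using h[unfolded \<phi>0] by blast
      then show ?thesis
      proof cases
        case 1
        then have "v = 0 \<or> v = 1" using card_2_cases[OF col[of 0] pts(1,3)] ne A by auto
        then show ?thesis by (auto simp: \<phi>0)
      next
        case 2
        then have "v = 0 \<or> v = -1" using card_2_cases[OF col[of 1] pts(2,5)] ne A by auto
        then show ?thesis by (auto simp: \<phi>0)
      next
        case 3
        then have "v = -1 \<or> v = 1" using card_2_cases[OF col[of "-1"] pts(4,6)] ne A by auto
        then show ?thesis by (auto simp: \<phi>0)
      qed
    qed
    have diag_F: "\<phi> v = 0" if h: "\<phi> (u - v) = 0"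
    proof -
      have Ak: "A (v + (u - v)) v" using A by simp
      have m2: "-1 + -1 = (1::'a)" "1 + 1 = (-1::'a)" using two by (simp_all add: eq_neg_iff_add_eq_0)
      consider "u - v = 0" | "u - v = 1" | "u - v = -1" using h[unfolded \<phi>0] by blast
      then show ?thesis
      proof cases
        case 1
        have "A (0 + 0) 0" "A (-1 + 0) (-1)" "A (v + 0) v" using Ak[unfolded 1] pts by simp_all
        then have "v = 0 \<or> v = -1" using card_2_cases[OF diag[of 0] _ _ ne(3)] by blast
        then show ?thesis by (auto simp: \<phi>0)
      next
        case 2
        have "A (0 + 1) 0" "A (1 + 1) 1" "A (v + 1) v"
          using Ak[unfolded 2] pts(2,6) by (simp_all only: m2 add_0)
        then have "v = 0 \<or> v = 1" using card_2_cases[OF diag[of 1] _ _ ne(2)] by blast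
        then show ?thesis by (auto simp: \<phi>0)
      next
        case 3
        have "A (1 + -1) 1" "A (-1 + -1) (-1)" "A (v + -1) v"
          using Ak[unfolded 3] pts(3,5) by (simp_all only: m2 add.right_inverse)
        then have "v = 1 \<or> v = -1" using card_2_cases[OF diag[of "-1"] _ _ ne(1)] by blast
        then show ?thesis by (auto simp: \<phi>0)
      qed
    qed
    show ?thesis
    proof (cases "\<phi> v = 0")
      case True
      then show ?thesis using row_F \<phi>_add by simp
    next
      case False
      \<comment> \<open>Both values are square roots of -1, of which there are two, opposite to each
        other; being different they add up to 0.\<close>
      then have "\<phi> u \<noteq> 0" "\<phi> u \<noteq> \<phi> v" using col_F diag_F \<phi>_diff by auto
      then have "(\<phi> u)^2 = (\<phi> v)^2" using \<phi>_sq False by simp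
      then have "\<phi> u = - \<phi> v" using \<open>\<phi> u \<noteq> \<phi> v\<close> by (simp add: power2_eq_iff)
      then show ?thesis using \<phi>_add by simp
    qed
  qed
  \<comment> \<open>Counted by rows there are 18 points, but the three antidiagonals carry at most 3
    each.\<close>
  let ?G = "SIGMA t:(UNIV::'a set). {s. A s t}"
  have "card ?G = (\<Sum>t\<in>(UNIV::'a set). card {s. A s t})" by (rule card_SigmaI) auto
  then have "card ?G = 18" using row q by simp
  have "?G \<subseteq> (\<Union>k\<in>{0, 1, -1}. (\<lambda>t. (t, k - t)) ` {t. A (k - t) t})"
  proof
    fix w assume "w \<in> ?G"
    then obtain u v where w: "w = (v, u)" "A u v" by auto
    then have "u + v \<in> {0, 1, -1}" using key[OF w(2)] by (simp add: \<phi>0)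
    moreover have "w \<in> (\<lambda>t. (t, (u + v) - t)) ` {t. A ((u + v) - t) t}" using w by (auto simp: image_iff)
    ultimately show "w \<in> (\<Union>k\<in>{0, 1, -1}. (\<lambda>t. (t, k - t)) ` {t. A (k - t) t})" by (rule UN_I)
  qed
  then have "card ?G \<le> card (\<Union>k\<in>{0, 1, -1}. (\<lambda>t. (t, k - t)) ` {t. A (k - t) t})" by (rule card_mono[rotated]) simp
  also have "\<dots> \<le> (\<Sum>k\<in>{0, 1, -1}. card ((\<lambda>t. (t, k - t)) ` {t. A (k - t) t}))" by (rule card_UN_le) simp
  also have "\<dots> \<le> (\<Sum>k\<in>{0, 1, -1::'a}. 3)"
    by (intro sum_mono order.trans[OF card_image_le anti]) simp
  also have "\<dots> \<le> 9" using ne by simp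
  finally show False using \<open>card ?G = 18\<close> by simp
qed

definition indep2 :: "'a::field^3 \<Rightarrow> 'a^3 \<Rightarrow> bool" where
  "indep2 x y \<longleftrightarrow> (\<forall>a b. a *s x + b *s y = 0 \<longrightarrow> a = 0 \<and> b = 0)"

definition indep3 :: "'a::field^3 \<Rightarrow> 'a^3 \<Rightarrow> 'a^3 \<Rightarrow> bool" where
  "indep3 x y z \<longleftrightarrow> (\<forall>a b c. a *s x + b *s y + c *s z = 0 \<longrightarrow> a = 0 \<and> b = 0 \<and> c = 0)"

lemma line_through:
  fixes x y :: "'a::{field,finite}^3"
  assumes xy: "indep2 x y"
  obtains u where "u \<noteq> 0"
    "{P \<in> PG_points. P \<subseteq> line u} = insert (point y) ((\<lambda>c. point (x + c *s y)) ` UNIV)"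
    "inj (\<lambda>c. point (x + c *s y))" "point y \<notin> range (\<lambda>c. point (x + c *s y))"
    "y \<noteq> 0" "\<And>c. x + c *s y \<noteq> 0"
proof -
  interpret proj_plane "PG_points :: ('a^3) set set" PG_lines "(\<subseteq>)" "CARD('a)" by (rule PG_proj_plane)
  have ind: "a *s x + b *s y = 0 \<Longrightarrow> a = 0 \<and> b = 0" for a b using xy by (simp add: indep2_def)
  have y: "y \<noteq> 0" using ind[of 0 1] by auto
  have xc: "x + c *s y \<noteq> 0" for c using ind[of 1 c] by auto
  have inj: "inj (\<lambda>c. point (x + c *s y))"
  proof (rule injI)
    fix c d assume "point (x + c *s y) = point (x + d *s y)"
    then obtain k where "x + d *s y = k *s (x + c *s y)" using point_eq_iff[OF xc] by blast
    then have "(1 - k) *s x + (d - k * c) *s y = 0" by (simp add: vec_eq_iff algebra_simps)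
    then have "1 - k = 0 \<and> d - k * c = 0" by (rule ind)
    then show "c = d" by auto
  qed
  have y_out: "point y \<notin> range (\<lambda>c. point (x + c *s y))"
  proof
    assume "point y \<in> range (\<lambda>c. point (x + c *s y))"
    then obtain c k where "x + c *s y = k *s y" using point_eq_iff[OF y] by blast
    then have "1 *s x + (c - k) *s y = 0" by (simp add: vec_eq_iff algebra_simps)
    then show False using ind by fastforce
  qed
  have P: "point y \<in> PG_points" "\<And>c. point (x + c *s y) \<in> PG_points" using y xc by (auto simp: PG_points_eq)
  have "point x = point (x + 0 *s y)" by simp
  then have "point x \<in> range (\<lambda>c. point (x + c *s y))" by (rule range_eqI)
  then have "point x \<in> PG_points" "point x \<noteq> point y" using P y_out by auto
  then have "card {L \<in> PG_lines. point y \<subseteq> L \<and> point x \<subseteq> L} = 1" using P by (intro join) auto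
  then obtain L where "{L \<in> PG_lines. point y \<subseteq> L \<and> point x \<subseteq> L} = {L}" by (rule card_1_singletonE)
  then have L: "L \<in> PG_lines" "point y \<subseteq> L" "point x \<subseteq> L" by blast+
  then obtain u where "u \<noteq> 0" "L = line u" by (auto simp: PG_lines_eq)
  then have u: "u \<noteq> 0" "L = line u" "dot u y = 0" "dot u x = 0" using L point_subset_line by blast+
  have sub: "insert (point y) (range (\<lambda>c. point (x + c *s y))) \<subseteq> {P \<in> PG_points. P \<subseteq> line u}"
    by (intro insert_subset[THEN iffD2] conjI image_subsetI) (simp_all add: P u point_subset_line dot_simps)
  have "card {P \<in> PG_points. P \<subseteq> line u} = CARD('a) + 1"
    using u by (intro card_line) (auto simp: PG_lines_eq)
  moreover have "card (insert (point y) (range (\<lambda>c. point (x + c *s y)))) = CARD('a) + 1"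
    using y_out inj by (simp add: card_image)
  ultimately have "insert (point y) (range (\<lambda>c. point (x + c *s y))) = {P \<in> PG_points. P \<subseteq> line u}"
    using sub by (intro card_subset_eq) auto
  then show thesis using that u inj y_out y xc by simp
qed

lemma prod_by_value:
  fixes f :: "'b \<Rightarrow> 'a::comm_monoid_mult"
  assumes "finite E" "finite K" "\<And>e. e \<in> E \<Longrightarrow> f e \<in> K"
  shows "(\<Prod>e\<in>E. f e) = (\<Prod>k\<in>K. k ^ card {e \<in> E. f e = k})"
proof -
  have "(\<Prod>e\<in>E. f e) = (\<Prod>k\<in>K. \<Prod>e | e \<in> E \<and> f e = k. f e)"
    using assms by (intro prod.group[symmetric]) auto
  also have "\<dots> = (\<Prod>k\<in>K. k ^ card {e \<in> E. f e = k})" by (intro prod.cong) auto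
  finally show ?thesis .
qed

text \<open>Inversion permutes the nonzero elements. The square is all that the product arguments
  use, so the sign of the product is left undetermined.\<close>

lemma prod_nonzero_squared: "(\<Prod>x\<in>UNIV - {0::'a::{field,finite}}. x) ^ 2 = 1"
proof -
  have "(\<Prod>x\<in>UNIV - {0::'a}. inverse x) = (\<Prod>x\<in>UNIV - {0::'a}. x)"
    by (rule prod.reindex_bij_witness[of _ inverse inverse]) auto
  then have "(\<Prod>x\<in>UNIV - {0::'a}. x) ^ 2 = (\<Prod>x\<in>UNIV - {0::'a}. x * inverse x)"
    by (simp only: prod.distrib power2_eq_square)
  also have "\<dots> = 1" by (intro prod.neutral) auto
  finally show ?thesis .
qed

text \<open>This is a maximal arc of degree 3, since 21 = 2 * 9 + 3.\<close>

locale cubic_arc =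
  fixes S :: "('a::{field,finite}^3) set set"
  assumes q: "CARD('a) = 9" and S: "S \<subseteq> PG_points" "card S = 21"
    and lines: "\<And>L. L \<in> PG_lines \<Longrightarrow> pts_on (\<subseteq>) S L \<in> {0, 3}"
begin

definition K :: "'a^3 \<Rightarrow> bool" where "K x \<longleftrightarrow> x \<noteq> 0 \<and> point x \<in> S"

lemma K_scale: "c \<noteq> 0 \<Longrightarrow> K (c *s x) \<longleftrightarrow> K x"
proof (cases "x = 0")
  case False
  assume "c \<noteq> 0"
  then have "point x = point (c *s x)" using point_eq_iff[OF False] by blast
  then show ?thesis using False \<open>c \<noteq> 0\<close> by (simp add: K_def)
qed (simp add: K_def)

lemma line_count:
  assumes "indep2 x y"
  shows "card {c. K (x + c *s y)} + (if K y then 1 else 0) \<in> {0, 3}"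
proof -
  from line_through[OF assms] obtain u where u: "u \<noteq> 0"
    "{P \<in> PG_points. P \<subseteq> line u} = insert (point y) ((\<lambda>c. point (x + c *s y)) ` UNIV)"
    and inj: "inj (\<lambda>c. point (x + c *s y))" and out: "point y \<notin> range (\<lambda>c. point (x + c *s y))"
    and ne: "y \<noteq> 0" "\<And>c. x + c *s y \<noteq> 0" by blast
  have "{P \<in> S. P \<subseteq> line u} = {P \<in> {P \<in> PG_points. P \<subseteq> line u}. P \<in> S}" using S by blast
  also have "\<dots> = (\<lambda>c. point (x + c *s y)) ` {c. K (x + c *s y)} \<union> {P. P = point y \<and> K y}"
    unfolding u(2) using ne by (auto simp: K_def)
  finally have eq: "{P \<in> S. P \<subseteq> line u} =
    (\<lambda>c. point (x + c *s y)) ` {c. K (x + c *s y)} \<union> {P. P = point y \<and> K y}" .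
  have "(\<lambda>c. point (x + c *s y)) ` {c. K (x + c *s y)} \<inter> {P. P = point y \<and> K y} = {}"
    using out by auto
  then have "card {P \<in> S. P \<subseteq> line u} = card ((\<lambda>c. point (x + c *s y)) ` {c. K (x + c *s y)})
      + card {P. P = point y \<and> K y}"
    unfolding eq by (intro card_Un_disjoint) auto
  also have "card ((\<lambda>c. point (x + c *s y)) ` {c. K (x + c *s y)}) = card {c. K (x + c *s y)}"
    using inj by (intro card_image inj_on_subset[OF inj]) auto
  also have "card {P. P = point y \<and> K y} = (if K y then 1 else 0)" by (auto simp: card_1_singleton_iff)
  finally show ?thesis using lines[of "line u"] u(1) by (simp add: pts_on_def PG_lines_eq)
qed

lemma line_count_in:
  assumes "indep2 x y" "K y"
  shows "card {c. K (x + c *s y)} = 2"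
  using line_count[OF assms(1)] assms(2) by auto

lemma third_unique:
  assumes "indep2 x y" "K x" "K y" "K (x + c *s y)" "K (x + d *s y)" "c \<noteq> 0" "d \<noteq> 0"
  shows "c = d"
  using card_2_cases[OF line_count_in[OF assms(1,3)], of 0 c d] assms by auto

lemma third_exists:
  assumes "indep2 x y" "K x" "K y"
  obtains c where "c \<noteq> 0" "K (x + c *s y)"
proof -
  have "card {c. K (x + c *s y)} = 2" by (rule line_count_in[OF assms(1,3)])
  then obtain a b where "{c. K (x + c *s y)} = {a, b}" "a \<noteq> b" by (auto simp: card_2_iff)
  then have "K (x + a *s y)" "K (x + b *s y)" "a \<noteq> 0 \<or> b \<noteq> 0" by auto
  then show thesis using that by blast
qed

text \<open>A Ceva-type product argument: with homogeneous coordinates \<open>(1 : y : z)\<close> relative to the basis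
  \<open>a, b, c\<close>, the products of \<open>y\<close>, of \<open>z\<close> and of \<open>z / y\<close> over all points of the arc off the
  coordinate axes are read off from the lines through \<open>c\<close>, \<open>b\<close> and \<open>a\<close>, respectively.\<close>
lemma triangle_closure:
  assumes ind: "indep3 a b c" and on_arc: "K a" "K b" "K c" "K (a + b)" "K (b + c)"
  shows "K (a + c)"
proof -
  let ?F = "UNIV - {0::'a}"
  define w where "w = (\<Prod>x\<in>?F. x)"
  have w2: "w^2 = 1" unfolding w_def by (rule prod_nonzero_squared)
  have i3: "r *s a + s *s b + t *s c = 0 \<Longrightarrow> r = 0 \<and> s = 0 \<and> t = 0" for r s t
    using ind by (simp add: indep3_def)
  have ind_ab: "indep2 a b" unfolding indep2_def using i3[of _ _ 0] by auto
  have ind_bc: "indep2 b c" unfolding indep2_def using i3[of 0] by auto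
  have ind_ac: "indep2 a c" unfolding indep2_def using i3[of _ 0] by auto
  have ind_c: "indep2 (a + k *s b) c" for k
    unfolding indep2_def
  proof (intro allI impI)
    fix r t assume "r *s (a + k *s b) + t *s c = 0"
    then have "r *s a + (r * k) *s b + t *s c = 0" by (simp add: vec_eq_iff algebra_simps)
    from i3[OF this] show "r = 0 \<and> t = 0" by simp
  qed
  have ind_b: "indep2 (a + k *s c) b" for k
    unfolding indep2_def
  proof (intro allI impI)
    fix r t assume "r *s (a + k *s c) + t *s b = 0"
    then have "r *s a + t *s b + (r * k) *s c = 0" by (simp add: vec_eq_iff algebra_simps)
    from i3[OF this] show "r = 0 \<and> t = 0" by simp
  qed
  have ind_a: "indep2 (b + k *s c) a" for k
    unfolding indep2_def
  proof (intro allI impI)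
    fix r t assume "r *s (b + k *s c) + t *s a = 0"
    then have "t *s a + r *s b + (r * k) *s c = 0" by (simp add: vec_eq_iff algebra_simps)
    from i3[OF this] show "r = 0 \<and> t = 0" by simp
  qed
  obtain z0 where z0: "z0 \<noteq> 0" "K (a + z0 *s c)" using third_exists[OF ind_ac on_arc(1,3)] .
  \<comment> \<open>The arc points off the three sides of the triangle \<open>a, b, c\<close>, in
    coordinates with first entry 1.\<close>
  define E where "E = {(y, z). y \<noteq> 0 \<and> z \<noteq> 0 \<and> K (a + y *s b + z *s c)}"
  have finE: "finite E" by simp
  \<comment> \<open>A line through a vertex on the arc has two further arc points; the parameter 0
    is its intersection with the opposite side.\<close>
  have minus_zero: "card {z. z \<noteq> 0 \<and> P z} = (if P 0 then 1 else 2)" if "card {z. P z} = 2" for P :: "'a \<Rightarrow> bool"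
  proof -
    have "{z. z \<noteq> 0 \<and> P z} = {z. P z} - {0}" by auto
    then show ?thesis using that by (simp add: card_Diff_singleton_if)
  qed
  \<comment> \<open>Every nonzero value is attained twice, except that \<open>j\<close> is attained
    once: it belongs to the line through the third arc point of the side.\<close>
  have weights: "(\<Prod>k\<in>?F. k ^ (if k = j then 1 else 2)) = w^2 / j" if j: "j \<noteq> 0" for j
  proof -
    have "(\<Prod>k\<in>?F. k ^ (if k = j then 1 else 2)) * j
        = (\<Prod>k\<in>?F. k ^ (if k = j then 1 else 2)) * (\<Prod>k\<in>?F. if k = j then k else 1)"
      using j by (simp add: prod.delta)
    also have "\<dots> = (\<Prod>k\<in>?F. k^2)"
      unfolding prod.distrib[symmetric] by (intro prod.cong) (auto simp: power2_eq_square)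
    also have "\<dots> = w^2" by (simp add: w_def prod_power_distrib)
    finally show ?thesis using j by (simp add: field_simps)
  qed
  have prod_y: "(\<Prod>e\<in>E. fst e) = w^2"
  proof -
    have "card {e \<in> E. fst e = k} = (if k = 1 then 1 else 2)" if k: "k \<in> ?F" for k
    proof -
      have "{e \<in> E. fst e = k} = Pair k ` {z. z \<noteq> 0 \<and> K (a + k *s b + z *s c)}"
        using k by (auto simp: E_def)
      then have "card {e \<in> E. fst e = k} = card {z. z \<noteq> 0 \<and> K (a + k *s b + z *s c)}"
        by (simp add: card_image inj_on_def)
      also have "\<dots> = (if K (a + k *s b + 0 *s c) then 1 else 2)"
        by (rule minus_zero[OF line_count_in[OF ind_c on_arc(3)]])
      also have "K (a + k *s b + 0 *s c) \<longleftrightarrow> k = 1"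
        using third_unique[OF ind_ab on_arc(1,2), of k 1] on_arc(4) k by auto
      finally show ?thesis .
    qed
    then have "(\<Prod>e\<in>E. fst e) = (\<Prod>k\<in>?F. k ^ (if k = 1 then 1 else 2))"
      by (subst prod_by_value[OF finE, of ?F]) (auto simp: E_def)
    then show ?thesis using weights[of 1] by simp
  qed
  have prod_z: "(\<Prod>e\<in>E. snd e) = w^2 / z0"
  proof -
    have "card {e \<in> E. snd e = k} = (if k = z0 then 1 else 2)" if k: "k \<in> ?F" for k
    proof -
      have "{e \<in> E. snd e = k} = (\<lambda>y. (y, k)) ` {y. y \<noteq> 0 \<and> K (a + k *s c + y *s b)}"
        using k by (auto simp: E_def add_ac)
      then have "card {e \<in> E. snd e = k} = card {y. y \<noteq> 0 \<and> K (a + k *s c + y *s b)}"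
        by (simp add: card_image inj_on_def)
      also have "\<dots> = (if K (a + k *s c + 0 *s b) then 1 else 2)"
        by (rule minus_zero[OF line_count_in[OF ind_b on_arc(2)]])
      also have "K (a + k *s c + 0 *s b) \<longleftrightarrow> k = z0"
        using third_unique[OF ind_ac on_arc(1,3), of k z0] z0 k by auto
      finally show ?thesis .
    qed
    then have "(\<Prod>e\<in>E. snd e) = (\<Prod>k\<in>?F. k ^ (if k = z0 then 1 else 2))"
      by (subst prod_by_value[OF finE, of ?F]) (auto simp: E_def)
    then show ?thesis using weights[OF z0(1)] by simp
  qed
  have prod_q: "(\<Prod>e\<in>E. snd e / fst e) = w^2"
  proof -
    have "card {e \<in> E. snd e / fst e = k} = (if k = 1 then 1 else 2)" if k: "k \<in> ?F" for k
    proof -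
      \<comment> \<open>The line through \<open>a\<close> is parametrised from its point on the
        opposite side; dividing by \<open>s\<close> returns to coordinates with first entry
        1.\<close>
      have "bij_betw (\<lambda>s. (1 / s, k / s)) {s. s \<noteq> 0 \<and> K (b + k *s c + s *s a)} {e \<in> E. snd e / fst e = k}"
      proof (rule bij_betwI[where g = "\<lambda>e. 1 / fst e"])
        have sc: "K (a + (1/s) *s b + (k/s) *s c) \<longleftrightarrow> K (b + k *s c + s *s a)" if "s \<noteq> 0" for s
        proof -
          have "s *s (a + (1/s) *s b + (k/s) *s c) = b + k *s c + s *s a"
            using that by (simp add: vec_eq_iff algebra_simps)
          then show ?thesis using K_scale[OF that] by metis
        qed
        show "(\<lambda>s. (1 / s, k / s)) \<in> {s. s \<noteq> 0 \<and> K (b + k *s c + s *s a)} \<rightarrow> {e \<in> E. snd e / fst e = k}"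
          using k sc by (auto simp: E_def)
        show "(\<lambda>e. 1 / fst e) \<in> {e \<in> E. snd e / fst e = k} \<rightarrow> {s. s \<noteq> 0 \<and> K (b + k *s c + s *s a)}"
        proof
          fix e assume e: "e \<in> {e \<in> E. snd e / fst e = k}"
          obtain y z where yz: "e = (y, z)" by (cases e)
          then have h: "y \<noteq> 0" "z = k * y" "K (a + y *s b + (k * y) *s c)" using e by (auto simp: E_def)
          then show "1 / fst e \<in> {s. s \<noteq> 0 \<and> K (b + k *s c + s *s a)}"
            using sc[of "1 / y"] by (simp add: yz)
        qed
      qed (auto simp: E_def)
      then have "card {e \<in> E. snd e / fst e = k} = card {s. s \<noteq> 0 \<and> K (b + k *s c + s *s a)}"
        by (rule bij_betw_same_card[symmetric])
      also have "\<dots> = (if K (b + k *s c + 0 *s a) then 1 else 2)"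
        by (rule minus_zero[OF line_count_in[OF ind_a on_arc(1)]])
      also have "K (b + k *s c + 0 *s a) \<longleftrightarrow> k = 1"
        using third_unique[OF ind_bc on_arc(2,3), of k 1] on_arc(5) k by auto
      finally show ?thesis .
    qed
    then have "(\<Prod>e\<in>E. snd e / fst e) = (\<Prod>k\<in>?F. k ^ (if k = 1 then 1 else 2))"
      by (subst prod_by_value[OF finE, of ?F]) (auto simp: E_def)
    then show ?thesis using weights[of 1] by simp
  qed
  \<comment> \<open>The three products satisfy \<open>w^2 / z0 = w^2 * w^2\<close>, and
    \<open>w^2 = 1\<close> leaves \<open>z0 = 1\<close>.\<close>
  have "(\<Prod>e\<in>E. snd e) = (\<Prod>e\<in>E. fst e) * (\<Prod>e\<in>E. snd e / fst e)"
    unfolding prod.distrib[symmetric] by (intro prod.cong) (auto simp: E_def)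
  then have "z0 = 1" using prod_y prod_z prod_q w2 z0 by simp
  then show ?thesis using z0 by simp
qed

end

lemma indep3_imp_indep2:
  assumes ind: "indep3 a b c" and lm: "l \<noteq> 0 \<or> m \<noteq> 0"
  shows "indep2 (a + k *s b + n *s c) (l *s b + m *s c)"
  unfolding indep2_def
proof (intro allI impI)
  fix r t assume "r *s (a + k *s b + n *s c) + t *s (l *s b + m *s c) = 0"
  then have "r *s a + (r * k + t * l) *s b + (r * n + t * m) *s c = 0"
    by (simp add: vec_eq_iff algebra_simps)
  then have "r = 0 \<and> r * k + t * l = 0 \<and> r * n + t * m = 0" using ind by (simp add: indep3_def)
  then show "r = 0 \<and> t = 0" using lm by auto
qed

context cubic_arc begin

text \<open>Three noncollinear arc points can be scaled so that \<open>a + b\<close> and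
  \<open>b + c\<close> are on the arc. Repeated use of \<open>triangle_closure\<close> then produces
  the six affine points with coordinates in the prime field demanded by
  \<open>no_affine_cubic_arc\<close>.\<close>

lemma no_cubic_arc: False
proof -
  interpret proj_plane "PG_points :: ('a^3) set set" PG_lines "(\<subseteq>)" "CARD('a)" by (rule PG_proj_plane)
  have three: "(3::'a) = 0" by (rule char3[OF q])
  have "\<not> S \<subseteq> {P}" for P using S(2) card_mono[of "{P}" S] by auto
  then obtain P R where PR: "P \<in> S" "R \<in> S" "P \<noteq> R" using S(2) by (metis card.empty insert_iff subsetI zero_neq_numeral ex_in_conv)
  have rep: "\<exists>x. x \<noteq> 0 \<and> Q = point x" if "Q \<in> S" for Q
    using S(1) that unfolding PG_points_eq by blast
  obtain p r0 where p: "p \<noteq> 0" "P = point p" and r0: "r0 \<noteq> 0" "R = point r0"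
    using rep[OF PR(1)] rep[OF PR(2)] by blast
  have K0: "K p" "K r0" using p r0 PR by (auto simp: K_def)
  have ind: "indep2 p r0"
    unfolding indep2_def
  proof (intro allI impI)
    fix a b assume h: "a *s p + b *s r0 = 0"
    show "a = 0 \<and> b = 0"
    proof (cases "b = 0")
      case True
      then show ?thesis using h p by simp
    next
      case False
      have "r0 = (- a / b) *s p"
      proof -
        have "b *s r0 = (- a) *s p" using h by (simp add: eq_neg_iff_add_eq_0 add.commute)
        then have "(1 / b) *s (b *s r0) = (1 / b) *s ((- a) *s p)" by simp
        then show ?thesis using False by simp
      qed
      moreover from this have "- a / b \<noteq> 0" using r0 by auto
      ultimately have "point p = point r0" using point_eq_iff[OF p(1)] by blast
      then show ?thesis using PR p r0 by simp
    qed
  qed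
  obtain c0 where c0: "c0 \<noteq> 0" "K (p + c0 *s r0)" using third_exists[OF ind K0] .
  have "P \<in> PG_points" "R \<in> PG_points" using PR S by auto
  then have "card {L \<in> PG_lines. P \<subseteq> L \<and> R \<subseteq> L} = 1" using PR by (intro join)
  then obtain L where "{L \<in> PG_lines. P \<subseteq> L \<and> R \<subseteq> L} = {L}" by (rule card_1_singletonE)
  then have L: "L \<in> PG_lines" "P \<subseteq> L" "R \<subseteq> L" by blast+
  then obtain u where "u \<noteq> 0" "L = line u" by (auto simp: PG_lines_eq)
  then have u: "L = line u" "dot u p = 0" "dot u r0 = 0" using L point_subset_line p r0 by blast+
  have "pts_on (\<subseteq>) S L \<le> 3" using lines[OF L(1)] by auto
  then have "card {P \<in> S. P \<subseteq> L} \<le> 3" by (simp only: pts_on_def)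
  then have "{P \<in> S. P \<subseteq> L} \<noteq> S" using S(2) by auto
  then obtain Q where Q: "Q \<in> S" "\<not> Q \<subseteq> L" by blast
  obtain a where "a \<noteq> 0" "Q = point a" using rep[OF Q(1)] by blast
  then have a: "K a" "dot u a \<noteq> 0" using Q u point_subset_line by (auto simp: K_def)
  have i3: "x = 0 \<and> y = 0 \<and> z = 0" if h: "x *s a + y *s p + z *s r0 = 0" for x y z
  proof -
    have "dot u (x *s a + y *s p + z *s r0) = 0" using h by (simp add: dot_simps)
    then have "x = 0" using u a by (simp add: dot_simps)
    then show ?thesis using h ind by (simp add: indep2_def)
  qed
  have "indep2 a p" unfolding indep2_def using i3[of _ _ 0] by auto
  then obtain c1 where c1: "c1 \<noteq> 0" "K (a + c1 *s p)" using third_exists a K0 by blast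
  \<comment> \<open>The scalars make the third arc points of two sides equal to \<open>a + b\<close>
    and a multiple of \<open>b + c\<close>; then no freedom is left for the third side.\<close>
  define b c where "b = c1 *s p" and "c = (c1 * c0) *s r0"
  have ind3: "indep3 a b c"
    unfolding indep3_def
  proof (intro allI impI)
    fix x y z assume "x *s a + y *s b + z *s c = 0"
    then have "x *s a + (y * c1) *s p + (z * (c1 * c0)) *s r0 = 0" by (simp add: b_def c_def)
    from i3[OF this] show "x = 0 \<and> y = 0 \<and> z = 0" using c0 c1 by simp
  qed
  have "b + c = c1 *s (p + c0 *s r0)" by (simp add: b_def c_def vec_eq_iff algebra_simps)
  then have on_arc: "K b" "K c" "K (b + c)" "K (a + b)"
    using c0 c1 K0 K_scale by (auto simp: b_def c_def)
  have K_neg: "K (- x) \<longleftrightarrow> K x" for x using K_scale[of "-1" x] by simp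
  have ind': "x = 0 \<and> y = 0 \<and> z = 0" if "x *s a + y *s b + z *s c = 0" for x y z
    using ind3 that by (simp add: indep3_def)
  have 1: "K (a + c)" using triangle_closure[OF ind3 a(1) on_arc(1,2,4,3)] .
  have 2: "K (a + (- (b + c)))"
  proof (rule triangle_closure)
    show "indep3 a b (- (b + c))"
      unfolding indep3_def
    proof (intro allI impI)
      fix x y z assume "x *s a + y *s b + z *s (- (b + c)) = 0"
      then have "x *s a + (y - z) *s b + (- z) *s c = 0" by (simp add: vec_eq_iff algebra_simps)
      from ind'[OF this] show "x = 0 \<and> y = 0 \<and> z = 0" by auto
    qed
    show "K a" "K b" "K (- (b + c))" "K (a + b)" by (simp_all only: a on_arc K_neg)
    show "K (b + - (b + c))" using K_neg[of c] on_arc(2) by simp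
  qed
  have 3: "K ((a + b) + (- c))"
  proof (rule triangle_closure)
    show "indep3 (a + b) (- b) (- c)"
      unfolding indep3_def
    proof (intro allI impI)
      fix x y z assume "x *s (a + b) + y *s (- b) + z *s (- c) = 0"
      then have "x *s a + (x - y) *s b + (- z) *s c = 0" by (simp add: vec_eq_iff algebra_simps)
      from ind'[OF this] show "x = 0 \<and> y = 0 \<and> z = 0" by auto
    qed
    show "K (a + b)" "K (- b)" "K (- c)" by (simp_all only: on_arc K_neg)
    show "K (a + b + - b)" using a by simp
    show "K (- b + - c)" using K_neg[of "b + c"] on_arc(3) by simp
  qed
  \<comment> \<open>In characteristic 3 the vector \<open>a + 2b + c\<close> is
    \<open>a - b + c\<close>, the affine point (-1, 1).\<close>
  have 4: "K ((a + b) + (b + c))"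
  proof (rule triangle_closure)
    show "indep3 (a + b) (- b) (b + c)"
      unfolding indep3_def
    proof (intro allI impI)
      fix x y z assume "x *s (a + b) + y *s (- b) + z *s (b + c) = 0"
      then have "x *s a + (x - y + z) *s b + z *s c = 0" by (simp add: vec_eq_iff algebra_simps)
      from ind'[OF this] show "x = 0 \<and> y = 0 \<and> z = 0" by auto
    qed
    show "K (a + b)" "K (- b)" "K (b + c)" by (simp_all only: on_arc K_neg)
    show "K (a + b + - b)" using a by simp
    show "K (- b + (b + c))" using on_arc(2) by simp
  qed
  \<comment> \<open>In this chart \<open>b\<close>, \<open>c\<close> and \<open>b + c\<close> are
    arc points at infinity, so rows, columns and diagonals carry exactly two affine arc points. The
    direction \<open>c - b\<close> of the antidiagonals is not known to be on the arc, which is why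
    only the bound 3 is used for them.\<close>
  define A where "A s t \<longleftrightarrow> K (a + s *s b + t *s c)" for s t
  show False
  proof (rule no_affine_cubic_arc[OF q, of A])
    fix t
    have "K (a + s *s b + t *s c) \<longleftrightarrow> K ((a + 0 *s b + t *s c) + s *s (1 *s b + 0 *s c))" for s
      by (simp add: add_ac)
    then show "card {s. A s t} = 2"
      unfolding A_def using line_count_in[OF indep3_imp_indep2[OF ind3, of 1 0 0 t]] on_arc(1) by simp
  next
    fix s
    have "K (a + s *s b + t *s c) \<longleftrightarrow> K ((a + s *s b + 0 *s c) + t *s (0 *s b + 1 *s c))" for t
      by (simp add: add_ac)
    then show "card {t. A s t} = 2"
      unfolding A_def using line_count_in[OF indep3_imp_indep2[OF ind3, of 0 1 s 0]] on_arc(2) by simp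
  next
    fix k
    have eq: "a + (t + k) *s b + t *s c = (a + k *s b + 0 *s c) + t *s (1 *s b + 1 *s c)" for t
      by (simp add: vec_eq_iff algebra_simps)
    show "card {t. A (t + k) t} = 2"
      unfolding A_def eq by (rule line_count_in[OF indep3_imp_indep2[OF ind3]]) (use on_arc(3) in auto)
  next
    fix k
    have eq: "a + (k - t) *s b + t *s c = (a + k *s b + 0 *s c) + t *s ((-1) *s b + 1 *s c)" for t
      by (simp add: vec_eq_iff algebra_simps)
    have "indep2 (a + k *s b + 0 *s c) ((-1) *s b + 1 *s c)" by (rule indep3_imp_indep2[OF ind3]) simp
    from line_count[OF this] show "card {t. A (k - t) t} \<le> 3"
      unfolding A_def eq by auto
  next
    have v4: "a + (- 1) *s b + 1 *s c = (a + b) + (b + c) - 3 *s b" by (simp add: vec_eq_iff algebra_simps)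
    show "A 0 0" "A 1 0" "A 0 1" using a(1) on_arc(4) 1 by (simp_all add: A_def)
    show "A (-1) (-1)" "A 1 (-1)" using 2 3 by (simp_all add: A_def algebra_simps)
    show "A (-1) 1" unfolding A_def v4 three using 4 by simp
  qed
qed

end

text \<open>By \<open>M1\<close> the two values \<open>y\<close> over each \<open>x\<close> are opposite, and by \<open>M2\<close> the quotient \<open>y\<^sup>2 / x\<close> does not
  depend on \<open>x\<close>, so that every \<open>x\<close> would be a square.\<close>
lemma no_symmetric_pairs:
  fixes B :: "('a::{field,finite} \<times> 'a) set"
  assumes q: "CARD('a) = 9" and B1: "\<And>x. x \<noteq> 0 \<Longrightarrow> card {y. (x, y) \<in> B} = 2"
    and B0: "\<And>x y. (x, y) \<in> B \<Longrightarrow> x \<noteq> 0 \<and> y \<noteq> 0"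
    and M1: "\<And>x0. x0 \<noteq> 0 \<Longrightarrow> (\<Sum>(x, y)\<in>B. y ^ 1 * (\<Prod>x'\<in>UNIV - {0, x0}. x - x')) = 0"
    and M2: "\<And>x0 x1. x0 \<noteq> 0 \<Longrightarrow> x1 \<noteq> 0 \<Longrightarrow> x0 \<noteq> x1 \<Longrightarrow>
      (\<Sum>(x, y)\<in>B. y ^ 2 * (\<Prod>x'\<in>UNIV - {0, x0, x1}. x - x')) = 0"
  shows False
proof -
  have three: "(3::'a) = 0" by (rule char3[OF q])
  have two: "(2::'a) \<noteq> 0"
  proof
    assume "(2::'a) = 0"
    then have "(3::'a) - 2 = 0" using three by simp
    then show False by simp
  qed
  define Y where "Y x = {y. (x, y) \<in> B}" for x
  have B_sigma: "B = (SIGMA x:UNIV. Y x)" by (auto simp: Y_def)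
  have sum_B: "(\<Sum>(x, y)\<in>B. y ^ j * g x) = (\<Sum>x\<in>UNIV. (\<Sum>y\<in>Y x. y ^ j) * g x)" for j and g :: "'a \<Rightarrow> 'a"
    unfolding B_sigma by (subst sum.Sigma[symmetric]) (auto simp: sum_distrib_right)
  have Y0: "Y 0 = {}" using B0 by (auto simp: Y_def)
  \<comment> \<open>The product is a Lagrange factor: it vanishes at every nonzero \<open>x\<close>
    except \<open>x0\<close>, and there is no pair over 0.\<close>
  have zero1: "(\<Sum>y\<in>Y x0. y ^ 1) = 0" if x0: "x0 \<noteq> 0" for x0
  proof -
    let ?g = "\<lambda>x. \<Prod>x'\<in>UNIV - {0, x0}. x - x'"
    have "(\<Sum>y\<in>Y x. y ^ 1) * ?g x = 0" if "x \<noteq> x0" for x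
      using that Y0 by (cases "x = 0") auto
    then have "(\<Sum>x\<in>UNIV. (\<Sum>y\<in>Y x. y ^ 1) * ?g x) = (\<Sum>x\<in>{x0}. (\<Sum>y\<in>Y x. y ^ 1) * ?g x)"
      by (intro sum.mono_neutral_right) auto
    then have "(\<Sum>y\<in>Y x0. y ^ 1) * ?g x0 = 0" using M1[OF x0] unfolding sum_B by simp
    moreover have "?g x0 \<noteq> 0" by auto
    ultimately show ?thesis by simp
  qed
  have ex: "\<exists>y. y \<noteq> 0 \<and> (\<Sum>y\<in>Y x. y ^ 2) = 2 * y^2" if x: "x \<noteq> 0" for x
  proof -
    have "card (Y x) = 2" using B1[OF x] by (simp add: Y_def)
    then obtain y y' where y: "Y x = {y, y'}" "y \<noteq> y'" by (auto simp: card_2_iff)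
    then have "y + y' = 0" using zero1[OF x] by simp
    then have "y' = - y" by (simp add: eq_neg_iff_add_eq_0 add.commute)
    moreover have "y \<noteq> 0" using y B0[of x y] by (auto simp: Y_def)
    ultimately show ?thesis using y by (intro exI[of _ y]) simp
  qed
  then obtain h where h: "\<And>x. x \<noteq> 0 \<Longrightarrow> h x \<noteq> 0 \<and> (\<Sum>y\<in>Y x. y ^ 2) = 2 * (h x)^2" by metis
  define w where "w = (\<Prod>x\<in>UNIV - {0::'a}. x)"
  have w: "w \<noteq> 0" by (simp add: w_def)
  have lagrange: "(\<Prod>x'\<in>UNIV - {0, x0, x1}. x0 - x') * (x0 * (x0 - x1)) = w"
    if "x0 \<noteq> 0" "x1 \<noteq> 0" "x0 \<noteq> x1" for x0 x1 :: 'a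
  proof -
    have "w = (\<Prod>x'\<in>UNIV - {x0}. x0 - x')"
      unfolding w_def by (rule prod.reindex_bij_witness[of _ "\<lambda>y. x0 - y" "\<lambda>y. x0 - y"]) auto
    also have "UNIV - {x0} = insert 0 (insert x1 (UNIV - {0, x0, x1}))" using that by auto
    also have "(\<Prod>x'\<in>\<dots>. x0 - x') = x0 * ((x0 - x1) * (\<Prod>x'\<in>UNIV - {0, x0, x1}. x0 - x'))"
      using that by simp
    finally show ?thesis by (simp add: mult_ac)
  qed
  \<comment> \<open>The factor now vanishes except at \<open>x0\<close> and \<open>x1\<close>, so
    one linear relation between their two power sums remains; \<open>lagrange\<close> evaluates its
    coefficients up to the common constant \<open>w\<close>.\<close>
  have square: "(h x0)^2 * x1 = (h x1)^2 * x0" if x: "x0 \<noteq> 0" "x1 \<noteq> 0" "x0 \<noteq> x1" for x0 x1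
  proof -
    let ?g = "\<lambda>x. \<Prod>x'\<in>UNIV - {0, x0, x1}. x - x'"
    have "(\<Sum>y\<in>Y z. y ^ 2) * ?g z = 0" if "z \<noteq> x0" "z \<noteq> x1" for z
      using that Y0 by (cases "z = 0") auto
    then have "(\<Sum>x\<in>UNIV. (\<Sum>y\<in>Y x. y ^ 2) * ?g x) = (\<Sum>x\<in>{x0, x1}. (\<Sum>y\<in>Y x. y ^ 2) * ?g x)"
      by (intro sum.mono_neutral_right) auto
    then have "2 * ((h x0)^2 * ?g x0 + (h x1)^2 * ?g x1) = 0"
      using M2[OF x] x h[OF x(1)] h[OF x(2)] unfolding sum_B by (simp add: algebra_simps)
    then have s: "(h x0)^2 * ?g x0 + (h x1)^2 * ?g x1 = 0" using two by (simp only: mult_eq_0_iff simp_thms)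
    have g0: "?g x0 * (x0 * (x0 - x1)) = w" using lagrange[OF x] .
    have g1: "?g x1 * (x1 * (x1 - x0)) = w"
      using lagrange[OF x(2,1)] x(3) by (simp add: insert_commute)
    have "0 = ((h x0)^2 * ?g x0 + (h x1)^2 * ?g x1) * (x0 * x1 * (x0 - x1))" using s by simp
    also have "\<dots> = (h x0)^2 * x1 * (?g x0 * (x0 * (x0 - x1))) - (h x1)^2 * x0 * (?g x1 * (x1 * (x1 - x0)))"
      by (simp add: algebra_simps)
    also have "\<dots> = ((h x0)^2 * x1 - (h x1)^2 * x0) * w" unfolding g0 g1 by (simp add: algebra_simps)
    finally show ?thesis using w by simp
  qed
  have "\<exists>s. s^2 = x" for x :: 'a
  proof (cases "x = 0 \<or> x = 1")
    case True
    then show ?thesis by (metis power_one zero_power2)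
  next
    case False
    then have "(h x)^2 * 1 = (h 1)^2 * x" by (intro square) auto
    moreover have "h 1 \<noteq> 0" using h[of 1] by simp
    ultimately have "(h x / h 1)^2 = x" by (simp add: power_divide field_simps)
    then show ?thesis by blast
  qed
  \<comment> \<open>On a finite set squaring would then be injective, although 1 and -1 have the
    same square.\<close>
  then have "surj (\<lambda>s::'a. s^2)" by (metis surjI)
  then have "inj (\<lambda>s::'a. s^2)" by (simp add: finite_UNIV_surj_inj)
  then have "(1::'a) = -1" by (rule injD) simp
  then have "(2::'a) = 0" by (simp add: eq_neg_iff_add_eq_0)
  then show False using two by simp
qed

text \<open>By \<open>pencil_sum_zero\<close>, the intersection numbers with \<open>A\<close>, read modulo \<open>3\<close>, are orthogonal to all products
  of eight linear forms in the line coordinates. In coordinates with respect to the triangle \<open>U\<close>, suitable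
  products that vanish on \<open>U\<close> give the moments of \<open>no_symmetric_pairs\<close> for the lines in \<open>W\<close>.\<close>
lemma no_triangle:
  fixes A :: "('a::{field,finite}^3) set set"
  assumes q: "CARD('a) = 9" and A: "A \<subseteq> PG_points" and U: "U \<subseteq> PG_lines" "card U = 3"
    and W: "W \<subseteq> PG_lines" "U \<inter> W = {}"
    and mod3: "\<And>L. L \<in> PG_lines \<Longrightarrow>
      pts_on (\<subseteq>) A L mod 3 = (if L \<in> U then 1 else if L \<in> W then 2 else 0)"
    and side: "\<And>L P. L \<in> U \<Longrightarrow> P \<in> PG_points \<Longrightarrow> P \<subseteq> L \<Longrightarrow>
      card {L \<in> U. P \<subseteq> L} = 2 \<and> card {L \<in> W. P \<subseteq> L} = 0 \<or>
      card {L \<in> U. P \<subseteq> L} = 1 \<and> card {L \<in> W. P \<subseteq> L} = 2"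
  shows False
proof -
  interpret proj_plane "PG_points :: ('a^3) set set" PG_lines "(\<subseteq>)" "CARD('a)" by (rule PG_proj_plane)
  have three: "(3::'a) = 0" by (rule char3[OF q])
  have two: "(2::'a) \<noteq> 0"
  proof
    assume "(2::'a) = 0"
    then have "(3::'a) - 2 = 0" using three by simp
    then show False by simp
  qed
  obtain l1 l2 l3 where l: "U = {l1, l2, l3}" "l1 \<noteq> l2" "l1 \<noteq> l3" "l2 \<noteq> l3"
    using U(2) by (auto simp: card_3_iff)
  have lL: "l1 \<in> PG_lines" "l2 \<in> PG_lines" "l3 \<in> PG_lines" using U l by auto
  have rep: "\<exists>u. u \<noteq> 0 \<and> L = line u" if "L \<in> PG_lines" for L :: "('a^3) set"
    using that unfolding PG_lines_eq by blast
  obtain u1 u2 u3 where u: "u1 \<noteq> 0" "l1 = line u1" "u2 \<noteq> 0" "l2 = line u2" "u3 \<noteq> 0" "l3 = line u3"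
    using rep[OF lL(1)] rep[OF lL(2)] rep[OF lL(3)] by blast
  have vertex: "\<exists>V. V \<noteq> 0 \<and> dot u V = 0 \<and> dot w V = 0"
    if "line u \<in> PG_lines" "line w \<in> PG_lines" "line u \<noteq> line w" for u w :: "'a^3"
  proof -
    have "card {P \<in> PG_points. P \<subseteq> line u \<and> P \<subseteq> line w} = 1" using that by (rule meet)
    then obtain P where "{P \<in> PG_points. P \<subseteq> line u \<and> P \<subseteq> line w} = {P}" by (rule card_1_singletonE)
    then have "P \<in> PG_points" "P \<subseteq> line u" "P \<subseteq> line w" by blast+
    moreover from this(1) obtain V where "V \<noteq> 0" "P = point V" unfolding PG_points_eq by blast
    ultimately show ?thesis using point_subset_line by blast
  qed
  obtain V1 where V1: "V1 \<noteq> 0" "dot u2 V1 = 0" "dot u3 V1 = 0" using vertex[of u2 u3] lL l u by blast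
  obtain V2 where V2: "V2 \<noteq> 0" "dot u1 V2 = 0" "dot u3 V2 = 0" using vertex[of u1 u3] lL l u by blast
  obtain V3 where V3: "V3 \<noteq> 0" "dot u1 V3 = 0" "dot u2 V3 = 0" using vertex[of u1 u2] lL l u by blast
  have pP: "point V \<in> PG_points" if "V \<noteq> 0" for V :: "'a^3" using that unfolding PG_points_eq by blast
  have side': "card {L \<in> U. point V \<subseteq> L} = 2 \<and> card {L \<in> W. point V \<subseteq> L} = 0 \<or>
      card {L \<in> U. point V \<subseteq> L} = 1 \<and> card {L \<in> W. point V \<subseteq> L} = 2"
    if "V \<noteq> 0" "dot w V = 0" "line w \<in> U" for V w
    using side[OF that(3) pP[OF that(1)]] that(2) point_subset_line by blast
  \<comment> \<open>By \<open>side\<close> no point of a line of \<open>U\<close> lies on all three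
    of them, so the lines form a proper triangle.\<close>
  have not_conc: "\<not> (dot u1 V = 0 \<and> dot u2 V = 0 \<and> dot u3 V = 0)" if V: "V \<noteq> 0" for V
  proof
    assume h: "dot u1 V = 0 \<and> dot u2 V = 0 \<and> dot u3 V = 0"
    then have "point V \<subseteq> l1" "point V \<subseteq> l2" "point V \<subseteq> l3" unfolding u point_subset_line by simp_all
    then have "{L \<in> U. point V \<subseteq> L} = U" using l(1) by blast
    then show False using side'[of V u1] V h U(2) l u by auto
  qed
  \<comment> \<open>Rescaled so that the three sides are the basis dual to the opposite
    vertices.\<close>
  define e1 e2 e3 where "e1 = (1 / dot u1 V1) *s u1" and "e2 = (1 / dot u2 V2) *s u2"
    and "e3 = (1 / dot u3 V3) *s u3"
  have d: "dot u1 V1 \<noteq> 0" "dot u2 V2 \<noteq> 0" "dot u3 V3 \<noteq> 0"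
    using not_conc[OF V1(1)] not_conc[OF V2(1)] not_conc[OF V3(1)] V1 V2 V3 by auto
  have e: "dot e1 V1 = 1" "dot e1 V2 = 0" "dot e1 V3 = 0" "dot e2 V1 = 0" "dot e2 V2 = 1" "dot e2 V3 = 0"
    "dot e3 V1 = 0" "dot e3 V2 = 0" "dot e3 V3 = 1"
    using d V1 V2 V3 by (simp_all add: e1_def e2_def e3_def dot_simps)
  have e0: "e1 \<noteq> 0" "e2 \<noteq> 0" "e3 \<noteq> 0" using e dot_zero_left by (metis zero_neq_one)+
  have line_scale: "line (c *s w) = line w" if "c \<noteq> 0" for c and w :: "'a^3"
    using that by (simp add: line_def dot_simps)
  have le: "l1 = line e1" "l2 = line e2" "l3 = line e3"
    using d unfolding e1_def e2_def e3_def u by (subst line_scale; simp)+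
  have two_U: "card {L \<in> U. point V \<subseteq> L} \<ge> 2"
    if "L \<in> U" "L' \<in> U" "L \<noteq> L'" "point V \<subseteq> L" "point V \<subseteq> L'" for V L L'
  proof -
    have "{L, L'} \<subseteq> {L \<in> U. point V \<subseteq> L}" using that by blast
    from card_mono[OF _ this] show ?thesis using that(3) by simp
  qed
  have avoid: "dot w V \<noteq> 0" if V: "V \<noteq> 0" and L: "line w \<in> W" and two: "card {L \<in> U. point V \<subseteq> L} \<ge> 2"
    and on: "dot w' V = 0" "line w' \<in> U" for w w' V
  proof
    assume "dot w V = 0"
    then have "line w \<in> {L \<in> W. point V \<subseteq> L}" using L point_subset_line by blast
    then have "card {L \<in> W. point V \<subseteq> L} \<noteq> 0" by (auto simp: card_eq_0_iff)
    then show False using side'[OF V on] two by auto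
  qed
  \<comment> \<open>Each vertex lies on two lines of \<open>U\<close>, and \<open>side\<close> then
    allows no line of \<open>W\<close> through it.\<close>
  have W_avoid: "dot w V1 \<noteq> 0" "dot w V2 \<noteq> 0" "dot w V3 \<noteq> 0" if "line w \<in> W" for w
  proof -
    show "dot w V1 \<noteq> 0"
      using that V1(1) e l le by (intro avoid[of V1 w e2] two_U[of l2 l3]) (auto simp only: point_subset_line)
    show "dot w V2 \<noteq> 0"
      using that V2(1) e l le by (intro avoid[of V2 w e1] two_U[of l1 l3]) (auto simp only: point_subset_line)
    show "dot w V3 \<noteq> 0"
      using that V3(1) e l le by (intro avoid[of V3 w e1] two_U[of l1 l2]) (auto simp only: point_subset_line)
  qed
  have nondeg: "w = 0" if w: "dot w V1 = 0" "dot w V2 = 0" "dot w V3 = 0" for w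
  proof (rule ccontr)
    assume w0: "w \<noteq> 0"
    have "point V1 \<noteq> point V2"
    proof
      assume "point V1 = point V2"
      then obtain c where "V2 = c *s V1" "c \<noteq> 0" using point_eq_iff[OF V1(1)] by blast
      then have "dot e1 V2 = c" using e by (simp add: dot_simps)
      then show False using e \<open>c \<noteq> 0\<close> by simp
    qed
    then have "card {L \<in> PG_lines. point V1 \<subseteq> L \<and> point V2 \<subseteq> L} = 1"
      using V1 V2 by (intro join pP)
    then obtain L where L: "{L \<in> PG_lines. point V1 \<subseteq> L \<and> point V2 \<subseteq> L} = {L}" by (rule card_1_singletonE)
    have "line w \<in> {L}" "line e3 \<in> {L}"
      unfolding L[symmetric] using w w0 e e0 by (simp_all add: PG_lines_eq point_subset_line)
    then have "line e3 = line w" by simp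
    then obtain c where "w = c *s e3" "c \<noteq> 0" using line_eq_iff[OF e0(3) w0] by blast
    then have "dot w V3 = c" using e by (simp add: dot_simps)
    then show False using w \<open>c \<noteq> 0\<close> by simp
  qed
  define uu where "uu x y = x *s e1 + y *s e2 + e3" for x y
  have uu: "dot (uu x y) V1 = x" "dot (uu x y) V2 = y" "dot (uu x y) V3 = 1" for x y
    using e by (simp_all add: uu_def dot_simps)
  have uu0: "uu x y \<noteq> 0" for x y using uu(3)[of x y] dot_zero_left by (metis zero_neq_one)
  have coords: "w = dot w V3 *s uu (dot w V1 / dot w V3) (dot w V2 / dot w V3)" if "dot w V3 \<noteq> 0" for w
  proof -
    have "w - dot w V3 *s uu (dot w V1 / dot w V3) (dot w V2 / dot w V3) = 0"
      by (rule nondeg) (use that in \<open>simp_all add: dot_simps uu\<close>)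
    then show ?thesis by simp
  qed
  \<comment> \<open>A line of \<open>W\<close> misses \<open>V3\<close>, so it has a unique
    coordinate vector of the form \<open>uu x y\<close>; as it also misses \<open>V1\<close> and
    \<open>V2\<close>, both \<open>x\<close> and \<open>y\<close> are nonzero.\<close>
  define B where "B = {(x, y). line (uu x y) \<in> W}"
  have bij: "bij_betw (\<lambda>(c, b). c *s uu (fst b) (snd b)) ((UNIV - {0}) \<times> B) {w. w \<noteq> 0 \<and> line w \<in> W}"
  proof (rule bij_betwI[where g = "\<lambda>w. (dot w V3, dot w V1 / dot w V3, dot w V2 / dot w V3)"])
    show "(\<lambda>(c, b). c *s uu (fst b) (snd b)) \<in> (UNIV - {0}) \<times> B \<rightarrow> {w. w \<noteq> 0 \<and> line w \<in> W}"
      using uu0 by (auto simp: B_def line_scale)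
    show "(\<lambda>w. (dot w V3, dot w V1 / dot w V3, dot w V2 / dot w V3))
        \<in> {w. w \<noteq> 0 \<and> line w \<in> W} \<rightarrow> (UNIV - {0}) \<times> B"
    proof
      fix w assume w: "w \<in> {w. w \<noteq> 0 \<and> line w \<in> W}"
      then have n: "dot w V3 \<noteq> 0" using W_avoid by blast
      have "line w = line (uu (dot w V1 / dot w V3) (dot w V2 / dot w V3))"
        using line_scale[OF n] coords[OF n] by metis
      then show "(dot w V3, dot w V1 / dot w V3, dot w V2 / dot w V3) \<in> (UNIV - {0}) \<times> B"
        using w n by (simp add: B_def)
    qed
    show "(\<lambda>w. (dot w V3, dot w V1 / dot w V3, dot w V2 / dot w V3)) ((\<lambda>(c, b). c *s uu (fst b) (snd b)) z) = z"
      if "z \<in> (UNIV - {0}) \<times> B" for z using that by (auto simp: dot_simps uu)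
    show "(\<lambda>(c, b). c *s uu (fst b) (snd b)) ((\<lambda>w. (dot w V3, dot w V1 / dot w V3, dot w V2 / dot w V3)) w) = w"
      if "w \<in> {w. w \<noteq> 0 \<and> line w \<in> W}" for w
      using that W_avoid(3)[of w] coords[of w] by simp
  qed
  have moment: "(\<Sum>(x, y)\<in>B. y ^ j * (\<Prod>x'\<in>X. x - x')) = 0"
    if j: "j \<noteq> 0" and X: "0 < card X" "j + card X = 8" for j and X :: "'a set"
  proof -
    \<comment> \<open>A product of \<open>j + card X = 8\<close> linear forms whose value at
      \<open>uu x y\<close> is the summand of the moment. Its degree \<open>q - 1\<close> makes it
      invariant under scaling.\<close>
    define M where "M w = dot w V2 ^ j * (\<Prod>x'\<in>X. dot w (V1 - x' *s V3))" for w
    have finX: "finite X" and ne: "X \<noteq> {}" using X(1) by auto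
    have M0: "M 0 = 0" using j by (simp add: M_def dot_simps)
    have M_scale: "M (c *s w) = M w" if "c \<noteq> 0" for c w
    proof -
      have "M (c *s w) = c ^ (j + card X) * M w"
        unfolding M_def dot_scale_left power_mult_distrib prod.distrib prod_constant power_add
        by (simp only: mult_ac)
      then show ?thesis using power_card_minus_one[OF that] q X by simp
    qed
    \<comment> \<open>The factor at \<open>V2\<close> vanishes on \<open>e1\<close> and
      \<open>e3\<close>, and each factor indexed by \<open>X\<close> vanishes on \<open>e2\<close>;
      this is where \<open>j \<noteq> 0\<close> and \<open>X\<close> nonempty enter.\<close>
    have M_U: "M w = 0" if wU: "w \<noteq> 0" "line w \<in> U" for w
    proof -
      have "line w = l1 \<or> line w = l2 \<or> line w = l3" using wU(2) l(1) by blast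
      then have "\<exists>i. i \<in> {e1, e2, e3} \<and> line i = line w \<and> i \<noteq> 0" unfolding le using e0 by auto
      then obtain i where i: "i \<in> {e1, e2, e3}" "line i = line w" "i \<noteq> 0" by blast
      then obtain c where "w = c *s i" "c \<noteq> 0" using line_eq_iff[OF i(3) wU(1)] by blast
      then have "M w = M i" using M_scale by simp
      also have "\<dots> = 0" using i(1) e j ne by (auto simp: M_def dot_simps prod_zero_iff[OF finX] power_0_left)
      finally show ?thesis .
    qed
    let ?n = "\<lambda>w. of_nat (pts_on (\<subseteq>) A (line w)) :: 'a"
    have finA: "finite A" by simp
    have "(\<Sum>w\<in>UNIV - {0}. ?n w * M w) = (\<Sum>w\<in>UNIV - {0}. \<Sum>P\<in>A. if P \<subseteq> line w then M w else 0)"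
      by (intro sum.cong) (simp_all add: pts_on_def sum.If_cases Collect_conj_eq Int_commute)
    also have "\<dots> = (\<Sum>P\<in>A. \<Sum>w\<in>UNIV - {0}. if P \<subseteq> line w then M w else 0)" by (rule sum.swap)
    also have "\<dots> = 0"
    proof (rule sum.neutral, rule ballI)
      fix P assume "P \<in> A"
      then obtain x where x: "x \<noteq> 0" "P = point x" using A unfolding PG_points_eq by blast
      have "(\<Sum>w\<in>UNIV - {0}. if P \<subseteq> line w then M w else 0) = (\<Sum>w | dot x w = 0. M w)"
        unfolding x(2) point_subset_line dot_commute[of _ x] using M0
        by (intro sum.mono_neutral_cong) auto
      also have "\<dots> = 0" unfolding M_def using x(1) X q by (intro pencil_sum_zero) auto
      finally show "(\<Sum>w\<in>UNIV - {0}. if P \<subseteq> line w then M w else 0) = 0" .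
    qed
    finally have "0 = (\<Sum>w\<in>UNIV - {0}. ?n w * M w)" by simp
    also have "\<dots> = (\<Sum>w\<in>UNIV - {0}. if line w \<in> W then 2 * M w else 0)"
    proof (rule sum.cong)
      fix w :: "'a^3" assume "w \<in> UNIV - {0}"
      then have w: "w \<noteq> 0" "line w \<in> PG_lines" by (auto simp: PG_lines_eq)
      have "?n w = of_nat (pts_on (\<subseteq>) A (line w) div 3 * 3 + pts_on (\<subseteq>) A (line w) mod 3)"
        by (simp only: div_mult_mod_eq)
      also have "\<dots> = of_nat (pts_on (\<subseteq>) A (line w) mod 3)"
        by (simp only: of_nat_add of_nat_mult) (simp add: three)
      finally have "?n w = (if line w \<in> U then 1 else if line w \<in> W then 2 else 0)"
        unfolding mod3[OF w(2)] by simp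
      then show "?n w * M w = (if line w \<in> W then 2 * M w else 0)" using M_U[OF w(1)] W(2) by auto
    qed simp
    also have "\<dots> = (\<Sum>w | w \<noteq> 0 \<and> line w \<in> W. 2 * M w)"
      by (intro sum.mono_neutral_cong_right) auto
    finally have "2 * (\<Sum>w | w \<noteq> 0 \<and> line w \<in> W. M w) = 0" by (simp add: sum_distrib_left)
    then have "0 = (\<Sum>w | w \<noteq> 0 \<and> line w \<in> W. M w)" using two by (simp only: mult_eq_0_iff simp_thms)
    also have "\<dots> = (\<Sum>(c, b)\<in>(UNIV - {0}) \<times> B. M (c *s uu (fst b) (snd b)))"
      using sum.reindex_bij_betw[OF bij, of M] by (simp add: case_prod_unfold)
    also have "\<dots> = (\<Sum>c\<in>UNIV - {0::'a}. \<Sum>b\<in>B. M (c *s uu (fst b) (snd b)))"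
      by (rule sum.cartesian_product[symmetric])
    also have "\<dots> = (\<Sum>c\<in>UNIV - {0::'a}. \<Sum>b\<in>B. M (uu (fst b) (snd b)))"
      by (intro sum.cong) (auto simp: M_scale)
    \<comment> \<open>The eight nonzero scalars contribute equally, and 8 is written as a power of 2
      because 2 is known to be nonzero.\<close>
    also have "\<dots> = 2^3 * (\<Sum>b\<in>B. M (uu (fst b) (snd b)))"
      using q by (simp add: card_Diff_singleton)
    finally have "(\<Sum>b\<in>B. M (uu (fst b) (snd b))) = 0"
      using power_not_zero[OF two, of 3] by (metis mult_eq_0_iff)
    then show ?thesis by (simp add: M_def dot_simps uu case_prod_unfold)
  qed
  show False
  proof (rule no_symmetric_pairs[OF q, of B])
    show "x \<noteq> 0 \<and> y \<noteq> 0" if "(x, y) \<in> B" for x y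
      using W_avoid[of "uu x y"] that by (simp add: B_def uu)
    show "(\<Sum>(x, y)\<in>B. y ^ 1 * (\<Prod>x'\<in>UNIV - {0, x0}. x - x')) = 0" if "x0 \<noteq> 0" for x0
    proof (rule moment)
      have c: "card (UNIV - {0, x0}) = 7" using that q by (simp add: card_Diff_subset)
      show "0 < card (UNIV - {0, x0})" "1 + card (UNIV - {0, x0}) = 8" unfolding c by simp_all
    qed simp
    show "(\<Sum>(x, y)\<in>B. y ^ 2 * (\<Prod>x'\<in>UNIV - {0, x0, x1}. x - x')) = 0"
      if "x0 \<noteq> 0" "x1 \<noteq> 0" "x0 \<noteq> x1" for x0 x1
    proof (rule moment)
      have c: "card (UNIV - {0, x0, x1}) = 6" using that q by (simp add: card_Diff_subset)
      show "0 < card (UNIV - {0, x0, x1})" "2 + card (UNIV - {0, x0, x1}) = 8" unfolding c by simp_all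
    qed simp
    show "card {y. (x, y) \<in> B} = 2" if x: "x \<noteq> 0" for x
    proof -
      \<comment> \<open>This point lies on the side \<open>l2\<close> and is not a vertex, so
        exactly two lines of \<open>W\<close> pass through it; they are the lines with first affine
        coordinate \<open>x\<close>.\<close>
      let ?V = "V1 - x *s V3"
      have dV: "dot e1 ?V = 1" "dot e2 ?V = 0" "dot e3 ?V = - x" using e by (simp_all add: dot_simps)
      have V0: "?V \<noteq> 0" using dV(1) dot_zero by (metis zero_neq_one)
      have "\<not> point ?V \<subseteq> l1" "point ?V \<subseteq> l2" "\<not> point ?V \<subseteq> l3"
        unfolding le point_subset_line dV using x by simp_all
      then have "{L \<in> U. point ?V \<subseteq> L} = {l2}" using l(1) by blast
      then have cW: "card {L \<in> W. point ?V \<subseteq> L} = 2"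
        using side'[OF V0 dV(2)] l le by simp
      have "bij_betw (\<lambda>y. line (uu x y)) {y. (x, y) \<in> B} {L \<in> W. point ?V \<subseteq> L}"
        unfolding bij_betw_def
      proof
        show "inj_on (\<lambda>y. line (uu x y)) {y. (x, y) \<in> B}"
        proof (rule inj_onI)
          fix y y' assume "line (uu x y) = line (uu x y')"
          then obtain c where c: "uu x y' = c *s uu x y" using line_eq_iff[OF uu0 uu0] by blast
          then have "dot (uu x y') V3 = c" by (simp add: dot_simps uu)
          then have "c = 1" by (simp add: uu)
          then have "dot (uu x y') V2 = dot (uu x y) V2" using c by simp
          then show "y = y'" by (simp add: uu)
        qed
        show "(\<lambda>y. line (uu x y)) ` {y. (x, y) \<in> B} = {L \<in> W. point ?V \<subseteq> L}"
        proof (intro equalityI subsetI)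
          fix L assume "L \<in> (\<lambda>y. line (uu x y)) ` {y. (x, y) \<in> B}"
          then obtain y where "L = line (uu x y)" "(x, y) \<in> B" by blast
          then show "L \<in> {L \<in> W. point ?V \<subseteq> L}"
            by (simp add: B_def point_subset_line dot_simps uu)
        next
          fix L assume L: "L \<in> {L \<in> W. point ?V \<subseteq> L}"
          then obtain w where w: "w \<noteq> 0" "L = line w" using W(1) unfolding PG_lines_eq by blast
          then have lw: "line w \<in> W" "dot w ?V = 0" using L point_subset_line by blast+
          have n: "dot w V3 \<noteq> 0" using W_avoid(3)[OF lw(1)] .
          have "dot w V1 = x * dot w V3" using lw(2) by (simp add: dot_simps)
          then have "w = dot w V3 *s uu x (dot w V2 / dot w V3)" using coords[OF n] n by simp
          then have "L = line (uu x (dot w V2 / dot w V3))" using line_scale[OF n] w(2) by metis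
          moreover from this have "(x, dot w V2 / dot w V3) \<in> B" using lw w by (simp add: B_def)
          ultimately show "L \<in> (\<lambda>y. line (uu x y)) ` {y. (x, y) \<in> B}" by blast
        qed
      qed
      from bij_betw_same_card[OF this] show ?thesis using cW by (rule trans)
    qed
  qed
qed

lemma bounded_plane_order9:
  assumes q: "CARD('a::{field,finite}) = 9"
  shows "bounded_plane (PG_points :: ('a^3) set set) PG_lines (\<subseteq>) CARD('a) 19"
proof -
  interpret proj_plane "PG_points :: ('a^3) set set" PG_lines "(\<subseteq>)" "CARD('a)" by (rule PG_proj_plane)
  show ?thesis
  proof (rule bounded_planeI)
    fix A D assume AD: "disjoint_pair A D" "card A = Suc 19" "card D = Suc 19"
    have AP: "A \<subseteq> PG_points" using AD by (simp add: disjoint_pair_def)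
    have "card A = 20" "card D = 20" using AD by simp_all
    from order9_cases[OF AD(1) this q] show False
    proof (elim disjE exE conjE)
      fix S :: "('a^3) set set"
      assume "S \<subseteq> PG_points" "card S = 21" "\<forall>l\<in>PG_lines. pts_on (\<subseteq>) S l \<in> {0, 3}"
      then have "cubic_arc S" using q by unfold_locales blast+
      then show False by (rule cubic_arc.no_cubic_arc)
    next
      fix U W :: "('a^3) set set"
      assume "U \<subseteq> PG_lines" "W \<subseteq> PG_lines" "card U = 3" "U \<inter> W = {}"
        and m: "\<forall>l\<in>PG_lines. pts_on (\<subseteq>) A l mod 3 = (if l \<in> U then 1 else if l \<in> W then 2 else 0)"
        and s: "\<forall>m\<in>U. \<forall>p\<in>PG_points. p \<subseteq> m \<longrightarrow>
           card {l \<in> U. p \<subseteq> l} = 2 \<and> card {l \<in> W. p \<subseteq> l} = 0 \<or>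
           card {l \<in> U. p \<subseteq> l} = 1 \<and> card {l \<in> W. p \<subseteq> l} = 2"
      note * = no_triangle[OF q AP this(1,3,2,4)]
      show False by (rule *) (use m s in blast)+
    qed
  qed
qed

section \<open>The ten planes\<close>

lemma PG_values:
  assumes q: "CARD('a::{field,finite}) = q"
    and bnd: "bounded_plane (PG_points :: ('a^3) set set) PG_lines (\<subseteq>) q (length S)"
    and check: "isoperimetric_check (int q) (int (length S)) (int t0)"
    and zech: "zech_field (g::'a) Z (int (length Z)) h"
    and pair: "pair_check (int (length Z)) Z S T" "length T = length S"
  shows "PG_incidence_free_number TYPE('a) = length S \<and>
    PG_isoperimetric_number TYPE('a) = 1 - real (length S) / real (q^2 + q + 1)"
proof -
  obtain A D where "A \<subseteq> (PG_points :: ('a^3) set set)" "D \<subseteq> PG_lines" "card A = length S"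
    "card D = length S" "\<And>P L. P \<in> A \<Longrightarrow> L \<in> D \<Longrightarrow> \<not> P \<subseteq> L"
    using zech_field.pair_check_sound[OF zech pair(1)] pair(2) by metis
  from PG_invariants[OF bnd[folded q] check[folded q] this] show ?thesis by (simp only: q)
qed

text \<open>The generator is the integer \<open>r\<close> itself, so \<open>rs\<close> has length
  one. The equation \<open>int q = r * k + 1\<close> certifies that \<open>r\<close> is nonzero in
  the field.\<close>

lemma PG_values_prime:
  assumes q: "CARD('a::{field,finite}) = q" "q = Suc (length Z)" "int q = r * k + 1"
    and "zech_check (int q) [r] Z h" "pair_check (int (length Z)) Z S T" "length T = length S"
    and "bounded_plane (PG_points :: ('a^3) set set) PG_lines (\<subseteq>) q (length S)"
    and "isoperimetric_check (int q) (int (length S)) (int t0)"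
  shows "PG_incidence_free_number TYPE('a) = length S \<and>
    PG_isoperimetric_number TYPE('a) = 1 - real (length S) / real (q^2 + q + 1)"
proof -
  have c: "of_int (int q) = (0::'a)" using q(1) by (intro of_int_char[of q 1]) simp
  have "of_int r \<noteq> (0::'a)"
  proof
    assume "of_int r = (0::'a)"
    then have "of_int (r * k + 1) = (1::'a)" by simp
    with c have "(1::'a) = 0" by (simp only: q(3))
    then show False by simp
  qed
  then have "zech_field (of_int r :: 'a) Z (int (length Z)) h"
    using q(1,2) by (intro zech_check_sound[OF assms(4) c]) (simp_all add: horner_Cons horner_Nil)
  from PG_values[OF q(1) assms(7,8) this assms(5,6)] show ?thesis .
qed

lemma PG_values_prime_power:
  assumes q: "CARD('a::{field,finite}) = q" "q = p ^ k" "q = Suc (length Z)"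
    and g: "\<exists>g::'a. g \<noteq> 0 \<and> g ^ length rs = horner g rs"
    and "zech_check (int p) rs Z h" "pair_check (int (length Z)) Z S T" "length T = length S"
    and "bounded_plane (PG_points :: ('a^3) set set) PG_lines (\<subseteq>) q (length S)"
    and "isoperimetric_check (int q) (int (length S)) (int t0)"
  shows "PG_incidence_free_number TYPE('a) = length S \<and>
    PG_isoperimetric_number TYPE('a) = 1 - real (length S) / real (q^2 + q + 1)"
proof -
  obtain g :: 'a where "g ^ length rs = horner g rs" "g \<noteq> 0" using g by blast
  then have "zech_field g Z (int (length Z)) h"
    using q by (intro zech_check_sound[OF assms(5) of_int_char[of p k]]) simp_all
  from PG_values[OF q(1) assms(8,9) this assms(6,7)] show ?thesis .
qed

lemma bounded_plane_PG:
  assumes "CARD('a::{field,finite}) = q" "violates_quadratic (int q) (int \<alpha> + 1) (int \<alpha> + 1)"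
  shows "bounded_plane (PG_points :: ('a^3) set set) PG_lines (\<subseteq>) q \<alpha>"
  using proj_plane.bounded_plane_quadratic[OF PG_proj_plane[where 'a='a]] assms by simp

lemma bounded_plane_PG_5_9:
  "CARD('a::{field,finite}) = 5 \<Longrightarrow> bounded_plane (PG_points :: ('a^3) set set) PG_lines (\<subseteq>) 5 7"
  "CARD('a::{field,finite}) = 9 \<Longrightarrow> bounded_plane (PG_points :: ('a^3) set set) PG_lines (\<subseteq>) 9 19"
  using proj_plane.bounded_plane_order5[OF PG_proj_plane[where 'a='a]] bounded_plane_order9[where 'a='a]
  by simp_all

section \<open>Zech logarithms and extremal pairs for the ten orders\<close>

definition "zech2 = ([0] :: int list)"
definition "points2 = ([
     (1, 0, 0), (0, 1, 0)] :: (int \<times> int \<times> int) list)"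
definition "lines2 = ([
     (1, 1, 0), (1, 1, 1)] :: (int \<times> int \<times> int) list)"

definition "zech3 = ([2, 0] :: int list)"
definition "points3 = ([
     (1, 0, 0), (1, 1, 0), (1, 2, 0)] :: (int \<times> int \<times> int) list)"
definition "lines3 = ([
     (1, 0, 0), (1, 0, 1), (1, 0, 2)] :: (int \<times> int \<times> int) list)"

definition "zech4 = ([0, 3, 2] :: int list)"
text \<open>A hyperoval and its external lines: as (6 + 4)^2 = 4 * 5^2, Cauchy-Schwarz holds with
  equality, so every other line meets the six points in exactly two.\<close>

definition "points4 = ([
     (0, 1, 1), (0, 1, 3), (1, 0, 1), (1, 0, 2), (1, 2, 1), (1, 2, 2)] :: (int \<times> int \<times> int) list)"
definition "lines4 = ([
     (0, 0, 1), (0, 1, 3), (1, 0, 2), (1, 1, 0), (1, 2, 0), (1, 3, 2)] :: (int \<times> int \<times> int) list)"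

definition "zech5 = ([2, 4, 0, 3] :: int list)"
definition "points5 = ([
     (0, 1, 2), (0, 1, 3), (1, 0, 0), (1, 0, 4), (1, 1, 1), (1, 1, 4), (1, 2, 0)] :: (int \<times> int \<times> int) list)"
definition "lines5 = ([
     (1, 0, 1), (1, 0, 2), (1, 1, 0), (1, 1, 3), (1, 4, 3), (1, 3, 1), (1, 3, 2)] :: (int \<times> int \<times> int) list)"

definition "zech7 = ([3, 5, 2, 0, 6, 4] :: int list)"
definition "points7 = ([
     (0, 1, 1), (0, 1, 3), (1, 0, 3), (1, 0, 5), (1, 0, 6), (1, 1, 5), (1, 1, 6), (1, 3, 3),
     (1, 3, 2), (1, 2, 2), (1, 2, 4), (1, 6, 5), (1, 6, 4)] :: (int \<times> int \<times> int) list)"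
definition "lines7 = ([
     (0, 0, 1), (0, 1, 1), (0, 1, 3), (1, 0, 4), (1, 1, 0), (1, 3, 3), (1, 2, 1), (1, 5, 1),
     (1, 5, 3), (1, 6, 0), (1, 6, 4), (1, 4, 3), (1, 4, 4)] :: (int \<times> int \<times> int) list)"

definition "zech8 = ([0, 4, 7, 2, 6, 5, 3] :: int list)"
definition "points8 = ([
     (0, 1, 0), (0, 1, 4), (0, 1, 6), (1, 0, 2), (1, 0, 4), (1, 0, 6), (1, 4, 0), (1, 4, 4),
     (1, 3, 1), (1, 3, 3), (1, 3, 5), (1, 7, 0), (1, 7, 2), (1, 5, 1), (1, 5, 7), (1, 5, 5)] :: (int \<times> int \<times> int) list)"
definition "lines8 = ([
     (0, 1, 2), (0, 1, 4), (0, 1, 7), (1, 1, 0), (1, 1, 1), (1, 1, 4), (1, 4, 2), (1, 4, 4),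
     (1, 3, 0), (1, 3, 1), (1, 7, 0), (1, 7, 1), (1, 7, 6), (1, 6, 2), (1, 6, 4), (1, 6, 6)] :: (int \<times> int \<times> int) list)"

definition "zech9 = ([5, 3, 8, 7, 0, 4, 6, 2] :: int list)"
definition "points9 = ([
     (0, 1, 0), (0, 1, 2), (0, 1, 7), (1, 0, 1), (1, 0, 8), (1, 0, 6), (1, 5, 3), (1, 5, 8),
     (1, 5, 2), (1, 8, 1), (1, 8, 5), (1, 8, 3), (1, 8, 7), (1, 7, 7), (1, 7, 6), (1, 7, 4),
     (1, 4, 5), (1, 4, 2), (1, 4, 4)] :: (int \<times> int \<times> int) list)"
definition "lines9 = ([
     (0, 1, 1), (0, 1, 3), (1, 1, 1), (1, 1, 3), (1, 5, 0), (1, 5, 4), (1, 3, 0), (1, 3, 2),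
     (1, 8, 0), (1, 8, 7), (1, 2, 2), (1, 2, 4), (1, 7, 1), (1, 7, 7), (1, 6, 3), (1, 6, 2),
     (1, 6, 7), (1, 4, 0), (1, 4, 3)] :: (int \<times> int \<times> int) list)"

definition "zech11 = ([2, 9, 5, 7, 10, 0, 6, 4, 3, 8] :: int list)"
definition "points11 = ([
     (0, 1, 2), (0, 1, 9), (0, 1, 7), (0, 1, 6), (1, 3, 3), (1, 3, 5), (1, 3, 7), (1, 3, 6),
     (1, 5, 2), (1, 5, 5), (1, 5, 6), (1, 10, 8), (1, 10, 4), (1, 10, 7), (1, 8, 1), (1, 8, 2),
     (1, 8, 3), (1, 8, 5), (1, 4, 4), (1, 4, 7), (1, 4, 6), (1, 7, 1), (1, 7, 3), (1, 7, 8),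
     (1, 6, 1), (1, 6, 2), (1, 6, 8), (1, 6, 4)] :: (int \<times> int \<times> int) list)"
definition "lines11 = ([
     (0, 0, 1), (0, 1, 0), (0, 1, 7), (1, 0, 8), (1, 0, 7), (1, 1, 2), (1, 1, 3), (1, 2, 3),
     (1, 2, 5), (1, 9, 10), (1, 9, 4), (1, 9, 7), (1, 3, 5), (1, 3, 4), (1, 5, 0), (1, 5, 1),
     (1, 5, 8), (1, 10, 3), (1, 10, 6), (1, 8, 0), (1, 8, 6), (1, 4, 2), (1, 4, 9), (1, 4, 10),
     (1, 7, 9), (1, 7, 5), (1, 6, 0), (1, 6, 1)] :: (int \<times> int \<times> int) list)"

definition "zech13 = ([2, 5, 10, 9, 3, 12, 0, 7, 11, 6, 8, 4] :: int list)"
definition "points13 = ([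
     (0, 0, 1), (0, 1, 3), (0, 1, 11), (0, 1, 8), (1, 0, 10), (1, 0, 12), (1, 1, 10), (1, 1, 6),
     (1, 2, 3), (1, 2, 6), (1, 2, 4), (1, 5, 12), (1, 5, 4), (1, 3, 6), (1, 3, 8), (1, 10, 10),
     (1, 10, 8), (1, 10, 7), (1, 6, 10), (1, 6, 11), (1, 6, 7), (1, 12, 3), (1, 12, 4), (1, 4, 4),
     (1, 4, 9), (1, 4, 11), (1, 9, 11), (1, 9, 8), (1, 11, 12), (1, 11, 9), (1, 11, 8), (1, 8, 3),
     (1, 8, 11), (1, 7, 6), (1, 7, 9), (1, 7, 7)] :: (int \<times> int \<times> int) list)"
definition "lines13 = ([
     (0, 0, 1), (0, 1, 1), (0, 1, 11), (1, 0, 3), (1, 0, 6), (1, 0, 7), (1, 1, 1), (1, 1, 2),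
     (1, 1, 4), (1, 2, 12), (1, 2, 4), (1, 2, 9), (1, 5, 11), (1, 5, 7), (1, 3, 5), (1, 3, 6),
     (1, 10, 1), (1, 10, 4), (1, 6, 3), (1, 6, 12), (1, 6, 11), (1, 12, 2), (1, 12, 9), (1, 12, 7),
     (1, 4, 5), (1, 4, 9), (1, 9, 3), (1, 9, 6), (1, 9, 4), (1, 11, 2), (1, 11, 12), (1, 11, 11),
     (1, 8, 1), (1, 8, 9), (1, 7, 5), (1, 7, 7)] :: (int \<times> int \<times> int) list)"

definition "zech16 = ([0, 5, 9, 15, 2, 11, 14, 10, 3, 8, 6, 13, 12, 7, 4] :: int list)"
text \<open>A maximal arc of degree 4 and its external lines: as (52 + 16)^2 = 16 * 17^2,
  Cauchy-Schwarz holds with equality, so every other line meets the 52 points in exactly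
  four.\<close>

definition "points16 = ([
     (1, 0, 0), (1, 0, 9), (1, 0, 15), (1, 0, 7), (1, 1, 0), (1, 1, 11), (1, 1, 4), (1, 1, 13),
     (1, 5, 3), (1, 5, 6), (1, 5, 7), (1, 5, 12), (1, 3, 0), (1, 3, 5), (1, 3, 15), (1, 3, 10),
     (1, 9, 0), (1, 9, 5), (1, 9, 9), (1, 9, 6), (1, 6, 5), (1, 6, 11), (1, 6, 10), (1, 6, 12),
     (1, 11, 5), (1, 11, 3), (1, 11, 4), (1, 11, 13), (1, 4, 3), (1, 4, 9), (1, 4, 12), (1, 4, 13),
     (1, 15, 6), (1, 15, 11), (1, 15, 4), (1, 15, 15), (1, 7, 2), (1, 7, 3), (1, 7, 10), (1, 7, 7),
     (1, 14, 2), (1, 14, 9), (1, 14, 15), (1, 14, 12), (1, 12, 2), (1, 12, 11), (1, 12, 10),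
     (1, 12, 13), (1, 13, 2), (1, 13, 6), (1, 13, 4), (1, 13, 7)] :: (int \<times> int \<times> int) list)"
definition "lines16 = ([
     (1, 0, 0), (1, 0, 1), (1, 0, 3), (1, 0, 9), (1, 2, 7), (1, 2, 14), (1, 2, 12), (1, 2, 13),
     (1, 5, 3), (1, 5, 9), (1, 5, 6), (1, 5, 11), (1, 3, 5), (1, 3, 11), (1, 3, 4), (1, 3, 7),
     (1, 9, 0), (1, 9, 9), (1, 9, 4), (1, 9, 14), (1, 6, 5), (1, 6, 9), (1, 6, 15), (1, 6, 13),
     (1, 11, 1), (1, 11, 6), (1, 11, 15), (1, 11, 12), (1, 4, 1), (1, 4, 11), (1, 4, 15),
     (1, 4, 13), (1, 15, 0), (1, 15, 3), (1, 15, 15), (1, 15, 14), (1, 10, 3), (1, 10, 6),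
     (1, 10, 7), (1, 10, 12), (1, 7, 0), (1, 7, 5), (1, 7, 7), (1, 7, 13), (1, 12, 5), (1, 12, 6),
     (1, 12, 4), (1, 12, 14), (1, 13, 1), (1, 13, 11), (1, 13, 4), (1, 13, 12)] :: (int \<times> int \<times> int) list)"

text \<open>The lists encode \<open>g = r\<close> for a primitive root \<open>r\<close> in the prime
  fields, and \<open>g^2 = 1 + g\<close>, \<open>g^3 = 1 + g\<close>, \<open>g^4 = 1 + g\<close> in
  the others. The last argument is 0 in characteristic 2, where -1 = 1, and (q - 1) / 2
  otherwise.\<close>

lemma zech_checks:
  "zech_check 2 [1] zech2 0"
  "zech_check 3 [2] zech3 1"
  "zech_check 2 [1, 1] zech4 0"
  "zech_check 5 [2] zech5 2"
  "zech_check 7 [3] zech7 3"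
  "zech_check 2 [1, 1, 0] zech8 0"
  "zech_check 3 [1, 1] zech9 4"
  "zech_check 11 [2] zech11 5"
  "zech_check 13 [2] zech13 6"
  "zech_check 2 [1, 1, 0, 0] zech16 0"
  by code_simp+

lemma pair_checks:
  "pair_check 1 zech2 points2 lines2"
  "pair_check 2 zech3 points3 lines3"
  "pair_check 3 zech4 points4 lines4"
  "pair_check 4 zech5 points5 lines5"
  "pair_check 6 zech7 points7 lines7"
  "pair_check 7 zech8 points8 lines8"
  "pair_check 8 zech9 points9 lines9"
  "pair_check 10 zech11 points11 lines11"
  "pair_check 12 zech13 points13 lines13"
  "pair_check 15 zech16 points16 lines16"
  by code_simp+

lemma list_lengths:
  "length points2 = 2" "length lines2 = 2" "length zech2 = 1"
  "length points3 = 3" "length lines3 = 3" "length zech3 = 2"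
  "length points4 = 6" "length lines4 = 6" "length zech4 = 3"
  "length points5 = 7" "length lines5 = 7" "length zech5 = 4"
  "length points7 = 13" "length lines7 = 13" "length zech7 = 6"
  "length points8 = 16" "length lines8 = 16" "length zech8 = 7"
  "length points9 = 19" "length lines9 = 19" "length zech9 = 8"
  "length points11 = 28" "length lines11 = 28" "length zech11 = 10"
  "length points13 = 36" "length lines13 = 36" "length zech13 = 12"
  "length points16 = 52" "length lines16 = 52" "length zech16 = 15"
  by code_simp+

lemma generators:
  "CARD('a::{field,finite}) = 4 \<Longrightarrow> \<exists>g::'a. g \<noteq> 0 \<and> g ^ length [1, 1] = horner g [1, 1]"
  "CARD('a::{field,finite}) = 8 \<Longrightarrow> \<exists>g::'a. g \<noteq> 0 \<and> g ^ length [1, 1, 0] = horner g [1, 1, 0]"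
  "CARD('a::{field,finite}) = 9 \<Longrightarrow> \<exists>g::'a. g \<noteq> 0 \<and> g ^ length [1, 1] = horner g [1, 1]"
  "CARD('a::{field,finite}) = 16 \<Longrightarrow> \<exists>g::'a. g \<noteq> 0 \<and> g ^ length [1, 1, 0, 0] = horner g [1, 1, 0, 0]"
  using generator4[where 'a='a] generator8[where 'a='a] generator9[where 'a='a] generator16[where 'a='a]
  by (simp_all add: horner_Cons horner_Nil eval_nat_numeral)

lemmas PG_checks = violates_quadratic_instances isoperimetric_checks zech_checks pair_checks list_lengths

lemma PG_values_2:
  assumes q: "CARD('a::{field,finite}) = 2"
  shows "PG_incidence_free_number TYPE('a) = 2 \<and>
    PG_isoperimetric_number TYPE('a) = 1 - real 2 / real (2^2 + 2 + 1)"
  by (rule PG_values_prime[OF q, of zech2 1 1 0 points2 lines2 3, unfolded list_lengths])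
    (simp_all add: PG_checks bounded_plane_PG[OF q])

lemma PG_values_3:
  assumes q: "CARD('a::{field,finite}) = 3"
  shows "PG_incidence_free_number TYPE('a) = 3 \<and>
    PG_isoperimetric_number TYPE('a) = 1 - real 3 / real (3^2 + 3 + 1)"
  by (rule PG_values_prime[OF q, of zech3 2 1 1 points3 lines3 6, unfolded list_lengths])
    (simp_all add: PG_checks bounded_plane_PG[OF q])

lemma PG_values_4:
  assumes q: "CARD('a::{field,finite}) = 4"
  shows "PG_incidence_free_number TYPE('a) = 6 \<and>
    PG_isoperimetric_number TYPE('a) = 1 - real 6 / real (4^2 + 4 + 1)"
  by (rule PG_values_prime_power[OF q _ _ generators(1)[OF q], of 2 2 zech4 0 points4 lines4 10, unfolded list_lengths])
    (simp_all add: PG_checks bounded_plane_PG[OF q])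

lemma PG_values_5:
  assumes q: "CARD('a::{field,finite}) = 5"
  shows "PG_incidence_free_number TYPE('a) = 7 \<and>
    PG_isoperimetric_number TYPE('a) = 1 - real 7 / real (5^2 + 5 + 1)"
  by (rule PG_values_prime[OF q, of zech5 2 2 2 points5 lines5 15, unfolded list_lengths])
    (simp_all add: PG_checks bounded_plane_PG_5_9(1)[OF q])

lemma PG_values_7:
  assumes q: "CARD('a::{field,finite}) = 7"
  shows "PG_incidence_free_number TYPE('a) = 13 \<and>
    PG_isoperimetric_number TYPE('a) = 1 - real 13 / real (7^2 + 7 + 1)"
  by (rule PG_values_prime[OF q, of zech7 3 2 3 points7 lines7 29, unfolded list_lengths])
    (simp_all add: PG_checks bounded_plane_PG[OF q])

lemma PG_values_8:
  assumes q: "CARD('a::{field,finite}) = 8"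
  shows "PG_incidence_free_number TYPE('a) = 16 \<and>
    PG_isoperimetric_number TYPE('a) = 1 - real 16 / real (8^2 + 8 + 1)"
  by (rule PG_values_prime_power[OF q _ _ generators(2)[OF q], of 2 3 zech8 0 points8 lines8 37, unfolded list_lengths])
    (simp_all add: PG_checks bounded_plane_PG[OF q])

lemma PG_values_9:
  assumes q: "CARD('a::{field,finite}) = 9"
  shows "PG_incidence_free_number TYPE('a) = 19 \<and>
    PG_isoperimetric_number TYPE('a) = 1 - real 19 / real (9^2 + 9 + 1)"
  by (rule PG_values_prime_power[OF q _ _ generators(3)[OF q], of 3 2 zech9 4 points9 lines9 46, unfolded list_lengths])
    (simp_all add: PG_checks bounded_plane_PG_5_9(2)[OF q])

lemma PG_values_11:
  assumes q: "CARD('a::{field,finite}) = 11"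
  shows "PG_incidence_free_number TYPE('a) = 28 \<and>
    PG_isoperimetric_number TYPE('a) = 1 - real 28 / real (11^2 + 11 + 1)"
  by (rule PG_values_prime[OF q, of zech11 2 5 5 points11 lines11 69, unfolded list_lengths])
    (simp_all add: PG_checks bounded_plane_PG[OF q])

lemma PG_values_13:
  assumes q: "CARD('a::{field,finite}) = 13"
  shows "PG_incidence_free_number TYPE('a) = 36 \<and>
    PG_isoperimetric_number TYPE('a) = 1 - real 36 / real (13^2 + 13 + 1)"
  by (rule PG_values_prime[OF q, of zech13 2 6 6 points13 lines13 95, unfolded list_lengths])
    (simp_all add: PG_checks bounded_plane_PG[OF q])

lemma PG_values_16:
  assumes q: "CARD('a::{field,finite}) = 16"
  shows "PG_incidence_free_number TYPE('a) = 52 \<and>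
    PG_isoperimetric_number TYPE('a) = 1 - real 52 / real (16^2 + 16 + 1)"
  by (rule PG_values_prime_power[OF q _ _ generators(4)[OF q], of 2 4 zech16 0 points16 lines16 143, unfolded list_lengths])
    (simp_all add: PG_checks bounded_plane_PG[OF q])

section \<open>Prime powers up to 16 and the table\<close>

lemma not_primepow_two_primes:
  fixes n :: nat
  assumes "prime a" "prime b" "a \<noteq> b" "a dvd n" "b dvd n"
  shows "\<not> primepow n"
proof
  assume "primepow n"
  then obtain p k where p: "prime p" "n = p ^ k" by (auto simp: primepow_def)
  then have "a dvd p" "b dvd p" using assms prime_dvd_power by blast+
  then have "a = p" "b = p" using assms p by (simp_all add: primes_dvd_imp_eq)
  then show False using assms by simp
qed

lemma primepow_le_16:
  fixes q :: nat
  assumes "primepow q" "q \<le> 16"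
  shows "q \<in> {2, 3, 4, 5, 7, 8, 9, 11, 13, 16}"
proof -
  have "q \<noteq> 6" using not_primepow_two_primes[of 2 3 6] assms by auto
  moreover have "q \<noteq> 10" using not_primepow_two_primes[of 2 5 10] assms by auto
  moreover have "q \<noteq> 12" using not_primepow_two_primes[of 2 3 12] assms by auto
  moreover have "q \<noteq> 14" using not_primepow_two_primes[of 2 7 14] assms by auto
  moreover have "q \<noteq> 15" using not_primepow_two_primes[of 3 5 15] assms by auto
  moreover have "1 < q" using primepow_gt_Suc_0[OF assms(1)] by simp
  ultimately show ?thesis using assms(2) by simp presburger
qed

theorem theorem2:
  fixes q :: nat
  assumes "primepow q" and "q \<le> 16"
    and "CARD('a::{field,finite}) = q"
  shows "(q, PG_incidence_free_number TYPE('a), PG_isoperimetric_number TYPE('a)) \<in>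
           {(2, 2, 5/7), (3, 3, 10/13), (4, 6, 5/7), (5, 7, 24/31), (7, 13, 44/57),
            (8, 16, 57/73), (9, 19, 72/91), (11, 28, 15/19), (13, 36, 49/61), (16, 52, 17/21)} \<and>
         PG_isoperimetric_number TYPE('a) =
           1 - real (PG_incidence_free_number TYPE('a)) / real (q^2 + q + 1)"
proof -
  have "q \<in> {2, 3, 4, 5, 7, 8, 9, 11, 13, 16}" by (rule primepow_le_16[OF assms(1,2)])
  then consider "q = 2" | "q = 3" | "q = 4" | "q = 5" | "q = 7" | "q = 8" | "q = 9" | "q = 11" | "q = 13" | "q = 16" by blast
  then show ?thesis
  proof cases
    case 1
    then show ?thesis using PG_values_2[where 'a='a] assms(3) by simp
  next
    case 2
    then show ?thesis using PG_values_3[where 'a='a] assms(3) by simp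
  next
    case 3
    then show ?thesis using PG_values_4[where 'a='a] assms(3) by simp
  next
    case 4
    then show ?thesis using PG_values_5[where 'a='a] assms(3) by simp
  next
    case 5
    then show ?thesis using PG_values_7[where 'a='a] assms(3) by simp
  next
    case 6
    then show ?thesis using PG_values_8[where 'a='a] assms(3) by simp
  next
    case 7
    then show ?thesis using PG_values_9[where 'a='a] assms(3) by simp
  next
    case 8
    then show ?thesis using PG_values_11[where 'a='a] assms(3) by simp
  next
    case 9
    then show ?thesis using PG_values_13[where 'a='a] assms(3) by simp
  next
    case 10
    then show ?thesis using PG_values_16[where 'a='a] assms(3) by simp
  qed
qed

end
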